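(* Let $\beta>\beta_c$ and consider the infinite-volume zero-field heat-bath Glauber dynamics of the two-dimensional Ising model on $\Omega=\{-1,+1\}^{\mathbb Z^2}$ at inverse temperature $\beta$. Then $$\mathcal A_{\mathrm{anti}}\subset S_{C_0}\subset S_R .$$ In particular, $S_{C_0}$ and $S_R$ are dense in $\Omega$ and are semigroup-absorbing in the universally completed sense: for $C\in\{C_0,R\}$, the set $S_C$ is universally measurable, and $P_u(\xi,S_C)=1$ for every $\xi\in S_C$ and every $u\ge 0$.
   Context: $\Omega=\{-1,+1\}^{\mathbb Z^2}$ carries the product topology and its Borel $\sigma$-algebra. $\beta_c$ is the critical inverse temperature of the nearest-neighbour ferromagnetic Ising model on $\mathbb Z^2$ (Hamiltonian $-\sum_{i\sim j}\sigma_i\sigma_j$, zero external field). For $\beta>\beta_c$, $\mu^+$ and $\mu^-$ are the infinite-volume plus and minus phases, and $m_\beta=\int\sigma_0\,d\mu^+>0$ is the spontaneous magnetization. Dynamics: $(\sigma_t)_{t\ge0}$ is the continuous-time heat-bath Glauber dynamics on $\Omega$, built by the Harris graphical construction: each site $i\in\mathbb Z^2$ carries an independent rate-1 Poisson clock, and when the clock at $i$ rings, the spin at $i$ is resampled (using an independent uniform mark) to be $+1$ with probability $\bigl(1+\exp(-2\beta\sum_{j\sim i}\sigma_j)\bigr)^{-1}$ and $-1$ otherwise. $\mathbb P_\xi$ is the law of the process started from $\xi$ on the Skorokhod space $D([0,\infty),\Omega)$, and $P_t(\xi,\cdot)$ is its transition kernel. Probability measures are extended to universally measurable sets (those measurable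 for the completion of every Borel probability measure). Block magnetization: $\Lambda_n=[-n,n]^2\cap\mathbb Z^2$ and $M_n(\sigma)=|\Lambda_n|^{-1}\sum_{i\in\Lambda_n}\sigma_i$. Sectors: $P^\pm=\{\sigma\in\Omega:M_n(\sigma)\to\pm m_\beta\}$, $R=\Omega\setminus(P^+\cup P^-)$, $C_0=\{\sigma\in\Omega:M_n(\sigma)\to0\}$. For Borel $C\subset\Omega$, let $H_C=\{\omega\in D([0,\infty),\Omega):\omega(t)\in C\text{ for all }t\ge0\}$ and $S_C=C\cap\{\xi\in\Omega:\mathbb P_\xi(H_C)=1\}$, where $\mathbb P_\xi(H_C)$ is taken in the completion of $\mathbb P_\xi$. Translations: $(\tau_u\sigma)_i=\sigma_{i-u}$ for $u\in\mathbb Z^2$. Global spin-flip: $(\Theta\sigma)_i=-\sigma_i$. $\mathcal A_{\mathrm{anti}}$ is the set of $\eta\in\Omega$ for which there exist a finite-index subgroup $L\subset\mathbb Z^2$ and $u\in\mathbb Z^2$ such that $\tau_\ell\eta=\eta$ for all $\ell\in L$ and $\tau_u\eta=\Theta\eta$. *)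

theory Defs
  imports "HOL-Probability.Probability" "HOL-Algebra.Elementary_Groups"
begin

section \<open>Configurations\<close>

type_synonym site = "int \<times> int"

text \<open>
  A spin is a Boolean, \<open>True\<close> standing for \<open>+1\<close> and \<open>False\<close> for \<open>-1\<close>. As \<open>bool\<close> carries
  the discrete topology, the type \<open>config\<close> is the whole space $\{-1,+1\}^{\mathbb{Z}^2}$ with
  the product topology, and \<open>borel :: config measure\<close> is its Borel sigma-algebra.
\<close>

type_synonym config = "site \<Rightarrow> bool"

definition spin :: "bool \<Rightarrow> real" where
  "spin b = (if b then 1 else - 1)"

definition adjacent :: "site \<Rightarrow> site \<Rightarrow> bool" where
  "adjacent i j \<longleftrightarrow> \<bar>fst i - fst j\<bar> + \<bar>snd i - snd j\<bar> = 1"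

definition box :: "nat \<Rightarrow> site set" where
  "box n = {- int n..int n} \<times> {- int n..int n}"

definition block_mag :: "nat \<Rightarrow> config \<Rightarrow> real" where
  "block_mag n \<sigma> = (\<Sum>i\<in>box n. spin (\<sigma> i)) / real (card (box n))"

definition translate :: "site \<Rightarrow> config \<Rightarrow> config" where
  "translate u \<sigma> = (\<lambda>i. \<sigma> (i - u))"

definition flip :: "config \<Rightarrow> config" where
  "flip \<sigma> = (\<lambda>i. \<not> \<sigma> i)"

section \<open>Equilibrium: plus phase, spontaneous magnetization, critical point\<close>

text \<open>Edges are unordered pairs; those with at least one endpoint in the box contribute.\<close>

definition box_edges :: "nat \<Rightarrow> site set set" where
  "box_edges n = {e. \<exists>i j. e = {i, j} \<and> adjacent i j \<and> e \<inter> box n \<noteq> {}}"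

definition ising_energy :: "nat \<Rightarrow> config \<Rightarrow> real" where
  "ising_energy n \<sigma> = - (\<Sum>e\<in>box_edges n. \<Prod>i\<in>e. spin (\<sigma> i))"

definition plus_configs :: "nat \<Rightarrow> config set" where
  "plus_configs n = {\<sigma>. \<forall>i. i \<notin> box n \<longrightarrow> \<sigma> i}"

definition plus_expectation :: "real \<Rightarrow> nat \<Rightarrow> (config \<Rightarrow> real) \<Rightarrow> real" where
  "plus_expectation \<beta> n f =
     (\<Sum>\<sigma>\<in>plus_configs n. f \<sigma> * exp (- \<beta> * ising_energy n \<sigma>)) /
     (\<Sum>\<sigma>\<in>plus_configs n. exp (- \<beta> * ising_energy n \<sigma>))"

text \<open>The plus phase is the weak limit of the finite-volume plus measures.\<close>

definition is_plus_phase :: "real \<Rightarrow> config measure \<Rightarrow> bool" where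
  "is_plus_phase \<beta> \<mu> \<longleftrightarrow>
     prob_space \<mu> \<and> sets \<mu> = sets borel \<and>
     (\<forall>f :: config \<Rightarrow> real. continuous_on UNIV f \<longrightarrow>
        (\<lambda>n. plus_expectation \<beta> n f) \<longlonglongrightarrow> (\<integral>\<sigma>. f \<sigma> \<partial>\<mu>))"

definition plus_phase :: "real \<Rightarrow> config measure" where
  "plus_phase \<beta> = (THE \<mu>. is_plus_phase \<beta> \<mu>)"

definition spont_mag :: "real \<Rightarrow> real" where
  "spont_mag \<beta> = (\<integral>\<sigma>. spin (\<sigma> (0, 0)) \<partial>plus_phase \<beta>)"

text \<open>
  The supremum is taken in \<^typ>\<open>ereal\<close>, since \<open>Sup\<close> on \<^typ>\<open>real\<close> is meaningful only for
  sets known to be bounded above.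
\<close>

definition beta_crit :: ereal where
  "beta_crit = (SUP \<beta>\<in>{\<beta>. 0 \<le> \<beta> \<and> spont_mag \<beta> = 0}. ereal \<beta>)"

section \<open>Path space\<close>

definition cadlag :: "(real \<Rightarrow> config) \<Rightarrow> bool" where
  "cadlag \<omega> \<longleftrightarrow>
     (\<forall>t\<ge>0. (\<omega> \<longlongrightarrow> \<omega> t) (at_right t)) \<and>
     (\<forall>t>0. \<exists>l. (\<omega> \<longlongrightarrow> l) (at_left t))"

text \<open>
  Paths are indexed by \<open>[0,\<infinity>)\<close>, i.e. they are \<^const>\<open>undefined\<close> at negative times. The
  Borel sigma-algebra of the Skorokhod topology is the one generated by the evaluations at
  fixed times; the latter description is used here.
\<close>

definition skorokhod :: "(real \<Rightarrow> config) set" where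
  "skorokhod = {\<omega> \<in> extensional {0..}. cadlag \<omega>}"

definition path_space :: "(real \<Rightarrow> config) measure" where
  "path_space = restrict_space (Pi\<^sub>M {0..} (\<lambda>_. borel)) skorokhod"

section \<open>Harris graphical construction of the heat-bath dynamics\<close>

text \<open>
  A sample \<open>h\<close> of the graphical representation attaches to the \<open>k\<close>-th ring of the clock at
  \<open>i\<close> the pair \<open>h (i, k)\<close> consisting of the exponential waiting time since the previous ring
  and the uniform mark.
\<close>

type_synonym harris = "site \<times> nat \<Rightarrow> real \<times> real"

definition harris_space :: "harris measure" where
  "harris_space =
     Pi\<^sub>M UNIV (\<lambda>_. density lborel (exponential_density 1) \<Otimes>\<^sub>M uniform_measure lborel {0..1})"

definition ring_time :: "harris \<Rightarrow> site \<Rightarrow> nat \<Rightarrow> real" where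
  "ring_time h i k = (\<Sum>l\<le>k. fst (h (i, l)))"

definition ring_mark :: "harris \<Rightarrow> site \<Rightarrow> nat \<Rightarrow> real" where
  "ring_mark h i k = snd (h (i, k))"

definition plus_prob :: "real \<Rightarrow> config \<Rightarrow> site \<Rightarrow> real" where
  "plus_prob \<beta> \<sigma> i = 1 / (1 + exp (- 2 * \<beta> * (\<Sum>j | adjacent i j. spin (\<sigma> j))))"

text \<open>
  \<open>\<omega>\<close> starts at \<open>\<xi>\<close>, and at each time \<open>t\<close> the spins whose clock rings are resampled given the
  configuration \<open>l\<close> just before \<open>t\<close>, while all the others keep their value.
\<close>

definition driven_by :: "real \<Rightarrow> config \<Rightarrow> harris \<Rightarrow> (real \<Rightarrow> config) \<Rightarrow> bool" where
  "driven_by \<beta> \<xi> h \<omega> \<longleftrightarrow>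
     \<omega> 0 = \<xi> \<and>
     (\<forall>t>0. \<forall>l. (\<omega> \<longlongrightarrow> l) (at_left t) \<longrightarrow>
        (\<forall>i. (\<forall>k. ring_time h i k = t \<longrightarrow> \<omega> t i = (ring_mark h i k \<le> plus_prob \<beta> l i)) \<and>
             ((\<forall>k. ring_time h i k \<noteq> t) \<longrightarrow> \<omega> t i = l i)))"

text \<open>
  Almost every \<open>h\<close> drives exactly one path; on the exceptional null set the path is
  (arbitrarily) constant. Measurability of \<open>h \<mapsto> glauber_path \<beta> \<xi> h\<close> is needed only up to
  null sets, whence the completion in the law.
\<close>

definition glauber_path :: "real \<Rightarrow> config \<Rightarrow> harris \<Rightarrow> (real \<Rightarrow> config)" where
  "glauber_path \<beta> \<xi> h =
     (if \<exists>!\<omega>. \<omega> \<in> skorokhod \<and> driven_by \<beta> \<xi> h \<omega>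
      then THE \<omega>. \<omega> \<in> skorokhod \<and> driven_by \<beta> \<xi> h \<omega>
      else (\<lambda>t\<in>{0..}. \<xi>))"

definition glauber_law :: "real \<Rightarrow> config \<Rightarrow> (real \<Rightarrow> config) measure" where
  "glauber_law \<beta> \<xi> = distr (completion harris_space) path_space (glauber_path \<beta> \<xi>)"

definition glauber_kernel :: "real \<Rightarrow> real \<Rightarrow> config \<Rightarrow> config measure" where
  "glauber_kernel \<beta> t \<xi> = distr (glauber_law \<beta> \<xi>) borel (\<lambda>\<omega>. \<omega> t)"

section \<open>Sectors and their survival sets\<close>

definition plus_sector :: "real \<Rightarrow> config set" where
  "plus_sector \<beta> = {\<sigma>. (\<lambda>n. block_mag n \<sigma>) \<longlonglongrightarrow> spont_mag \<beta>}"

definition minus_sector :: "real \<Rightarrow> config set" where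
  "minus_sector \<beta> = {\<sigma>. (\<lambda>n. block_mag n \<sigma>) \<longlonglongrightarrow> - spont_mag \<beta>}"

definition rest_sector :: "real \<Rightarrow> config set" where
  "rest_sector \<beta> = UNIV - (plus_sector \<beta> \<union> minus_sector \<beta>)"

definition zero_sector :: "config set" where
  "zero_sector = {\<sigma>. (\<lambda>n. block_mag n \<sigma>) \<longlonglongrightarrow> 0}"

definition staying_paths :: "config set \<Rightarrow> (real \<Rightarrow> config) set" where
  "staying_paths C = {\<omega> \<in> skorokhod. \<forall>t\<ge>0. \<omega> t \<in> C}"

text \<open>
  \<^const>\<open>emeasure\<close> vanishes outside the sigma-algebra, so the condition below includes
  measurability of \<open>staying_paths C\<close> for the completed law.
\<close>

definition survival_set :: "real \<Rightarrow> config set \<Rightarrow> config set" where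
  "survival_set \<beta> C =
     C \<inter> {\<xi>. emeasure (completion (glauber_law \<beta> \<xi>)) (staying_paths C) = 1}"

definition universally_measurable :: "'a::topological_space set \<Rightarrow> bool" where
  "universally_measurable A \<longleftrightarrow>
     (\<forall>\<mu>. prob_space \<mu> \<and> sets \<mu> = sets borel \<longrightarrow> A \<in> sets (completion \<mu>))"

abbreviation Z2 :: "site monoid" where
  "Z2 \<equiv> integer_group \<times>\<times> integer_group"

definition anti_periodic :: "config set" where
  "anti_periodic =
     {\<eta>. \<exists>L u. subgroup L Z2 \<and> finite (rcosets\<^bsub>Z2\<^esub> L) \<and>
           (\<forall>l\<in>L. translate l \<eta> = \<eta>) \<and> translate u \<eta> = flip \<eta>}"

end

(*
  Backward in time, the state of a site at time t depends only on finitely many rings: in a short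
  time window the sites whose clock rings form a subcritical site percolation, so no infinite
  chain of earlier and earlier neighbouring rings exists. Truncating the recursion along such
  chains after m steps gives observables of range m that agree with the true spins up to a set of
  sites of small density, and a variance bound for local observables yields that the block
  magnetization at a fixed time is asymptotically equal to its mean. Between times s and t it
  changes by at most twice the density of the sites that ring, hence by at most 2(t - s) + o(1);
  so the events "stay in the sector at all times" are decided, up to null sets, by rational times,
  which makes the survival sets Borel. If a translate of the initial configuration is its flip,
  the symmetries of the clocks and marks make the mean spin antiperiodic, and its block averages
  vanish in the limit. Absorption is the Markov property: by memorylessness, two independent
  graphical representations spliced at time u have again the law of a graphical representation.
  Finally zero_sector lies in rest_sector because spont_mag vanishes at 0, so that
  beta > beta_crit forces beta > 0 and a nonzero spontaneous magnetization.
*)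

theory Submission
  imports Defs "HOL-Real_Asymp.Real_Asymp"
begin

text \<open>In infinite volume there is no first ring after time 0, so a path cannot be built by
  processing the rings in order; a single spin has to be unwound backward instead. The sites that
  ring in a long time interval percolate, so such an interval says nothing about finiteness of the
  chains. The length 1/8 is chosen against the 4 neighbours of a site: at most 4^n walks of n steps,
  each with n + 1 sites that ring with probability at most 1/8 apiece, leave a geometric tail. Such
  windows suffice for all times because decreasing ring times converge, hence end up in one window.
  The dimension enters the law of large numbers through the box size (2n + 1)^2: covariances of
  finite range give variances of order n^-2, which are summable, so second moments already yield
  almost sure convergence. Reflecting a mark y to 1 - y turns \<open>\<le>\<close> into
  \<open>\<ge>\<close>, so the flip symmetry could fail at ties; the countably many values of
  \<open>plus_prob\<close> are avoided almost surely, which makes it an exact symmetry of the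
  paths.\<close>

text \<open>Sites are pairs, but quantifiers over sites should not be split into coordinates.\<close>

declare split_paired_All [simp del] split_paired_Ex [simp del]

text \<open>Second countable factors let \<open>sets_PiM_equal_borel\<close> identify the Borel sets
  of \<open>config\<close> with the product sigma-algebra, on which coordinatewise measurability
  rests.\<close>

instance bool :: second_countable_topology
proof
  show "\<exists>B :: bool set set. countable B \<and> open = generate_topology B"
    by (intro exI[of _ "range (\<lambda>a. {..< a}) \<union> range (\<lambda>a. {a <..})"])
       (auto simp: open_bool_def intro: countable_finite)
qed

section \<open>The dynamics driven by a fixed graphical representation\<close>

text \<open>Spins are discrete and a basic open set of the product constrains finitely many sites,
  so finitely many eventual equalities can be combined. This reduces every limit of a path to single
  spins.\<close>

lemma tendsto_config_iff:
  fixes l :: config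
  shows "(f \<longlongrightarrow> l) F \<longleftrightarrow> (\<forall>i. \<forall>\<^sub>F x in F. f x i = l i)"
proof
  assume f: "(f \<longlongrightarrow> l) F"
  show "\<forall>i. \<forall>\<^sub>F x in F. f x i = l i"
  proof
    fix i
    have "((\<lambda>x. f x i) \<longlongrightarrow> l i) F"
      using continuous_on_tendsto_compose[OF continuous_on_product_coordinates f] by simp
    then show "\<forall>\<^sub>F x in F. f x i = l i"
      by (simp add: tendsto_discrete)
  qed
next
  assume ev: "\<forall>i. \<forall>\<^sub>F x in F. f x i = l i"
  show "(f \<longlongrightarrow> l) F"
  proof (rule topological_tendstoI)
    fix S :: "config set" assume "open S" "l \<in> S"
    then obtain X where X: "l \<in> (\<Pi>\<^sub>E i\<in>UNIV. X i)" "finite {i. X i \<noteq> UNIV}" "(\<Pi>\<^sub>E i\<in>UNIV. X i) \<subseteq> S"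
      using product_topology_open_contains_basis[of "\<lambda>_. euclidean" UNIV S l]
      by (auto simp: open_fun_def)
    have "\<forall>\<^sub>F x in F. \<forall>i\<in>{i. X i \<noteq> UNIV}. f x i = l i"
      using X(2) ev by (intro eventually_ball_finite) auto
    then show "\<forall>\<^sub>F x in F. f x \<in> S"
    proof eventually_elim
      case (elim x)
      have "f x i \<in> X i" for i
        using elim X(1) by (cases "X i = UNIV") (auto simp: PiE_iff)
      then show ?case
        using X(3) by (auto simp: PiE_iff)
    qed
  qed
qed

lemma tendsto_config_unique:
  fixes l l' :: config
  assumes "F \<noteq> bot" "(f \<longlongrightarrow> l) F" "(f \<longlongrightarrow> l') F"
  shows "l = l'"
proof
  fix i
  have "\<forall>\<^sub>F x in F. l i = l' i"
    using assms(2,3)[unfolded tendsto_config_iff, rule_format, of i] by eventually_elim simp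
  then show "l i = l' i" using assms(1) by (simp add: eventually_const)
qed

lemma neighbours_eq:
  "{j. adjacent i j} =
     {(fst i + 1, snd i), (fst i - 1, snd i), (fst i, snd i + 1), (fst i, snd i - 1)}"
  by (cases i) (auto simp: adjacent_def abs_if split: if_splits)

lemma finite_neighbours [simp]: "finite {j. adjacent i j}"
  by (simp add: neighbours_eq)

lemma plus_prob_cong:
  assumes "\<And>j. adjacent i j \<Longrightarrow> \<sigma> j = \<sigma>' j"
  shows "plus_prob \<beta> \<sigma> i = plus_prob \<beta> \<sigma>' i"
  using assms unfolding plus_prob_def by (auto intro!: sum.cong)

section \<open>Backward recursion through the latest rings\<close>

text \<open>The latest ring strictly before \<open>t\<close> governs the left limit at
  \<open>t\<close>; \<open>ring_upto\<close> admits a ring at \<open>t\<close> itself and governs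
  the value. When the clocks are regular, neither selects an index before the first ring, where the
  initial spin is still in force.\<close>

definition ring_before :: "harris \<Rightarrow> real \<Rightarrow> site \<Rightarrow> nat \<Rightarrow> bool" where
  "ring_before h t i k \<longleftrightarrow> ring_time h i k < t \<and> t \<le> ring_time h i (Suc k)"

definition ring_upto :: "harris \<Rightarrow> real \<Rightarrow> site \<Rightarrow> nat \<Rightarrow> bool" where
  "ring_upto h t i k \<longleftrightarrow> ring_time h i k \<le> t \<and> t < ring_time h i (Suc k)"

text \<open>
  \<open>ev_val n i k\<close> is the spin chosen at the \<open>k\<close>-th ring of \<open>i\<close> when the recursion through the
  latest rings of the neighbours is cut off after \<open>n\<close> steps; \<open>deep n i k\<close> says that the
  cut-off is noticed, i.e. that there is a chain of \<open>n\<close> such steps.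
\<close>

primrec ev_val :: "real \<Rightarrow> config \<Rightarrow> harris \<Rightarrow> nat \<Rightarrow> site \<Rightarrow> nat \<Rightarrow> bool" where
  "ev_val \<beta> \<xi> h 0 = (\<lambda>i k. False)"
| "ev_val \<beta> \<xi> h (Suc n) = (\<lambda>i k. ring_mark h i k \<le> plus_prob \<beta>
     (\<lambda>j. (ring_time h i k \<le> ring_time h j 0 \<and> \<xi> j) \<or>
          (\<exists>l. ring_before h (ring_time h i k) j l \<and> ev_val \<beta> \<xi> h n j l)) i)"

primrec deep :: "harris \<Rightarrow> nat \<Rightarrow> site \<Rightarrow> nat \<Rightarrow> bool" where
  "deep h 0 = (\<lambda>i k. True)"
| "deep h (Suc n) = (\<lambda>i k. \<exists>j l. adjacent i j \<and> ring_before h (ring_time h i k) j l \<and> deep h n j l)"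

text \<open>All \<open>n\<close> at which the cut-off goes unnoticed give the same truncated value
  (\<open>ev_val_stable\<close>), so the existential picks out that common value.\<close>

definition resampled :: "real \<Rightarrow> config \<Rightarrow> harris \<Rightarrow> site \<Rightarrow> nat \<Rightarrow> bool" where
  "resampled \<beta> \<xi> h i k \<longleftrightarrow> (\<exists>n. \<not> deep h n i k \<and> ev_val \<beta> \<xi> h n i k)"

text \<open>The candidate for the left limit at \<open>t\<close>: the configuration that the
  heat-bath rule reads at a ring.\<close>

definition left_state :: "real \<Rightarrow> config \<Rightarrow> harris \<Rightarrow> real \<Rightarrow> config" where
  "left_state \<beta> \<xi> h t = (\<lambda>j. (t \<le> ring_time h j 0 \<and> \<xi> j) \<or>
     (\<exists>l. ring_before h t j l \<and> resampled \<beta> \<xi> h j l))"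

definition state :: "real \<Rightarrow> config \<Rightarrow> harris \<Rightarrow> real \<Rightarrow> config" where
  "state \<beta> \<xi> h t = (\<lambda>j. (t < ring_time h j 0 \<and> \<xi> j) \<or>
     (\<exists>l. ring_upto h t j l \<and> resampled \<beta> \<xi> h j l))"

definition regular :: "harris \<Rightarrow> bool" where
  "regular h \<longleftrightarrow> (\<forall>i k. 0 < fst (h (i, k))) \<and> (\<forall>i (m::nat). \<exists>k. real m < ring_time h i k)"

definition good :: "harris \<Rightarrow> bool" where
  "good h \<longleftrightarrow> regular h \<and> (\<forall>i k. \<exists>n. \<not> deep h n i k)"

lemma good_regular: "good h \<Longrightarrow> regular h"
  by (simp add: good_def)

lemma ring_time_0: "ring_time h i 0 = fst (h (i, 0))"
  and ring_time_Suc: "ring_time h i (Suc k) = ring_time h i k + fst (h (i, Suc k))"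
  by (simp_all add: ring_time_def)

lemma ring_time_cong: "(\<And>k. h (i, k) = h' (i, k)) \<Longrightarrow> ring_time h i = ring_time h' i"
  by (simp add: ring_time_def fun_eq_iff)

lemma ring_mark_cong: "(\<And>k. h (i, k) = h' (i, k)) \<Longrightarrow> ring_mark h i = ring_mark h' i"
  by (simp add: ring_mark_def fun_eq_iff)

lemma ring_before_cong: "(\<And>k. h (i, k) = h' (i, k)) \<Longrightarrow> ring_before h t i = ring_before h' t i"
  and ring_upto_cong: "(\<And>k. h (i, k) = h' (i, k)) \<Longrightarrow> ring_upto h t i = ring_upto h' t i"
  using ring_time_cong[of h i h'] by (simp_all add: ring_before_def ring_upto_def fun_eq_iff)

text \<open>If no chain of \<open>Suc n\<close> steps starts at a ring, no chain of \<open>n\<close>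
  steps starts at the latest rings of its neighbours, so the values fed into
  \<open>plus_prob\<close> are already stable. The base case is vacuous since
  \<open>deep h 0\<close> always holds.\<close>

lemma ev_val_stable:
  assumes "\<not> deep h n i k" "n \<le> m"
  shows "ev_val \<beta> \<xi> h m i k = ev_val \<beta> \<xi> h n i k"
  using assms
proof (induction n arbitrary: i k m)
  case (Suc n)
  then obtain m' where m: "m = Suc m'" "n \<le> m'"
    by (cases m) auto
  have "ev_val \<beta> \<xi> h m' j l = ev_val \<beta> \<xi> h n j l"
    if "adjacent i j" "ring_before h (ring_time h i k) j l" for j l
    using Suc.prems(1) that by (intro Suc.IH m(2)) (auto simp only: deep.simps)
  then show ?case
    unfolding m(1) ev_val.simps by (subst plus_prob_cong) auto
qed simp

lemma resampled_ev_val: "\<not> deep h n i k \<Longrightarrow> resampled \<beta> \<xi> h i k = ev_val \<beta> \<xi> h n i k"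
  unfolding resampled_def by (metis ev_val_stable nle_le)

section \<open>Locating the latest ring before a given time\<close>

context
  fixes h assumes h: "regular h"
begin

lemma waits_pos: "0 < fst (h (i, k))"
  using h by (simp add: regular_def)

lemma strict_mono_ring_time: "strict_mono (ring_time h i)"
  by (rule strict_monoI_Suc) (simp add: ring_time_Suc waits_pos)

lemma ring_time_less_iff: "ring_time h i k < ring_time h i l \<longleftrightarrow> k < l"
  by (simp add: strict_mono_less strict_mono_ring_time)

lemma ring_time_le_iff: "ring_time h i k \<le> ring_time h i l \<longleftrightarrow> k \<le> l"
  by (simp add: strict_mono_less_eq strict_mono_ring_time)

lemma ring_time_pos: "0 < ring_time h i k"
  using waits_pos[of i 0] ring_time_le_iff[of i 0 k] by (simp add: ring_time_0)

lemma ring_time_unbounded: "\<exists>k. t < ring_time h i k"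
proof -
  obtain m :: nat where "t < real m" using reals_Archimedean2 by blast
  then show ?thesis using h unfolding regular_def by (meson less_trans)
qed

lemma ring_upto_cases:
  obtains "t < ring_time h i 0" | k where "ring_upto h t i k"
proof -
  define m where "m = (LEAST k. t < ring_time h i k)"
  have m: "t < ring_time h i m"
    unfolding m_def by (rule LeastI_ex[OF ring_time_unbounded])
  show ?thesis
  proof (cases m)
    case 0 then show ?thesis using m that by simp
  next
    case (Suc k)
    then have "\<not> t < ring_time h i k"
      by (metis m_def lessI not_less_Least)
    then have "ring_upto h t i k" using m Suc by (simp add: ring_upto_def)
    then show ?thesis by (rule that(2))
  qed
qed

lemma ring_before_cases:
  obtains "t \<le> ring_time h i 0" | k where "ring_before h t i k"
proof -
  define m where "m = (LEAST k. t \<le> ring_time h i k)"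
  have m: "t \<le> ring_time h i m"
    unfolding m_def using ring_time_unbounded[of t i] by (meson LeastI_ex less_imp_le)
  show ?thesis
  proof (cases m)
    case 0 then show ?thesis using m that by simp
  next
    case (Suc k)
    then have "\<not> t \<le> ring_time h i k"
      by (metis m_def lessI not_less_Least)
    then have "ring_before h t i k" using m Suc by (simp add: ring_before_def)
    then show ?thesis by (rule that(2))
  qed
qed

lemma ring_upto_unique: "ring_upto h t i k \<Longrightarrow> ring_upto h t i l \<Longrightarrow> k = l"
  unfolding ring_upto_def
  by (metis le_less_trans ring_time_less_iff less_Suc_eq_le antisym)

lemma ring_before_unique: "ring_before h t i k \<Longrightarrow> ring_before h t i l \<Longrightarrow> k = l"
  unfolding ring_before_def
  by (metis less_le_trans ring_time_less_iff less_Suc_eq_le antisym)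

lemma ring_upto_not_first: "ring_upto h t i k \<Longrightarrow> \<not> t < ring_time h i 0"
  unfolding ring_upto_def using ring_time_le_iff[of i 0 k] by simp

lemma ring_before_not_first: "ring_before h t i k \<Longrightarrow> \<not> t \<le> ring_time h i 0"
  unfolding ring_before_def using ring_time_le_iff[of i 0 k] by simp

lemma state_first: "t < ring_time h i 0 \<Longrightarrow> state \<beta> \<xi> h t i = \<xi> i"
  unfolding state_def using ring_upto_not_first by blast

lemma state_ring: "ring_upto h t i k \<Longrightarrow> state \<beta> \<xi> h t i = resampled \<beta> \<xi> h i k"
  unfolding state_def using ring_upto_not_first ring_upto_unique by blast

lemma left_state_first: "t \<le> ring_time h i 0 \<Longrightarrow> left_state \<beta> \<xi> h t i = \<xi> i"
  unfolding left_state_def using ring_before_not_first by blast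

lemma left_state_ring: "ring_before h t i k \<Longrightarrow> left_state \<beta> \<xi> h t i = resampled \<beta> \<xi> h i k"
  unfolding left_state_def using ring_before_not_first ring_before_unique by blast

lemma state_eqI_no_ring:
  assumes "s \<le> t" "\<And>k. \<not> (s < ring_time h i k \<and> ring_time h i k \<le> t)"
  shows "state \<beta> \<xi> h t i = state \<beta> \<xi> h s i"
proof (rule ring_upto_cases[of s i])
  assume "s < ring_time h i 0"
  moreover then have "t < ring_time h i 0" using assms(2)[of 0] by simp
  ultimately show ?thesis by (simp add: state_first)
next
  fix k assume k: "ring_upto h s i k"
  moreover then have "ring_upto h t i k"
    using assms(1) assms(2)[of "Suc k"] by (simp add: ring_upto_def)
  ultimately show ?thesis by (simp add: state_ring)
qed

lemma state_right: "\<forall>\<^sub>F s in at_right t. state \<beta> \<xi> h s i = state \<beta> \<xi> h t i"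
proof (rule ring_upto_cases[of t i])
  assume *: "t < ring_time h i 0"
  show ?thesis
    using eventually_at_right_real[OF *] by eventually_elim (use * in \<open>simp add: state_first\<close>)
next
  fix k assume k: "ring_upto h t i k"
  then have "t < ring_time h i (Suc k)" by (simp add: ring_upto_def)
  from eventually_at_right_real[OF this] show ?thesis
  proof eventually_elim
    case (elim s)
    then have "ring_upto h s i k" using k by (simp add: ring_upto_def)
    then show ?case using k by (simp add: state_ring)
  qed
qed

lemma state_left: "\<forall>\<^sub>F s in at_left t. state \<beta> \<xi> h s i = left_state \<beta> \<xi> h t i"
proof (rule ring_before_cases[of t i])
  assume *: "t \<le> ring_time h i 0"
  have "t - 1 < t" by simp
  from eventually_at_left_real[OF this] show ?thesis
    by eventually_elim (use * in \<open>simp add: state_first left_state_first\<close>)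
next
  fix k assume k: "ring_before h t i k"
  then have "ring_time h i k < t" by (simp add: ring_before_def)
  from eventually_at_left_real[OF this] show ?thesis
  proof eventually_elim
    case (elim s)
    then have "ring_upto h s i k" using k by (simp add: ring_before_def ring_upto_def)
    then show ?case using k by (simp add: state_ring left_state_ring)
  qed
qed

end

text \<open>A cut-off unnoticed at this ring is \<open>Suc m\<close> for some \<open>m\<close>, and
  the cut-off \<open>m\<close> is then unnoticed at the latest rings of the neighbours. So the
  truncated recursion becomes the exact equation demanded by \<open>driven_by\<close>.\<close>

lemma resampled_eq:
  assumes h: "good h"
  shows "resampled \<beta> \<xi> h i k \<longleftrightarrow>
     ring_mark h i k \<le> plus_prob \<beta> (left_state \<beta> \<xi> h (ring_time h i k)) i"
proof -
  obtain n where n: "\<not> deep h n i k" using h unfolding good_def by blast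
  then obtain m where m: "n = Suc m" by (cases n) auto
  have "ev_val \<beta> \<xi> h m j l = resampled \<beta> \<xi> h j l"
    if "adjacent i j" "ring_before h (ring_time h i k) j l" for j l
    using n that unfolding m by (intro resampled_ev_val[symmetric]) auto
  then show ?thesis
    unfolding resampled_ev_val[OF n] unfolding m ev_val.simps left_state_def
    by (subst plus_prob_cong) auto
qed

section \<open>Existence of the driven path\<close>

definition flow :: "real \<Rightarrow> config \<Rightarrow> harris \<Rightarrow> real \<Rightarrow> config" where
  "flow \<beta> \<xi> h = (\<lambda>t\<in>{0..}. state \<beta> \<xi> h t)"

lemma flow_skorokhod:
  assumes h: "good h"
  shows "flow \<beta> \<xi> h \<in> skorokhod"
proof -
  have "(flow \<beta> \<xi> h \<longlongrightarrow> flow \<beta> \<xi> h t) (at_right t)" if "0 \<le> t" for t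
    unfolding tendsto_config_iff
  proof
    fix i
    from state_right[OF good_regular[OF h], of \<beta> \<xi> i t] eventually_at_right_less[of t]
    show "\<forall>\<^sub>F s in at_right t. flow \<beta> \<xi> h s i = flow \<beta> \<xi> h t i"
      by eventually_elim (use that in \<open>simp add: flow_def\<close>)
  qed
  moreover have "(flow \<beta> \<xi> h \<longlongrightarrow> left_state \<beta> \<xi> h t) (at_left t)" if "0 < t" for t
    unfolding tendsto_config_iff
  proof
    fix i
    from state_left[OF good_regular[OF h], of \<beta> \<xi> i t] eventually_at_left_real[OF that]
    show "\<forall>\<^sub>F s in at_left t. flow \<beta> \<xi> h s i = left_state \<beta> \<xi> h t i"
      by eventually_elim (simp add: flow_def)
  qed
  ultimately show ?thesis
    unfolding skorokhod_def cadlag_def by (auto simp: flow_def)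
qed

lemma flow_left:
  assumes h: "good h" and t: "0 < t"
  shows "(flow \<beta> \<xi> h \<longlongrightarrow> left_state \<beta> \<xi> h t) (at_left t)"
  unfolding tendsto_config_iff
proof
  fix i
  from state_left[OF good_regular[OF h], of \<beta> \<xi> i t] eventually_at_left_real[OF t]
  show "\<forall>\<^sub>F s in at_left t. flow \<beta> \<xi> h s i = left_state \<beta> \<xi> h t i"
    by eventually_elim (simp add: flow_def)
qed

lemma flow_driven:
  assumes h: "good h"
  shows "driven_by \<beta> \<xi> h (flow \<beta> \<xi> h)"
  unfolding driven_by_def
proof (intro conjI allI impI)
  show "flow \<beta> \<xi> h 0 = \<xi>"
    using ring_time_pos[OF good_regular[OF h]] state_first[OF good_regular[OF h]] by (auto simp: flow_def fun_eq_iff)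
next
  fix t :: real and l :: config and i k
  assume t: "0 < t" and l: "(flow \<beta> \<xi> h \<longlongrightarrow> l) (at_left t)" and k: "ring_time h i k = t"
  have l: "l = left_state \<beta> \<xi> h t"
    using tendsto_config_unique[OF _ l flow_left[OF h t]] by simp
  have "ring_upto h t i k" using k by (auto simp: ring_upto_def ring_time_less_iff[OF good_regular[OF h]])
  then show "flow \<beta> \<xi> h t i = (ring_mark h i k \<le> plus_prob \<beta> l i)"
    using t k by (simp add: flow_def state_ring[OF good_regular[OF h]] resampled_eq[OF h] l)
next
  fix t :: real and l :: config and i
  assume t: "0 < t" and l: "(flow \<beta> \<xi> h \<longlongrightarrow> l) (at_left t)" and k: "\<forall>k. ring_time h i k \<noteq> t"
  have l: "l = left_state \<beta> \<xi> h t"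
    using tendsto_config_unique[OF _ l flow_left[OF h t]] by simp
  show "flow \<beta> \<xi> h t i = l i"
  proof (rule ring_upto_cases[OF good_regular[OF h], of t i])
    assume "t < ring_time h i 0"
    then show ?thesis using t by (simp add: flow_def l state_first[OF good_regular[OF h]] left_state_first[OF good_regular[OF h]])
  next
    fix m assume m: "ring_upto h t i m"
    then have "ring_before h t i m" using k[rule_format, of m] by (simp add: ring_upto_def ring_before_def)
    then show ?thesis using t m by (simp add: flow_def l state_ring[OF good_regular[OF h]] left_state_ring[OF good_regular[OF h]])
  qed
qed

section \<open>Uniqueness of the driven path\<close>

lemma skorokhod_right:
  assumes "\<omega> \<in> skorokhod" "0 \<le> t"
  shows "\<forall>\<^sub>F s in at_right t. \<omega> s i = \<omega> t i"
  using assms by (simp add: skorokhod_def cadlag_def tendsto_config_iff)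

lemma skorokhod_left:
  assumes "\<omega> \<in> skorokhod" "0 < t"
  obtains l where "(\<omega> \<longlongrightarrow> l) (at_left t)"
  using assms by (auto simp: skorokhod_def cadlag_def)

text \<open>Without a ring the spin equals its left limit, and it is right continuous by the cadlag
  property; so it is a continuous map from a connected interval to a discrete space.\<close>

lemma driven_by_constant:
  assumes \<omega>: "\<omega> \<in> skorokhod" and d: "driven_by \<beta> \<xi> h \<omega>" and "0 \<le> a" "a \<le> s"
    and no: "\<And>k. \<not> (a < ring_time h i k \<and> ring_time h i k \<le> s)"
  shows "\<omega> s i = \<omega> a i"
proof -
  have "continuous_on {a..s} (\<lambda>r. \<omega> r i)"
    unfolding continuous_on_def tendsto_discrete
  proof
    fix r assume r: "r \<in> {a..s}"
    have right: "\<forall>\<^sub>F q in at_right r. \<omega> q i = \<omega> r i"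
      using r \<open>0 \<le> a\<close> by (intro skorokhod_right[OF \<omega>]) auto
    show "\<forall>\<^sub>F q in at r within {a..s}. \<omega> q i = \<omega> r i"
    proof (cases "r = a")
      case True
      have "at a within {a..s} \<le> at_right a"
        unfolding at_within_def by (intro inf_mono) auto
      then show ?thesis using right True by (auto elim: filter_leD)
    next
      case False
      then have r': "0 < r" "a < r" using r \<open>0 \<le> a\<close> by auto
      obtain l where l: "(\<omega> \<longlongrightarrow> l) (at_left r)" by (rule skorokhod_left[OF \<omega> r'(1)])
      have "\<forall>k. ring_time h i k \<noteq> r" using no r' r by force
      then have "\<omega> r i = l i" using d l r'(1) unfolding driven_by_def by blast
      then have "\<forall>\<^sub>F q in at_left r. \<omega> q i = \<omega> r i"
        using l unfolding tendsto_config_iff by auto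
      then have "\<forall>\<^sub>F q in at r. \<omega> q i = \<omega> r i"
        using right eventually_at_split by blast
      then show ?thesis using at_le[of "{a..s}" UNIV r] by (auto elim: filter_leD)
    qed
  qed
  then have c: "connected ((\<lambda>r. \<omega> r i) ` {a..s})"
    by (rule connected_continuous_image) simp
  show ?thesis
  proof (rule ccontr)
    assume ne: "\<omega> s i \<noteq> \<omega> a i"
    have im: "\<omega> s i \<in> (\<lambda>r. \<omega> r i) ` {a..s}" "\<omega> a i \<in> (\<lambda>r. \<omega> r i) ` {a..s}"
      using \<open>a \<le> s\<close> by auto
    have "{\<omega> s i} \<inter> (\<lambda>r. \<omega> r i) ` {a..s} = {} \<or> {\<omega> a i} \<inter> (\<lambda>r. \<omega> r i) ` {a..s} = {}"
      using ne by (intro connectedD[OF c]) (auto intro: discrete_topology_class.open_discrete)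
    then show False using im by blast
  qed
qed

lemma driven_by_left:
  assumes \<omega>: "\<omega> \<in> skorokhod" and d: "driven_by \<beta> \<xi> h \<omega>" and "0 \<le> a" "a < t"
    and l: "(\<omega> \<longlongrightarrow> l) (at_left t)"
    and no: "\<And>k. \<not> (a < ring_time h i k \<and> ring_time h i k < t)"
  shows "l i = \<omega> a i"
proof -
  have "\<forall>\<^sub>F s in at_left t. \<omega> s i = l i" using l by (simp add: tendsto_config_iff)
  moreover have "\<forall>\<^sub>F s in at_left t. s \<in> {a<..<t}" by (rule eventually_at_left_real[OF \<open>a < t\<close>])
  ultimately have "\<forall>\<^sub>F s in at_left t. l i = \<omega> a i"
  proof eventually_elim
    case (elim s)
    have "\<omega> s i = \<omega> a i"
    proof (rule driven_by_constant[OF \<omega> d \<open>0 \<le> a\<close>])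
      show "a \<le> s" using elim by simp
      show "\<not> (a < ring_time h i k \<and> ring_time h i k \<le> s)" for k
        using no[of k] elim by auto
    qed
    then show ?case using elim by simp
  qed
  then show ?thesis by simp
qed

text \<open>Induction on a cut-off that goes unnoticed at the ring, which exists everywhere by
  \<open>good\<close>. The left limit of a neighbour is its initial spin or its value at its latest
  ring, and the latter has chains shorter by one. Between rings the path is frozen.\<close>

lemma driven_by_unique:
  assumes h: "good h" and \<omega>: "\<omega> \<in> skorokhod" and d: "driven_by \<beta> \<xi> h \<omega>"
  shows "\<omega> = flow \<beta> \<xi> h"
proof -
  have 0: "\<omega> 0 = \<xi>" using d by (simp add: driven_by_def)
  have ring: "\<omega> (ring_time h i k) i = resampled \<beta> \<xi> h i k" if "\<not> deep h n i k" for n i k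
    using that
  proof (induction n arbitrary: i k)
    case (Suc n)
    let ?t = "ring_time h i k"
    have t: "0 < ?t" by (rule ring_time_pos[OF good_regular[OF h]])
    obtain l where l: "(\<omega> \<longlongrightarrow> l) (at_left ?t)" by (rule skorokhod_left[OF \<omega> t])
    have "l j = left_state \<beta> \<xi> h ?t j" if j: "adjacent i j" for j
    proof (rule ring_before_cases[OF good_regular[OF h], of ?t j])
      assume *: "?t \<le> ring_time h j 0"
      then have "l j = \<omega> 0 j"
        using ring_time_le_iff[OF good_regular[OF h], of j 0]
        by (intro driven_by_left[OF \<omega> d _ t l]) (auto simp: not_less intro: order_trans)
      then show ?thesis using * by (simp add: left_state_first[OF good_regular[OF h]] 0)
    next
      fix m assume m: "ring_before h ?t j m"
      have "\<not> (ring_time h j m < ring_time h j k \<and> ring_time h j k < ?t)" for k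
        using m ring_time_less_iff[OF good_regular[OF h], of j m k] ring_time_le_iff[OF good_regular[OF h], of j "Suc m" k]
        unfolding ring_before_def by auto
      then have "l j = \<omega> (ring_time h j m) j"
        using ring_time_pos[OF good_regular[OF h], of j m] m
        by (intro driven_by_left[OF \<omega> d _ _ l]) (auto simp: ring_before_def)
      also have "\<dots> = resampled \<beta> \<xi> h j m"
        using Suc.prems j m by (intro Suc.IH) auto
      finally show ?thesis using m by (simp add: left_state_ring[OF good_regular[OF h]])
    qed
    then have "plus_prob \<beta> l i = plus_prob \<beta> (left_state \<beta> \<xi> h ?t) i"
      by (rule plus_prob_cong)
    moreover have "\<omega> ?t i = (ring_mark h i k \<le> plus_prob \<beta> l i)"
      using d t l unfolding driven_by_def by blast
    ultimately show ?case by (simp add: resampled_eq[OF h])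
  qed simp
  have "\<omega> t i = state \<beta> \<xi> h t i" if t: "0 \<le> t" for t i
  proof (rule ring_upto_cases[OF good_regular[OF h], of t i])
    assume *: "t < ring_time h i 0"
    then have "\<omega> t i = \<omega> 0 i"
      using t ring_time_le_iff[OF good_regular[OF h], of i 0]
      by (intro driven_by_constant[OF \<omega> d]) (auto simp: not_le intro: less_le_trans)
    then show ?thesis using * by (simp add: state_first[OF good_regular[OF h]] 0)
  next
    fix m assume m: "ring_upto h t i m"
    have "\<not> (ring_time h i m < ring_time h i k \<and> ring_time h i k \<le> t)" for k
      using m ring_time_less_iff[OF good_regular[OF h], of i m k] ring_time_le_iff[OF good_regular[OF h], of i "Suc m" k]
      unfolding ring_upto_def by auto
    then have "\<omega> t i = \<omega> (ring_time h i m) i"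
      using ring_time_pos[OF good_regular[OF h], of i m] m
      by (intro driven_by_constant[OF \<omega> d]) (auto simp: ring_upto_def)
    also have "\<dots> = resampled \<beta> \<xi> h i m"
      using h ring unfolding good_def by blast
    finally show ?thesis using m by (simp add: state_ring[OF good_regular[OF h]])
  qed
  moreover have "\<omega> \<in> extensional {0..}" using \<omega> by (simp add: skorokhod_def)
  ultimately show ?thesis
    by (auto simp: flow_def extensional_def fun_eq_iff)
qed

lemma glauber_path_eq_flow:
  assumes "good h"
  shows "glauber_path \<beta> \<xi> h = flow \<beta> \<xi> h"
proof -
  have "\<omega> \<in> skorokhod \<and> driven_by \<beta> \<xi> h \<omega> \<longleftrightarrow> \<omega> = flow \<beta> \<xi> h" for \<omega>
    using driven_by_unique[OF assms] flow_skorokhod[OF assms] flow_driven[OF assms] by blast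
  then show ?thesis unfolding glauber_path_def by simp
qed

section \<open>The law of the graphical representation\<close>

definition wait_mark_space :: "(real \<times> real) measure" where
  "wait_mark_space = density lborel (exponential_density 1) \<Otimes>\<^sub>M uniform_measure lborel {0..1}"

definition site_space :: "(nat \<Rightarrow> real \<times> real) measure" where
  "site_space = Pi\<^sub>M UNIV (\<lambda>_. wait_mark_space)"

lemma harris_space_eq: "harris_space = Pi\<^sub>M UNIV (\<lambda>_. wait_mark_space)"
  by (simp add: harris_space_def wait_mark_space_def)

interpretation exp_prob: prob_space "density lborel (exponential_density 1)"
  by (rule prob_space_exponential_density) simp

interpretation unif_prob: prob_space "uniform_measure lborel {0..1::real}"
  by (rule prob_space_uniform_measure) auto

interpretation wait_mark: prob_space wait_mark_space
  unfolding wait_mark_space_def by (rule prob_space_pair) unfold_locales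

interpretation site: prob_space site_space
  unfolding site_space_def by (rule prob_space_PiM) unfold_locales

interpretation harris: prob_space harris_space
  unfolding harris_space_eq by (rule prob_space_PiM) unfold_locales

lemma space_wait_mark [simp]: "space wait_mark_space = UNIV"
  by (simp add: wait_mark_space_def space_pair_measure)

lemma space_site [simp]: "space site_space = UNIV"
  by (simp add: site_space_def space_PiM)

lemma space_harris [simp]: "space harris_space = UNIV"
  by (simp add: harris_space_eq space_PiM)

lemma sets_wait_mark: "sets wait_mark_space = sets (borel \<Otimes>\<^sub>M borel)"
  unfolding wait_mark_space_def by (intro sets_pair_measure_cong) auto

lemma measurable_fst_wait_mark [measurable]: "fst \<in> borel_measurable wait_mark_space"
  and measurable_snd_wait_mark [measurable]: "snd \<in> borel_measurable wait_mark_space"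
  unfolding measurable_cong_sets[OF sets_wait_mark refl] by simp_all

lemma restrict_UNIV_eq [simp]: "restrict f UNIV = f"
  by (simp add: restrict_def)

lemma measurable_site_coordinate: "(\<lambda>a. a k) \<in> site_space \<rightarrow>\<^sub>M wait_mark_space"
  unfolding site_space_def by (rule measurable_component_singleton) simp

lemma measurable_harris_coordinate: "(\<lambda>h. h p) \<in> harris_space \<rightarrow>\<^sub>M wait_mark_space"
  unfolding harris_space_eq by (rule measurable_component_singleton) simp

lemma measurable_wait [measurable (raw)]:
  "f \<in> N \<rightarrow>\<^sub>M site_space \<Longrightarrow> (\<lambda>x. fst (f x k)) \<in> borel_measurable N"
  "f' \<in> N \<rightarrow>\<^sub>M harris_space \<Longrightarrow> (\<lambda>x. fst (f' x p)) \<in> borel_measurable N"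
  by (rule measurable_compose[OF _ measurable_compose[OF measurable_site_coordinate measurable_fst_wait_mark]], assumption)
     (rule measurable_compose[OF _ measurable_compose[OF measurable_harris_coordinate measurable_fst_wait_mark]], assumption)

lemma measurable_mark [measurable (raw)]:
  "f \<in> N \<rightarrow>\<^sub>M site_space \<Longrightarrow> (\<lambda>x. snd (f x k)) \<in> borel_measurable N"
  "f' \<in> N \<rightarrow>\<^sub>M harris_space \<Longrightarrow> (\<lambda>x. snd (f' x p)) \<in> borel_measurable N"
  by (rule measurable_compose[OF _ measurable_compose[OF measurable_site_coordinate measurable_snd_wait_mark]], assumption)
     (rule measurable_compose[OF _ measurable_compose[OF measurable_harris_coordinate measurable_snd_wait_mark]], assumption)

lemma measurable_harris_site: "(\<lambda>h k. h (i, k)) \<in> harris_space \<rightarrow>\<^sub>M site_space"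
  unfolding site_space_def by (rule measurable_PiM_single') (auto intro: measurable_harris_coordinate)

lemma measurable_ring_time [measurable (raw)]:
  assumes [measurable]: "f \<in> N \<rightarrow>\<^sub>M harris_space"
  shows "(\<lambda>x. ring_time (f x) i k) \<in> borel_measurable N"
  unfolding ring_time_def by measurable

lemma measurable_ring_mark [measurable (raw)]:
  assumes [measurable]: "f \<in> N \<rightarrow>\<^sub>M harris_space"
  shows "(\<lambda>x. ring_mark (f x) i k) \<in> borel_measurable N"
  unfolding ring_mark_def by measurable

lemma distr_harris_site: "distr harris_space site_space (\<lambda>h k. h (i, k)) = site_space"
  using distr_PiM_reindex[of UNIV "\<lambda>_. wait_mark_space" "\<lambda>k. (i, k)" UNIV]
  by (simp add: harris_space_eq site_space_def inj_on_def wait_mark.prob_space_axioms)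

lemma indep_coordinates: "harris.indep_vars (\<lambda>_. wait_mark_space) (\<lambda>p h. h p) UNIV"
proof -
  have "distr harris_space wait_mark_space (\<lambda>h. h p) = wait_mark_space" for p
    unfolding harris_space_eq by (rule distr_PiM_component) (auto intro: wait_mark.prob_space_axioms)
  moreover have "distr harris_space harris_space (\<lambda>h. h) = harris_space"
    by (rule distr_id2) simp
  ultimately show ?thesis
    by (subst harris.indep_vars_iff_distr_eq_PiM)
       (simp_all add: measurable_harris_coordinate flip: harris_space_eq)
qed

lemma indep_sites: "harris.indep_vars (\<lambda>_. site_space) (\<lambda>i h k. h (i, k)) UNIV"
proof -
  have 1: "harris.indep_vars (\<lambda>i. Pi\<^sub>M ({i} \<times> UNIV) (\<lambda>_. wait_mark_space))
      (\<lambda>i h. restrict (\<lambda>p. h p) ({i} \<times> UNIV)) UNIV"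
    by (rule harris.indep_vars_restrict[OF indep_coordinates]) (auto simp: disjoint_family_on_def)
  have "(\<lambda>w k. w (i, k)) \<in> Pi\<^sub>M ({i} \<times> UNIV) (\<lambda>_. wait_mark_space) \<rightarrow>\<^sub>M site_space" for i :: site
    unfolding site_space_def by (rule measurable_PiM_single') auto
  from harris.indep_vars_compose2[OF 1 this] show ?thesis by simp
qed

text \<open>Grouping the independent coordinates by site turns \<open>harris_space\<close> into a
  product over sites, whose factors can be spliced separately.\<close>

lemma distr_harris_curry:
  "distr harris_space (Pi\<^sub>M UNIV (\<lambda>_. site_space)) (\<lambda>h i k. h (i, k)) = Pi\<^sub>M UNIV (\<lambda>_. site_space)"
proof -
  have "distr harris_space (Pi\<^sub>M UNIV (\<lambda>_. site_space)) (\<lambda>h. \<lambda>i\<in>UNIV. \<lambda>k. h (i, k)) =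
      Pi\<^sub>M UNIV (\<lambda>i. distr harris_space site_space (\<lambda>h k. h (i, k)))"
    using indep_sites
    by (subst (asm) harris.indep_vars_iff_distr_eq_PiM) (auto intro: measurable_harris_site)
  then show ?thesis by (simp add: distr_harris_site)
qed

lemma measurable_harris_uncurry:
  "(\<lambda>w p. w (fst p) (snd p)) \<in> Pi\<^sub>M UNIV (\<lambda>_. site_space) \<rightarrow>\<^sub>M harris_space"
  unfolding harris_space_eq
proof (rule measurable_PiM_single')
  fix p :: "site \<times> nat"
  show "(\<lambda>w. w (fst p) (snd p)) \<in> Pi\<^sub>M UNIV (\<lambda>_. site_space) \<rightarrow>\<^sub>M wait_mark_space"
    by (rule measurable_compose[where f="\<lambda>w. w (fst p)" and g="\<lambda>a. a (snd p)" and N=site_space])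
       (auto intro: measurable_site_coordinate)
qed simp

lemma measurable_harris_curry:
  "(\<lambda>h i k. h (i, k)) \<in> harris_space \<rightarrow>\<^sub>M Pi\<^sub>M UNIV (\<lambda>_. site_space)"
  by (rule measurable_PiM_single') (auto intro: measurable_harris_site)

lemma distr_harris_uncurry:
  "distr (Pi\<^sub>M UNIV (\<lambda>_. site_space)) harris_space (\<lambda>w p. w (fst p) (snd p)) = harris_space"
proof -
  have "distr (Pi\<^sub>M UNIV (\<lambda>_. site_space)) harris_space (\<lambda>w p. w (fst p) (snd p)) =
      distr harris_space harris_space ((\<lambda>w p. w (fst p) (snd p)) \<circ> (\<lambda>h i k. h (i, k)))"
    by (subst distr_harris_curry[symmetric], rule distr_distr[OF measurable_harris_uncurry measurable_harris_curry])
  also have "\<dots> = harris_space" by (simp add: comp_def)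
  finally show ?thesis .
qed

lemma emeasure_harris_sites:
  assumes "finite I" "\<And>i. i \<in> I \<Longrightarrow> B i \<in> sets site_space"
  shows "emeasure harris_space {h. \<forall>i\<in>I. (\<lambda>k. h (i, k)) \<in> B i} = (\<Prod>i\<in>I. emeasure site_space (B i))"
proof -
  interpret P: product_prob_space "\<lambda>_ :: site. site_space" UNIV by unfold_locales
  let ?S = "{w \<in> space (Pi\<^sub>M UNIV (\<lambda>_. site_space)). \<forall>i\<in>I. w i \<in> B i}"
  have S: "?S \<in> sets (Pi\<^sub>M UNIV (\<lambda>_. site_space))"
    using assms by measurable
  have "(\<Prod>i\<in>I. emeasure site_space (B i)) = emeasure (Pi\<^sub>M UNIV (\<lambda>_. site_space)) ?S"
    using P.emeasure_PiM_Collect[of I B] assms by simp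
  also have "\<dots> = emeasure harris_space ((\<lambda>h i k. h (i, k)) -` ?S \<inter> space harris_space)"
    by (subst distr_harris_curry[symmetric], rule emeasure_distr[OF measurable_harris_curry S])
  also have "(\<lambda>h i k. h (i, k)) -` ?S \<inter> space harris_space = {h. \<forall>i\<in>I. (\<lambda>k. h (i, k)) \<in> B i}"
    by (auto simp: space_PiM)
  finally show ?thesis ..
qed

lemma AE_harris_site:
  assumes "AE a in site_space. P a"
  shows "AE h in harris_space. P (\<lambda>k. h (i, k))"
proof -
  have "AE a in distr harris_space site_space (\<lambda>h k. h (i, k)). P a"
    using assms unfolding distr_harris_site .
  then show ?thesis by (rule AE_distrD[OF measurable_harris_site])
qed

subsection \<open>Waiting times\<close>

text \<open>Substitute \<open>s + t\<close> for \<open>t\<close> and factor exp(-(s + t)) = exp(-s)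
  exp(-t).\<close>

lemma exponential_memoryless:
  assumes s: "0 \<le> s" and [measurable]: "g \<in> borel_measurable borel"
  shows "(\<integral>\<^sup>+t. indicator {s<..} t * g t \<partial>density lborel (exponential_density 1)) =
     ennreal (exp (- s)) * (\<integral>\<^sup>+t. g (s + t) \<partial>density lborel (exponential_density 1))"
proof -
  have "(\<integral>\<^sup>+t. indicator {s<..} t * g t \<partial>density lborel (exponential_density 1)) =
      (\<integral>\<^sup>+t. ennreal (exponential_density 1 t) * (indicator {s<..} t * g t) \<partial>lborel)"
    by (subst nn_integral_density) auto
  also have "\<dots> = (\<integral>\<^sup>+t. ennreal (exponential_density 1 (s + t)) * (indicator {s<..} (s + t) * g (s + t)) \<partial>lborel)"
    by (subst nn_integral_real_affine[where c=1 and t=s]) auto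
  also have "\<dots> = (\<integral>\<^sup>+t. ennreal (exp (- s)) * (ennreal (exponential_density 1 t) * g (s + t)) \<partial>lborel)"
  proof (rule nn_integral_cong_AE)
    \<comment> \<open>At \<open>t = 0\<close> the strict indicator vanishes but the density does
      not; a single point is null.\<close>
    have "AE t in lborel. t \<noteq> (0::real)" by (rule AE_lborel_singleton)
    then show "AE t in lborel. ennreal (exponential_density 1 (s + t)) * (indicator {s<..} (s + t) * g (s + t)) =
       ennreal (exp (- s)) * (ennreal (exponential_density 1 t) * g (s + t))"
    proof eventually_elim
      case (elim t)
      show ?case
      proof (cases "0 < t")
        case True
        then have "exponential_density 1 (s + t) = exp (- s) * exponential_density 1 t"
          using s by (simp add: exponential_density_def flip: exp_add)
        then show ?thesis using True
          by (simp add: ennreal_mult' exponential_density_nonneg mult.assoc)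
      next
        case False
        then show ?thesis using elim by (simp add: exponential_density_def)
      qed
    qed
  qed
  also have "\<dots> = ennreal (exp (- s)) * (\<integral>\<^sup>+t. ennreal (exponential_density 1 t) * g (s + t) \<partial>lborel)"
    by (subst nn_integral_cmult) auto
  also have "\<dots> = ennreal (exp (- s)) * (\<integral>\<^sup>+t. g (s + t) \<partial>density lborel (exponential_density 1))"
    by (subst nn_integral_density) auto
  finally show ?thesis .
qed

lemma wait_memoryless:
  assumes s: "0 \<le> s" and g [measurable]: "g \<in> borel_measurable (borel \<Otimes>\<^sub>M borel)"
  shows "(\<integral>\<^sup>+x. indicator {s<..} (fst x) * g x \<partial>wait_mark_space) =
     ennreal (exp (- s)) * (\<integral>\<^sup>+x. g (s + fst x, snd x) \<partial>wait_mark_space)"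
proof -
  interpret pair_sigma_finite "density lborel (exponential_density 1)" "uniform_measure lborel {0..1::real}"
    by unfold_locales
  have [measurable]: "g \<in> borel_measurable wait_mark_space"
    using g unfolding measurable_cong_sets[OF sets_wait_mark refl] .
  have "(\<integral>\<^sup>+x. indicator {s<..} (fst x) * g x \<partial>wait_mark_space) =
      (\<integral>\<^sup>+m. \<integral>\<^sup>+t. indicator {s<..} t * g (t, m) \<partial>density lborel (exponential_density 1) \<partial>uniform_measure lborel {0..1})"
    unfolding wait_mark_space_def by (subst nn_integral_snd[symmetric]) auto
  also have "\<dots> = (\<integral>\<^sup>+m. ennreal (exp (- s)) * (\<integral>\<^sup>+t. g (s + t, m) \<partial>density lborel (exponential_density 1)) \<partial>uniform_measure lborel {0..1})"
    by (intro nn_integral_cong exponential_memoryless s) measurable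
  also have "\<dots> = ennreal (exp (- s)) * (\<integral>\<^sup>+m. \<integral>\<^sup>+t. g (s + t, m) \<partial>density lborel (exponential_density 1) \<partial>uniform_measure lborel {0..1})"
    by (subst nn_integral_cmult) auto
  also have "(\<integral>\<^sup>+m. \<integral>\<^sup>+t. g (s + t, m) \<partial>density lborel (exponential_density 1) \<partial>uniform_measure lborel {0..1}) =
      (\<integral>\<^sup>+x. g (s + fst x, snd x) \<partial>wait_mark_space)"
    unfolding wait_mark_space_def by (subst nn_integral_snd[symmetric]) auto
  finally show ?thesis .
qed

lemma emeasure_wait_greater:
  assumes s: "0 \<le> s"
  shows "emeasure wait_mark_space {x. s < fst x} = ennreal (exp (- s))"
proof -
  have [measurable]: "{x. s < fst x} \<in> sets wait_mark_space"
    using measurable_sets[of fst wait_mark_space borel "{s<..}"] by (simp add: vimage_def)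
  have "emeasure wait_mark_space {x. s < fst x} = (\<integral>\<^sup>+x. indicator {s<..} (fst x) * 1 \<partial>wait_mark_space)"
    by (subst nn_integral_indicator[symmetric], simp, intro nn_integral_cong) (simp add: indicator_def)
  also have "\<dots> = ennreal (exp (- s))"
    by (subst wait_memoryless[OF s]) (auto simp: wait_mark.emeasure_space_1[unfolded space_wait_mark])
  finally show ?thesis .
qed

lemma emeasure_wait_le:
  assumes s: "0 \<le> s"
  shows "emeasure wait_mark_space {x. fst x \<le> s} = ennreal (1 - exp (- s))"
proof -
  have "{x \<in> space wait_mark_space. s < fst x} \<in> sets wait_mark_space" by measurable
  then have m: "{x. s < fst x} \<in> sets wait_mark_space" by simp
  have "{x :: real \<times> real. fst x \<le> s} = space wait_mark_space - {x. s < fst x}" by auto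
  then have "emeasure wait_mark_space {x. fst x \<le> s} = 1 - ennreal (exp (- s))"
    using emeasure_compl[OF m] emeasure_wait_greater[OF s]
    by (simp add: wait_mark.emeasure_space_1[unfolded space_wait_mark])
  then show ?thesis by (simp add: ennreal_minus flip: ennreal_1)
qed

text \<open>\<open>psum a k\<close> is the time of the \<open>(k - 1)\<close>-st ring, with \<open>psum a 0 = 0\<close>.\<close>

definition psum :: "(nat \<Rightarrow> real \<times> real) \<Rightarrow> nat \<Rightarrow> real" where
  "psum a n = (\<Sum>l<n. fst (a l))"

lemma ring_time_psum: "ring_time h i k = psum (\<lambda>k. h (i, k)) (Suc k)"
  by (simp add: ring_time_def psum_def lessThan_Suc_atMost)

lemma psum_simps [simp]: "psum a 0 = 0" "psum a (Suc n) = psum a n + fst (a n)"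
  by (simp_all add: psum_def)

lemma measurable_psum [measurable (raw)]:
  assumes [measurable]: "f \<in> N \<rightarrow>\<^sub>M site_space"
  shows "(\<lambda>x. psum (f x) n) \<in> borel_measurable N"
  unfolding psum_def by measurable

definition regular_site :: "(nat \<Rightarrow> real \<times> real) \<Rightarrow> bool" where
  "regular_site a \<longleftrightarrow> (\<forall>k. 0 < fst (a k)) \<and> (\<forall>m::nat. \<exists>k. real m < psum a (Suc k))"

lemma regular_iff_sites: "regular h \<longleftrightarrow> (\<forall>i. regular_site (\<lambda>k. h (i, k)))"
  unfolding regular_def regular_site_def ring_time_psum by blast

lemma strict_mono_psum:
  assumes "regular_site a" shows "strict_mono (psum a)"
  using assms by (intro strict_monoI_Suc) (simp add: regular_site_def)

lemma AE_wait_positive: "AE a in site_space. \<forall>k. 0 < fst (a k)"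
proof -
  have "emeasure wait_mark_space {x. 0 < fst x} = 1" using emeasure_wait_greater[of 0] by simp
  then have "AE x in wait_mark_space. x \<in> {x. 0 < fst x}"
    by (intro wait_mark.AE_in_set_eq_1[THEN iffD2]) (auto simp: wait_mark.emeasure_eq_measure emeasure_neq_0_sets)
  then have "AE a in site_space. 0 < fst (a k)" for k
    unfolding site_space_def
    by (intro AE_PiM_component[where P="\<lambda>x. 0 < fst x"]) (auto intro: wait_mark.prob_space_axioms)
  then show ?thesis by (simp add: AE_all_countable)
qed

text \<open>A run of n waits of length at most 1 has probability (1 - exp(-1))^n, which tends to 0.
  Recurring waits longer than 1 make the ring times unbounded, so the clocks cannot explode.\<close>

lemma AE_wait_infinitely_long: "AE a in site_space. \<forall>K. \<exists>k\<ge>K. 1 < fst (a k)"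
  unfolding AE_all_countable
proof
  fix K :: nat
  interpret P: product_prob_space "\<lambda>_ :: nat. wait_mark_space" UNIV by unfold_locales
  let ?r = "1 - exp (- 1 :: real)"
  let ?E = "{a. \<forall>k\<ge>K. fst (a k) \<le> 1}"
  have "{a \<in> space site_space. \<forall>k. K \<le> k \<longrightarrow> fst (a k) \<le> 1} \<in> sets site_space" by measurable
  then have E: "?E \<in> sets site_space" by simp
  have "emeasure site_space ?E \<le> ennreal (?r ^ n)" for n
  proof -
    let ?C = "{a \<in> space (Pi\<^sub>M UNIV (\<lambda>_. wait_mark_space)). \<forall>k\<in>{K..<K+n}. a k \<in> {x. fst x \<le> 1}}"
    have s: "{x \<in> space wait_mark_space. fst x \<le> 1} \<in> sets wait_mark_space" by measurable
    have "?C \<in> sets (Pi\<^sub>M UNIV (\<lambda>_. wait_mark_space))" using s by measurable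
    then have "emeasure site_space ?E \<le> emeasure site_space ?C"
      by (intro emeasure_mono) (auto simp: space_PiM site_space_def)
    also have "\<dots> = (\<Prod>k\<in>{K..<K+n}. emeasure wait_mark_space {x. fst x \<le> 1})"
      unfolding site_space_def using s by (intro P.emeasure_PiM_Collect) auto
    also have "\<dots> = ennreal (?r ^ n)"
      by (simp add: emeasure_wait_le ennreal_power)
    finally show ?thesis .
  qed
  moreover have "(\<lambda>n. ennreal (?r ^ n)) \<longlonglongrightarrow> ennreal 0"
    by (intro tendsto_ennrealI LIMSEQ_power_zero) auto
  ultimately have "emeasure site_space ?E \<le> 0"
    by (intro LIMSEQ_le_const[where X="\<lambda>n. ennreal (?r ^ n)"]) auto
  then show "AE a in site_space. \<exists>k\<ge>K. 1 < fst (a k)"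
    using E by (intro AE_I[of _ _ ?E]) (auto simp: not_less)
qed

lemma AE_regular_site: "AE a in site_space. regular_site a"
  using AE_wait_positive AE_wait_infinitely_long
proof eventually_elim
  case (elim a)
  have "\<exists>k. real m < psum a (Suc k)" for m
  proof (induction m)
    case 0
    show ?case using elim(1) by (intro exI[of _ 0]) simp
  next
    case (Suc m)
    then obtain k where k: "real m < psum a (Suc k)" ..
    obtain l where l: "Suc k \<le> l" "1 < fst (a l)" using elim(2) by blast
    have "psum a (Suc k) \<le> psum a l"
      unfolding psum_def using l(1) elim(1) by (intro sum_mono2) (auto intro: less_imp_le)
    then show ?case using k l by (intro exI[of _ l]) simp
  qed
  then show ?case using elim(1) by (simp add: regular_site_def)
qed

lemma AE_regular: "AE h in harris_space. regular h"
  unfolding regular_iff_sites AE_all_countable using AE_harris_site[OF AE_regular_site] by blast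

subsection \<open>Restarting the clocks\<close>

text \<open>
  \<open>restart n u a b\<close> follows \<open>a\<close> for \<open>n\<close> rings and then \<open>b\<close> shifted by the time \<open>u\<close>;
  \<open>site_splice u a b\<close> uses exactly the rings of \<open>a\<close> up to time \<open>u\<close>.
\<close>

definition restart :: "nat \<Rightarrow> real \<Rightarrow> (nat \<Rightarrow> real \<times> real) \<Rightarrow> (nat \<Rightarrow> real \<times> real) \<Rightarrow> nat \<Rightarrow> real \<times> real" where
  "restart n u a b = comb_seq n a (case_nat (u - psum a n + fst (b 0), snd (b 0)) (\<lambda>k. b (Suc k)))"

definition site_splice :: "real \<Rightarrow> (nat \<Rightarrow> real \<times> real) \<Rightarrow> (nat \<Rightarrow> real \<times> real) \<Rightarrow> nat \<Rightarrow> real \<times> real" where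
  "site_splice u a b = restart (LEAST n. u < psum a (Suc n)) u a b"

definition splice :: "real \<Rightarrow> harris \<Rightarrow> harris \<Rightarrow> harris" where
  "splice u h h' = (\<lambda>p. site_splice u (\<lambda>k. h (fst p, k)) (\<lambda>k. h' (fst p, k)) (snd p))"

lemma measurable_wait_mark_Pair [measurable (raw)]:
  assumes "f \<in> borel_measurable N" "g \<in> borel_measurable N"
  shows "(\<lambda>x. (f x, g x)) \<in> N \<rightarrow>\<^sub>M wait_mark_space"
  unfolding measurable_cong_sets[OF refl sets_wait_mark] using assms by (rule measurable_Pair)

lemma measurable_case_nat_site [measurable (raw)]:
  assumes "f \<in> N \<rightarrow>\<^sub>M wait_mark_space" "g \<in> N \<rightarrow>\<^sub>M site_space"
  shows "(\<lambda>x. case_nat (f x) (g x)) \<in> N \<rightarrow>\<^sub>M site_space"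
  using assms unfolding site_space_def by measurable

lemma measurable_comb_seq_site [measurable (raw)]:
  assumes "f \<in> N \<rightarrow>\<^sub>M site_space" "g \<in> N \<rightarrow>\<^sub>M site_space"
  shows "(\<lambda>x. comb_seq n (f x) (g x)) \<in> N \<rightarrow>\<^sub>M site_space"
  using assms unfolding site_space_def by measurable

lemma measurable_tail_site: "(\<lambda>b k. b (Suc k)) \<in> site_space \<rightarrow>\<^sub>M site_space"
  unfolding site_space_def
  by (rule measurable_PiM_single') (auto intro: measurable_site_coordinate[unfolded site_space_def])

lemma measurable_restart [measurable (raw)]:
  assumes [measurable]: "f \<in> N \<rightarrow>\<^sub>M site_space" "g \<in> N \<rightarrow>\<^sub>M site_space"
  shows "(\<lambda>x. restart n u (f x) (g x)) \<in> N \<rightarrow>\<^sub>M site_space"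
proof -
  have "(\<lambda>x. (u - psum (f x) n + fst (g x 0), snd (g x 0))) \<in> N \<rightarrow>\<^sub>M wait_mark_space"
    by (rule measurable_wait_mark_Pair) measurable
  moreover have "(\<lambda>x k. g x (Suc k)) \<in> N \<rightarrow>\<^sub>M site_space"
    by (rule measurable_compose[OF assms(2) measurable_tail_site])
  ultimately show ?thesis
    unfolding restart_def by (intro measurable_comb_seq_site assms measurable_case_nat_site)
qed

lemma measurable_site_splice [measurable (raw)]:
  assumes [measurable]: "f \<in> N \<rightarrow>\<^sub>M site_space" "g \<in> N \<rightarrow>\<^sub>M site_space"
  shows "(\<lambda>x. site_splice u (f x) (g x)) \<in> N \<rightarrow>\<^sub>M site_space"
proof -
  have "(\<lambda>x. LEAST n. u < psum (f x) (Suc n)) \<in> N \<rightarrow>\<^sub>M count_space UNIV"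
    by (rule measurable_Least) (simp del: psum_simps)
  then show ?thesis
    unfolding site_splice_def
    by (rule measurable_compose_countable[where f="\<lambda>n x. restart n u (f x) (g x)", OF measurable_restart[OF assms]])
qed

text \<open>Splits an independent sequence into its first \<open>n\<close> entries, the entry
  \<open>n\<close> and the tail. In the application entry \<open>n\<close> carries the wait that
  straddles the time \<open>u\<close>.\<close>

lemma nn_integral_site_decompose:
  assumes [measurable]: "f \<in> borel_measurable site_space"
  shows "(\<integral>\<^sup>+a. f a \<partial>site_space) =
     (\<integral>\<^sup>+a. \<integral>\<^sup>+x. \<integral>\<^sup>+c. f (comb_seq n a (case_nat x c)) \<partial>site_space \<partial>wait_mark_space \<partial>site_space)"
proof -
  interpret S: sequence_space wait_mark_space by unfold_locales
  interpret p: pair_sigma_finite site_space site_space by unfold_locales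
  interpret q: pair_sigma_finite wait_mark_space site_space by unfold_locales
  have inner: "(\<integral>\<^sup>+b. f (comb_seq n a b) \<partial>site_space) =
      (\<integral>\<^sup>+x. \<integral>\<^sup>+c. f (comb_seq n a (case_nat x c)) \<partial>site_space \<partial>wait_mark_space)" for a
  proof -
    have "(\<integral>\<^sup>+b. f (comb_seq n a b) \<partial>site_space) =
       (\<integral>\<^sup>+b. f (comb_seq n a b) \<partial>distr (wait_mark_space \<Otimes>\<^sub>M site_space) site_space (\<lambda>(x, c). case_nat x c))"
      using S.PiM_iter by (simp add: site_space_def)
    also have "\<dots> = (\<integral>\<^sup>+x. \<integral>\<^sup>+c. f (comb_seq n a (case_nat x c)) \<partial>site_space \<partial>wait_mark_space)"
      by (subst nn_integral_distr) (auto simp: split_beta' site.nn_integral_fst[symmetric])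
    finally show ?thesis .
  qed
  have "(\<integral>\<^sup>+a. f a \<partial>site_space) =
      (\<integral>\<^sup>+a. f a \<partial>distr (site_space \<Otimes>\<^sub>M site_space) site_space (\<lambda>(a, b). comb_seq n a b))"
    using S.PiM_comb_seq[of n] by (simp add: site_space_def)
  also have "\<dots> = (\<integral>\<^sup>+a. \<integral>\<^sup>+b. f (comb_seq n a b) \<partial>site_space \<partial>site_space)"
    by (subst nn_integral_distr) (auto simp: split_beta' site.nn_integral_fst[symmetric])
  finally show ?thesis unfolding inner .
qed

lemma nn_integral_site_cons:
  assumes [measurable]: "f \<in> borel_measurable site_space"
  shows "(\<integral>\<^sup>+a. f a \<partial>site_space) = (\<integral>\<^sup>+x. \<integral>\<^sup>+c. f (case_nat x c) \<partial>site_space \<partial>wait_mark_space)"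
  using nn_integral_site_decompose[OF assms, of 0]
  by (simp add: comb_seq_0 site.emeasure_space_1[unfolded space_site])

lemma psum_comb_seq: "psum (comb_seq n a b) n = psum a n"
  unfolding psum_def by (intro sum.cong) (auto simp: comb_seq_less)

lemma comb_seq_at: "comb_seq n a b n = b 0"
  using comb_seq_add[of n a b 0] by simp

lemma comb_seq_comb_seq: "comb_seq n (comb_seq n a b) c = comb_seq n a c"
  by (auto simp: comb_seq_def)

text \<open>Given the first \<open>n\<close> rings, the straddling wait must exceed
  \<open>u - psum a n\<close>. On the left it is discarded, contributing the factor exp(-(u - psum a
  n)), and a fresh wait starts at \<open>u\<close>; on the right memorylessness produces the same
  factor and makes the overshoot past \<open>u\<close> a fresh wait. Both sides meet in the integral
  of \<open>?I\<close>.\<close>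

lemma nn_integral_restart:
  assumes [measurable]: "f \<in> borel_measurable site_space"
  shows "(\<integral>\<^sup>+a. \<integral>\<^sup>+b. indicator {a. psum a n \<le> u \<and> u < psum a (Suc n)} a * f (restart n u a b) \<partial>site_space \<partial>site_space)
    = (\<integral>\<^sup>+a. indicator {a. psum a n \<le> u \<and> u < psum a (Suc n)} a * f a \<partial>site_space)"
    (is "?L = ?R")
proof -
  let ?E = "{a. psum a n \<le> u \<and> u < psum a (Suc n)}"
  have "{a \<in> space site_space. psum a n \<le> u \<and> u < psum a (Suc n)} \<in> sets site_space" by measurable
  then have [measurable]: "?E \<in> sets site_space" by simp
  \<comment> \<open>The expectation of \<open>f\<close> when the first \<open>n\<close> entries come
    from \<open>a\<close> and the next ring falls a fresh wait \<open>fst y\<close> after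
    \<open>u\<close>.\<close>
  let ?I = "\<lambda>a. \<integral>\<^sup>+y. \<integral>\<^sup>+d. f (comb_seq n a (case_nat (u - psum a n + fst y, snd y) d)) \<partial>site_space \<partial>wait_mark_space"
  have E: "indicator ?E (comb_seq n a (case_nat x c)) =
     (indicator {..u} (psum a n) * indicator {u - psum a n<..} (fst x) :: ennreal)" for a x c
    by (auto simp: psum_comb_seq comb_seq_at split: split_indicator)
  have "?L = (\<integral>\<^sup>+a. indicator ?E a * (\<integral>\<^sup>+b. f (restart n u a b) \<partial>site_space) \<partial>site_space)"
    by (simp add: nn_integral_cmult)
  also have "\<dots> = (\<integral>\<^sup>+a. \<integral>\<^sup>+x. \<integral>\<^sup>+c. indicator ?E (comb_seq n a (case_nat x c)) *
      (\<integral>\<^sup>+b. f (restart n u (comb_seq n a (case_nat x c)) b) \<partial>site_space) \<partial>site_space \<partial>wait_mark_space \<partial>site_space)"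
    by (rule nn_integral_site_decompose) measurable
  also have "\<dots> = (\<integral>\<^sup>+a. \<integral>\<^sup>+x. indicator {..u} (psum a n) * indicator {u - psum a n<..} (fst x) *
      (\<integral>\<^sup>+b. f (restart n u a b) \<partial>site_space) \<partial>wait_mark_space \<partial>site_space)"
  proof (intro nn_integral_cong)
    fix a x
    \<comment> \<open>The restarted sequence reads only the first \<open>n\<close> entries of its
      first argument, so the straddling entry and the tail occur in the indicator alone and can be
      integrated out.\<close>
    have r: "restart n u (comb_seq n a (case_nat x c)) b = restart n u a b" for b c
      by (simp only: restart_def psum_comb_seq comb_seq_comb_seq)
    show "(\<integral>\<^sup>+c. indicator ?E (comb_seq n a (case_nat x c)) *
        (\<integral>\<^sup>+b. f (restart n u (comb_seq n a (case_nat x c)) b) \<partial>site_space) \<partial>site_space) =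
      indicator {..u} (psum a n) * indicator {u - psum a n<..} (fst x) *
        (\<integral>\<^sup>+b. f (restart n u a b) \<partial>site_space)"
      unfolding r E nn_integral_const by (simp only: site.emeasure_space_1 mult_1_right)
  qed
  also have "\<dots> = (\<integral>\<^sup>+a. indicator {..u} (psum a n) * ennreal (exp (- (u - psum a n))) * ?I a \<partial>site_space)"
  proof (rule nn_integral_cong)
    fix a
    have r: "(\<integral>\<^sup>+b. f (restart n u a b) \<partial>site_space) = ?I a"
    proof -
      have "(\<lambda>b. f (restart n u a b)) \<in> borel_measurable site_space" by measurable
      from nn_integral_site_cons[OF this] show ?thesis by (simp add: restart_def)
    qed
    have "(\<integral>\<^sup>+x. indicator {u - psum a n<..} (fst x) * ?I a \<partial>wait_mark_space) =
       ennreal (exp (- (u - psum a n))) * ?I a" if "psum a n \<le> u"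
      using wait_memoryless[of "u - psum a n" "\<lambda>_. ?I a"] that
      by (simp add: wait_mark.emeasure_space_1[unfolded space_wait_mark])
    then show "(\<integral>\<^sup>+x. indicator {..u} (psum a n) * indicator {u - psum a n<..} (fst x) *
      (\<integral>\<^sup>+b. f (restart n u a b) \<partial>site_space) \<partial>wait_mark_space) =
      indicator {..u} (psum a n) * ennreal (exp (- (u - psum a n))) * ?I a"
      unfolding r by (cases "psum a n \<le> u") (auto simp: mult.assoc)
  qed
  also have "\<dots> = (\<integral>\<^sup>+a. \<integral>\<^sup>+x. \<integral>\<^sup>+c. indicator ?E (comb_seq n a (case_nat x c)) *
      f (comb_seq n a (case_nat x c)) \<partial>site_space \<partial>wait_mark_space \<partial>site_space)"
  proof (rule nn_integral_cong)
    fix a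
    have "(\<lambda>x. \<integral>\<^sup>+c. f (comb_seq n a (case_nat x c)) \<partial>site_space) \<in> borel_measurable wait_mark_space"
      by measurable
    then have m: "(\<lambda>x. \<integral>\<^sup>+c. f (comb_seq n a (case_nat x c)) \<partial>site_space) \<in> borel_measurable (borel \<Otimes>\<^sub>M borel)"
      unfolding measurable_cong_sets[OF sets_wait_mark refl] .
    have "(\<integral>\<^sup>+x. \<integral>\<^sup>+c. indicator {u - psum a n<..} (fst x) * f (comb_seq n a (case_nat x c)) \<partial>site_space \<partial>wait_mark_space)
      = ennreal (exp (- (u - psum a n))) * ?I a" if "psum a n \<le> u"
      using wait_memoryless[OF _ m, of "u - psum a n"] that by (simp add: nn_integral_cmult)
    then show "indicator {..u} (psum a n) * ennreal (exp (- (u - psum a n))) * ?I a =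
      (\<integral>\<^sup>+x. \<integral>\<^sup>+c. indicator ?E (comb_seq n a (case_nat x c)) * f (comb_seq n a (case_nat x c)) \<partial>site_space \<partial>wait_mark_space)"
      unfolding E by (cases "psum a n \<le> u") auto
  qed
  also have "\<dots> = ?R"
    by (rule nn_integral_site_decompose[symmetric]) measurable
  finally show ?thesis .
qed

text \<open>The \<open>LEAST\<close> in \<open>site_splice\<close> is the number of rings up to time
  \<open>u\<close>, so the events treated by \<open>nn_integral_restart\<close> form a partition of
  the regular sequences.\<close>

lemma regular_site_count:
  assumes a: "regular_site a" and u: "0 \<le> u"
  shows "psum a n \<le> u \<and> u < psum a (Suc n) \<longleftrightarrow> n = (LEAST n. u < psum a (Suc n))"
proof -
  define N where "N = (LEAST n. u < psum a (Suc n))"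
  have "\<exists>n. u < psum a (Suc n)"
    using a reals_Archimedean2[of u] unfolding regular_site_def by (meson less_trans)
  then have N: "u < psum a (Suc N)" unfolding N_def by (rule LeastI_ex)
  have N': "psum a N \<le> u"
  proof (cases N)
    case (Suc m)
    then have "\<not> u < psum a (Suc m)" unfolding N_def by (intro not_less_Least) simp
    then show ?thesis using Suc by simp
  qed (simp add: u)
  have mono: "psum a k < psum a l \<longleftrightarrow> k < l" for k l
    by (rule strict_mono_less[OF strict_mono_psum[OF a]])
  have "n = N" if "psum a n \<le> u" "u < psum a (Suc n)"
    using mono[of n "Suc N"] mono[of N "Suc n"] N N' that by linarith
  then show ?thesis using N N' unfolding N_def[symmetric] by auto
qed

text \<open>Sum \<open>nn_integral_restart\<close> over the possible numbers of rings up to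
  \<open>u\<close>; exactly one summand survives for each regular sequence.\<close>

lemma nn_integral_site_splice:
  assumes [measurable]: "f \<in> borel_measurable site_space" and u: "0 \<le> u"
  shows "(\<integral>\<^sup>+a. \<integral>\<^sup>+b. f (site_splice u a b) \<partial>site_space \<partial>site_space) = (\<integral>\<^sup>+a. f a \<partial>site_space)"
proof -
  let ?E = "\<lambda>n. {a. psum a n \<le> u \<and> u < psum a (Suc n)}"
  have "{a \<in> space site_space. psum a n \<le> u \<and> u < psum a (Suc n)} \<in> sets site_space" for n by measurable
  then have [measurable]: "?E n \<in> sets site_space" for n by simp
  have one: "(\<Sum>n. indicator (?E n) a * F n) = (F (LEAST n. u < psum a (Suc n)) :: ennreal)"
    if "regular_site a" for a F
  proof -
    have "(\<lambda>n. indicator (?E n) a * F n) = (\<lambda>n. if n = (LEAST n. u < psum a (Suc n)) then F n else 0)"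
      using regular_site_count[OF that u] by (auto simp: fun_eq_iff indicator_def)
    then show ?thesis
      using suminf_finite[of "{LEAST n. u < psum a (Suc n)}" "\<lambda>n. if n = (LEAST n. u < psum a (Suc n)) then F n else 0"]
      by simp
  qed
  have "(\<integral>\<^sup>+a. \<integral>\<^sup>+b. f (site_splice u a b) \<partial>site_space \<partial>site_space) =
     (\<integral>\<^sup>+a. (\<Sum>n. indicator (?E n) a * (\<integral>\<^sup>+b. f (restart n u a b) \<partial>site_space)) \<partial>site_space)"
    using AE_regular_site
    by (intro nn_integral_cong_AE, eventually_elim) (simp only: one site_splice_def)
  also have "\<dots> = (\<Sum>n. \<integral>\<^sup>+a. \<integral>\<^sup>+b. indicator (?E n) a * f (restart n u a b) \<partial>site_space \<partial>site_space)"
    by (simp add: nn_integral_suminf nn_integral_cmult)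
  also have "\<dots> = (\<Sum>n. \<integral>\<^sup>+a. indicator (?E n) a * f a \<partial>site_space)"
    by (simp only: nn_integral_restart[OF assms(1)])
  also have "\<dots> = (\<integral>\<^sup>+a. (\<Sum>n. indicator (?E n) a * f a) \<partial>site_space)"
    by (rule nn_integral_suminf[symmetric]) measurable
  also have "\<dots> = (\<integral>\<^sup>+a. f a \<partial>site_space)"
    using AE_regular_site by (intro nn_integral_cong_AE, eventually_elim) (simp only: one)
  finally show ?thesis .
qed

lemma emeasure_site_splice:
  assumes [measurable]: "A \<in> sets site_space" and u: "0 \<le> u"
  shows "(\<integral>\<^sup>+a. emeasure site_space {b. site_splice u a b \<in> A} \<partial>site_space) = emeasure site_space A"
proof -
  have "emeasure site_space {b. site_splice u a b \<in> A} = (\<integral>\<^sup>+b. indicator A (site_splice u a b) \<partial>site_space)" for a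
  proof -
    have "{b \<in> space site_space. site_splice u a b \<in> A} \<in> sets site_space" by measurable
    then have "{b. site_splice u a b \<in> A} \<in> sets site_space" by simp
    then have "emeasure site_space {b. site_splice u a b \<in> A} =
        (\<integral>\<^sup>+b. indicator {b. site_splice u a b \<in> A} b \<partial>site_space)"
      by simp
    then show ?thesis by (simp add: indicator_def)
  qed
  then show ?thesis using nn_integral_site_splice[of "indicator A" u] u by simp
qed

lemma measurable_splice [measurable (raw)]:
  assumes "f \<in> N \<rightarrow>\<^sub>M harris_space" "g \<in> N \<rightarrow>\<^sub>M harris_space"
  shows "(\<lambda>x. splice u (f x) (g x)) \<in> N \<rightarrow>\<^sub>M harris_space"
  unfolding harris_space_eq
proof (rule measurable_PiM_single')
  fix p :: "site \<times> nat"
  show "(\<lambda>x. splice u (f x) (g x) p) \<in> N \<rightarrow>\<^sub>M wait_mark_space"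
    unfolding splice_def
    by (rule measurable_compose[OF measurable_site_splice measurable_site_coordinate])
       (rule measurable_compose[OF assms(1) measurable_harris_site] measurable_compose[OF assms(2) measurable_harris_site])+
qed simp

lemma measurable_splice_sites:
  "(\<lambda>(h, h') i. site_splice u (\<lambda>k. h (i, k)) (\<lambda>k. h' (i, k)))
     \<in> harris_space \<Otimes>\<^sub>M harris_space \<rightarrow>\<^sub>M Pi\<^sub>M UNIV (\<lambda>_ :: site. site_space)"
  unfolding split_beta'
proof (rule measurable_PiM_single')
  fix i :: site
  show "(\<lambda>x. site_splice u (\<lambda>k. fst x (i, k)) (\<lambda>k. snd x (i, k)))
      \<in> harris_space \<Otimes>\<^sub>M harris_space \<rightarrow>\<^sub>M site_space"
    by (intro measurable_site_splice measurable_compose[OF measurable_fst measurable_harris_site]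
        measurable_compose[OF measurable_snd measurable_harris_site])
qed simp

text \<open>A product measure is determined by finite rectangles. With \<open>h\<close> fixed,
  independence of the sites under \<open>h'\<close> factors the probability of a rectangle;
  integrating over \<open>h\<close> then uses independence of the sites once more.\<close>

lemma distr_splice_sites:
  assumes u: "0 \<le> u"
  shows "distr (harris_space \<Otimes>\<^sub>M harris_space) (Pi\<^sub>M UNIV (\<lambda>_ :: site. site_space))
    (\<lambda>(h, h') i. site_splice u (\<lambda>k. h (i, k)) (\<lambda>k. h' (i, k))) = Pi\<^sub>M UNIV (\<lambda>_. site_space)"
    (is "distr _ ?P ?Z = _")
proof -
  interpret P: product_prob_space "\<lambda>_ :: site. site_space" UNIV by unfold_locales
  show ?thesis
  proof (rule P.PiM_eq)
    fix J :: "site set" and F assume J: "finite J" and F: "\<And>j. j \<in> J \<Longrightarrow> F j \<in> sets site_space"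
    \<comment> \<open>The conditional probability, given the first sequence at \<open>j\<close>,
      that the spliced one lands in \<open>F j\<close>.\<close>
    define \<psi> where "\<psi> j a = emeasure site_space {b. site_splice u a b \<in> F j}" for j a
    let ?C = "{w \<in> space ?P. \<forall>j\<in>J. w j \<in> F j}"
    have emb: "prod_emb UNIV (\<lambda>_. site_space) J (Pi\<^sub>E J F) = ?C"
      by (auto simp: prod_emb_def space_PiM PiE_iff)
    have C: "?C \<in> sets ?P" using J F by measurable
    have m\<psi>: "\<psi> j \<in> borel_measurable site_space" if "j \<in> J" for j
    proof -
      have [measurable]: "F j \<in> sets site_space" by (rule F[OF that])
      have "{x \<in> space (site_space \<Otimes>\<^sub>M site_space). site_splice u (fst x) (snd x) \<in> F j} \<in> sets (site_space \<Otimes>\<^sub>M site_space)"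
        by measurable
      from site.measurable_emeasure_Pair[OF this] show ?thesis
        unfolding \<psi>_def by (simp add: vimage_def space_pair_measure)
    qed
    have "emeasure (distr (harris_space \<Otimes>\<^sub>M harris_space) ?P ?Z) ?C =
        emeasure (harris_space \<Otimes>\<^sub>M harris_space) (?Z -` ?C \<inter> space (harris_space \<Otimes>\<^sub>M harris_space))"
      by (rule emeasure_distr[OF measurable_splice_sites C])
    also have "\<dots> = (\<integral>\<^sup>+h. emeasure harris_space (Pair h -` (?Z -` ?C \<inter> space (harris_space \<Otimes>\<^sub>M harris_space))) \<partial>harris_space)"
      by (rule harris.emeasure_pair_measure_alt[OF measurable_sets[OF measurable_splice_sites C]])
    also have "\<dots> = (\<integral>\<^sup>+h. (\<Prod>j\<in>J. \<psi> j (\<lambda>k. h (j, k))) \<partial>harris_space)"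
    proof (rule nn_integral_cong)
      fix h :: harris
      have "Pair h -` (?Z -` ?C \<inter> space (harris_space \<Otimes>\<^sub>M harris_space)) =
          {h'. \<forall>j\<in>J. (\<lambda>k. h' (j, k)) \<in> {b. site_splice u (\<lambda>k. h (j, k)) b \<in> F j}}"
        by (auto simp: space_pair_measure space_PiM)
      also have "emeasure harris_space \<dots> = (\<Prod>j\<in>J. \<psi> j (\<lambda>k. h (j, k)))"
        unfolding \<psi>_def
      proof (rule emeasure_harris_sites[OF J])
        fix j assume "j \<in> J"
        then have [measurable]: "F j \<in> sets site_space" by (rule F)
        have "{b \<in> space site_space. site_splice u (\<lambda>k. h (j, k)) b \<in> F j} \<in> sets site_space" by measurable
        then show "{b. site_splice u (\<lambda>k. h (j, k)) b \<in> F j} \<in> sets site_space" by simp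
      qed
      finally show "emeasure harris_space (Pair h -` (?Z -` ?C \<inter> space (harris_space \<Otimes>\<^sub>M harris_space))) =
          (\<Prod>j\<in>J. \<psi> j (\<lambda>k. h (j, k)))" .
    qed
    also have "\<dots> = (\<Prod>j\<in>J. \<integral>\<^sup>+h. \<psi> j (\<lambda>k. h (j, k)) \<partial>harris_space)"
      by (intro harris.indep_vars_nn_integral J
          harris.indep_vars_compose2[OF harris.indep_vars_subset[OF indep_sites]] m\<psi>) auto
    also have "\<dots> = (\<Prod>j\<in>J. emeasure site_space (F j))"
    proof (rule prod.cong[OF refl])
      fix j assume j: "j \<in> J"
      have "(\<integral>\<^sup>+h. \<psi> j (\<lambda>k. h (j, k)) \<partial>harris_space) = (\<integral>\<^sup>+a. \<psi> j a \<partial>distr harris_space site_space (\<lambda>h k. h (j, k)))"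
        by (rule nn_integral_distr[symmetric, OF measurable_harris_site]) (use m\<psi>[OF j] in simp)
      also have "\<dots> = emeasure site_space (F j)"
        unfolding distr_harris_site \<psi>_def by (rule emeasure_site_splice[OF F[OF j] u])
      finally show "(\<integral>\<^sup>+h. \<psi> j (\<lambda>k. h (j, k)) \<partial>harris_space) = emeasure site_space (F j)" .
    qed
    finally show "emeasure (distr (harris_space \<Otimes>\<^sub>M harris_space) ?P ?Z)
        (prod_emb UNIV (\<lambda>_. site_space) J (\<Pi>\<^sub>E j\<in>J. F j)) = (\<Prod>j\<in>J. emeasure site_space (F j))"
      unfolding emb .
  qed simp
qed

lemma distr_splice:
  assumes u: "0 \<le> u"
  shows "distr (harris_space \<Otimes>\<^sub>M harris_space) harris_space (\<lambda>(h, h'). splice u h h') = harris_space"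
proof -
  have "harris_space = distr (distr (harris_space \<Otimes>\<^sub>M harris_space) (Pi\<^sub>M UNIV (\<lambda>_ :: site. site_space))
    (\<lambda>(h, h') i. site_splice u (\<lambda>k. h (i, k)) (\<lambda>k. h' (i, k)))) harris_space (\<lambda>w p. w (fst p) (snd p))"
    unfolding distr_splice_sites[OF u] distr_harris_uncurry ..
  also have "\<dots> = distr (harris_space \<Otimes>\<^sub>M harris_space) harris_space
      ((\<lambda>w p. w (fst p) (snd p)) \<circ> (\<lambda>(h, h') i. site_splice u (\<lambda>k. h (i, k)) (\<lambda>k. h' (i, k))))"
    by (rule distr_distr[OF measurable_harris_uncurry measurable_splice_sites])
  finally show ?thesis
    by (simp add: splice_def comp_def split_beta')
qed

section \<open>Ring times and marks after splicing\<close>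

lemma psum_restart_before: "k \<le> n \<Longrightarrow> psum (restart n u a b) k = psum a k"
  unfolding psum_def restart_def by (intro sum.cong) (auto simp: comb_seq_less)

text \<open>The first wait after the switch contains \<open>u - psum a n\<close>, which cancels the
  time already spent by \<open>a\<close>; from there on the rings are those of \<open>b\<close>
  delayed by \<open>u\<close>.\<close>

lemma psum_restart_after: "psum (restart n u a b) (Suc (n + m)) = u + psum b (Suc m)"
proof (induction m)
  case 0
  show ?case by (simp add: psum_restart_before) (simp add: restart_def comb_seq_at)
next
  case (Suc m)
  have "restart n u a b (Suc m + n) = b (Suc m)"
    unfolding restart_def comb_seq_add by simp
  then show ?case using Suc by (simp add: ac_simps)
qed

lemma snd_restart: "snd (restart n u a b k) = (if k < n then snd (a k) else snd (b (k - n)))"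
  by (auto simp: restart_def comb_seq_def split: nat.split)

lemma
  assumes "regular_site a" and u: "0 \<le> u"
  defines "N \<equiv> (LEAST n. u < psum a (Suc n))"
  shows psum_site_splice: "psum (site_splice u a b) (Suc k) =
      (if k < N then psum a (Suc k) else u + psum b (Suc (k - N)))"
    and snd_site_splice: "snd (site_splice u a b k) = (if k < N then snd (a k) else snd (b (k - N)))"
    and site_splice_less_iff: "k < N \<longleftrightarrow> psum a (Suc k) \<le> u"
proof -
  have N: "psum a N \<le> u" "u < psum a (Suc N)"
    using regular_site_count[OF assms(1,2), of N] unfolding N_def by blast+
  have mono: "psum a k < psum a l \<longleftrightarrow> k < l" for k l
    by (rule strict_mono_less[OF strict_mono_psum[OF assms(1)]])
  show "psum (site_splice u a b) (Suc k) = (if k < N then psum a (Suc k) else u + psum b (Suc (k - N)))"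
    using psum_restart_after[of N u a b "k - N"] psum_restart_before[of "Suc k" N u a b]
    unfolding site_splice_def N_def[symmetric] by (auto simp del: psum_simps)
  show "snd (site_splice u a b k) = (if k < N then snd (a k) else snd (b (k - N)))"
    unfolding site_splice_def N_def[symmetric] by (rule snd_restart)
  show "k < N \<longleftrightarrow> psum a (Suc k) \<le> u"
    using mono[of "Suc k" "Suc N"] mono[of N "Suc k"] N by linarith
qed

context
  fixes h h' :: harris and u :: real
  assumes h: "regular h" and h': "regular h'" and u: "0 \<le> u"
begin

lemma
  defines "N \<equiv> \<lambda>i. LEAST n. u < ring_time h i n"
  shows ring_time_splice: "ring_time (splice u h h') i k =
      (if k < N i then ring_time h i k else u + ring_time h' i (k - N i))"
    and ring_mark_splice: "ring_mark (splice u h h') i k =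
      (if k < N i then ring_mark h i k else ring_mark h' i (k - N i))"
    and splice_less_iff: "k < N i \<longleftrightarrow> ring_time h i k \<le> u"
proof -
  have r: "regular_site (\<lambda>k. h (i, k))" using h by (simp add: regular_iff_sites)
  note * = psum_site_splice[OF r u] snd_site_splice[OF r u] site_splice_less_iff[OF r u]
  show "ring_time (splice u h h') i k = (if k < N i then ring_time h i k else u + ring_time h' i (k - N i))"
    and "ring_mark (splice u h h') i k = (if k < N i then ring_mark h i k else ring_mark h' i (k - N i))"
    and "k < N i \<longleftrightarrow> ring_time h i k \<le> u"
    unfolding ring_time_psum ring_mark_def splice_def N_def fst_conv snd_conv by (rule *)+
qed

lemma splice_ring_before:
  assumes "t \<le> u"
  shows "ring_time (splice u h h') i k = t \<longleftrightarrow> ring_time h i k = t"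
    and "ring_time h i k = t \<Longrightarrow> ring_mark (splice u h h') i k = ring_mark h i k"
  using assms ring_time_pos[OF h', of i] splice_less_iff[of k i]
  unfolding ring_time_splice ring_mark_splice
  by (auto simp: not_le) (smt (verit))+

text \<open>Rings after \<open>u\<close> are rings of \<open>h'\<close> with the index shifted by
  the number of rings of \<open>h\<close> at that site up to \<open>u\<close>; hence the index
  \<open>l\<close> is only asserted to exist.\<close>

lemma splice_ring_after:
  assumes "u < t"
  shows "(\<forall>k. ring_time (splice u h h') i k \<noteq> t) \<longleftrightarrow> (\<forall>k. ring_time h' i k \<noteq> t - u)"
    and "ring_time (splice u h h') i k = t \<Longrightarrow> \<exists>l. ring_time h' i l = t - u \<and> ring_mark (splice u h h') i k = ring_mark h' i l"
proof -
  define N where "N = (LEAST n. u < ring_time h i n)"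
  have 1: "N \<le> k \<and> ring_time h' i (k - N) = t - u \<and> ring_mark (splice u h h') i k = ring_mark h' i (k - N)"
    if "ring_time (splice u h h') i k = t" for k
    using that assms splice_less_iff[of k i]
    unfolding ring_time_splice ring_mark_splice N_def[symmetric] by (auto split: if_splits)
  have 2: "ring_time (splice u h h') i (N + l) = t" if "ring_time h' i l = t - u" for l
    using that unfolding ring_time_splice N_def[symmetric] by simp
  show "(\<forall>k. ring_time (splice u h h') i k \<noteq> t) \<longleftrightarrow> (\<forall>k. ring_time h' i k \<noteq> t - u)"
    using 1 2 by blast
  show "ring_time (splice u h h') i k = t \<Longrightarrow> \<exists>l. ring_time h' i l = t - u \<and> ring_mark (splice u h h') i k = ring_mark h' i l"
    using 1 by blast
qed

end

section \<open>Probability that clocks ring in a time window\<close>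

definition rings_in :: "harris \<Rightarrow> site \<Rightarrow> real \<Rightarrow> real \<Rightarrow> bool" where
  "rings_in h i s t \<longleftrightarrow> (\<exists>k. s < ring_time h i k \<and> ring_time h i k \<le> t)"

text \<open>Splice at \<open>s\<close>: the first ring after \<open>s\<close> then comes after a
  fresh exponential wait, so a ring in the window forces that wait to be at most
  \<open>t - s\<close>. This has probability 1 - exp(-(t - s)), at most
  \<open>t - s\<close>.\<close>

lemma emeasure_site_rings:
  assumes s: "0 \<le> s" "s \<le> t"
  shows "emeasure site_space {a. \<exists>k. s < psum a (Suc k) \<and> psum a (Suc k) \<le> t} \<le> ennreal (t - s)"
proof -
  let ?A = "{a. \<exists>k. s < psum a (Suc k) \<and> psum a (Suc k) \<le> t}"
  interpret P: product_prob_space "\<lambda>_ :: nat. wait_mark_space" UNIV by unfold_locales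
  have "{a \<in> space site_space. \<exists>k. s < psum a (Suc k) \<and> psum a (Suc k) \<le> t} \<in> sets site_space" by measurable
  then have A: "?A \<in> sets site_space" by simp
  have "{b \<in> space site_space. fst (b 0) \<le> t - s} \<in> sets site_space" by measurable
  then have B: "{b. fst (b 0) \<le> t - s} \<in> sets site_space" by simp
  have W: "{x \<in> space wait_mark_space. fst x \<le> t - s} \<in> sets wait_mark_space" by measurable
  have "emeasure site_space {b. site_splice s a b \<in> ?A} \<le> emeasure site_space {b. fst (b 0) \<le> t - s}"
    if a: "regular_site a" for a
  proof (rule emeasure_mono_AE[OF _ B])
    show "AE b in site_space. b \<in> {b. site_splice s a b \<in> ?A} \<longrightarrow> b \<in> {b. fst (b 0) \<le> t - s}"
      using AE_regular_site
    proof eventually_elim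
      case (elim b)
      show ?case
      proof
        assume "b \<in> {b. site_splice s a b \<in> ?A}"
        then obtain k where k: "s < psum (site_splice s a b) (Suc k)" "psum (site_splice s a b) (Suc k) \<le> t"
          by auto
        define N where "N = (LEAST n. s < psum a (Suc n))"
        have "\<not> k < N"
          using k(1) psum_site_splice[OF a s(1), of b k] site_splice_less_iff[OF a s(1), of k]
          unfolding N_def[symmetric] by auto
        then have "psum b (Suc (k - N)) \<le> t - s"
          using k(2) psum_site_splice[OF a s(1), of b k] unfolding N_def[symmetric] by auto
        moreover have "psum b (Suc 0) \<le> psum b (Suc (k - N))"
          using strict_mono_less_eq[OF strict_mono_psum[OF elim]] by blast
        ultimately show "b \<in> {b. fst (b 0) \<le> t - s}" by simp
      qed
    qed
  qed
  then have "(\<integral>\<^sup>+a. emeasure site_space {b. site_splice s a b \<in> ?A} \<partial>site_space) \<le>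
      (\<integral>\<^sup>+a. emeasure site_space {b. fst (b 0) \<le> t - s} \<partial>site_space)"
    using AE_regular_site by (intro nn_integral_mono_AE) auto
  also have "\<dots> = emeasure site_space {b. fst (b 0) \<le> t - s}"
    using site.emeasure_space_1 by simp
  also have "\<dots> = emeasure wait_mark_space {x. fst x \<le> t - s}"
    using P.emeasure_PiM_Collect_single[of 0 "{x. fst x \<le> t - s}"] W by (simp add: site_space_def space_PiM)
  also have "\<dots> = ennreal (1 - exp (- (t - s)))"
    using s by (intro emeasure_wait_le) simp
  also have "\<dots> \<le> ennreal (t - s)"
    using exp_ge_add_one_self[of "- (t - s)"] by (intro ennreal_leI) linarith
  finally show ?thesis using emeasure_site_splice[OF A s(1)] by simp
qed

lemma rings_in_sites: "rings_in h i s t \<longleftrightarrow> (\<lambda>k. h (i, k)) \<in> {a. \<exists>k. s < psum a (Suc k) \<and> psum a (Suc k) \<le> t}"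
  by (simp add: rings_in_def ring_time_psum del: psum_simps)

lemma measurable_rings_in [measurable]: "Measurable.pred harris_space (\<lambda>h. rings_in h i s t)"
  unfolding rings_in_def by measurable

lemma emeasure_rings_in_all:
  assumes "0 \<le> s" "s \<le> t" "finite I"
  shows "emeasure harris_space {h. \<forall>i\<in>I. rings_in h i s t} \<le> ennreal ((t - s) ^ card I)"
proof -
  let ?A = "{a. \<exists>k. s < psum a (Suc k) \<and> psum a (Suc k) \<le> t}"
  have "{a \<in> space site_space. \<exists>k. s < psum a (Suc k) \<and> psum a (Suc k) \<le> t} \<in> sets site_space" by measurable
  then have A: "?A \<in> sets site_space" by simp
  have "emeasure harris_space {h. \<forall>i\<in>I. rings_in h i s t} = (\<Prod>i\<in>I. emeasure site_space ?A)"
    unfolding rings_in_sites by (rule emeasure_harris_sites[OF assms(3) A])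
  also have "\<dots> \<le> (\<Prod>i\<in>I. ennreal (t - s))"
    by (intro prod_mono_ennreal emeasure_site_rings assms)
  finally show ?thesis using assms by (simp add: ennreal_power)
qed

subsection \<open>Finiteness of the backward chains\<close>

primrec walks :: "nat \<Rightarrow> site \<Rightarrow> site list set" where
  "walks 0 i = {[i]}"
| "walks (Suc n) i = (\<Union>j\<in>{j. adjacent i j}. (#) i ` walks n j)"

lemma walks_length: "p \<in> walks n i \<Longrightarrow> length p = Suc n"
  by (induction n arbitrary: p i) auto

lemma finite_walks [simp]: "finite (walks n i)"
  by (induction n arbitrary: i) auto

lemma card_walks: "card (walks n i) \<le> 4 ^ n"
proof (induction n arbitrary: i)
  case (Suc n)
  have "card (walks (Suc n) i) \<le> (\<Sum>j\<in>{j. adjacent i j}. card ((#) i ` walks n j))"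
    by (simp add: card_UN_le)
  also have "\<dots> \<le> (\<Sum>j\<in>{j. adjacent i j}. 4 ^ n)"
    by (intro sum_mono order_trans[OF card_image_le Suc]) simp
  also have "\<dots> \<le> 4 * 4 ^ n"
    by (simp add: neighbours_eq card_insert_if)
  finally show ?case by simp
qed simp

text \<open>Discard what precedes an occurrence of \<open>x\<close>. This is the cut that removes a
  loop.\<close>

lemma walks_suffix:
  assumes "p \<in> walks n i" "x \<in> set p"
  shows "\<exists>m q. q \<in> walks m x \<and> last q = last p \<and> set q \<subseteq> set p \<and> (distinct p \<longrightarrow> distinct q)"
  using assms
proof (induction n arbitrary: p i)
  case 0
  then show ?case by (intro exI[of _ 0] exI[of _ p]) auto
next
  case (Suc n)
  then obtain j p' where p: "p = i # p'" "p' \<in> walks n j" by auto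
  show ?case
  proof (cases "x = i")
    case True
    then show ?thesis using Suc.prems by (intro exI[of _ "Suc n"] exI[of _ p]) auto
  next
    case False
    then have "x \<in> set p'" using Suc.prems p by simp
    from Suc.IH[OF p(2) this] show ?thesis using p walks_length[OF p(2)] by fastforce
  qed
qed

lemma walks_prefix:
  assumes "p \<in> walks n i" "m \<le> n"
  shows "\<exists>q\<in>walks m i. set q \<subseteq> set p \<and> (distinct p \<longrightarrow> distinct q)"
  using assms
proof (induction m arbitrary: p n i)
  case 0
  then show ?case by (cases n) auto
next
  case (Suc m)
  then obtain n' where n: "n = Suc n'" "m \<le> n'" by (cases n) auto
  then obtain j p' where p: "p = i # p'" "p' \<in> walks n' j" "adjacent i j" using Suc.prems by auto
  from Suc.IH[OF p(2) n(2)] obtain q where "q \<in> walks m j" "set q \<subseteq> set p'" "distinct p' \<longrightarrow> distinct q"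
    by blast
  then show ?case using p by (intro bexI[of _ "i # q"]) auto
qed

text \<open>Loop erasure along the sequence: prepend the next site to a self-avoiding walk or, if
  the site is already on it, cut the walk there. A self-avoiding walk to a point that short walks
  from \<open>s 0\<close> cannot reach has a prefix with \<open>n\<close> steps.\<close>

lemma infinite_walk_distinct:
  fixes s :: "nat \<Rightarrow> site"
  assumes adj: "\<And>n. adjacent (s n) (s (Suc n))" and inf: "infinite (range s)"
  shows "\<exists>p\<in>walks n (s 0). distinct p \<and> set p \<subseteq> range s"
proof -
  have reach: "\<exists>n p. p \<in> walks n (s k) \<and> distinct p \<and> set p \<subseteq> range s \<and> last p = s (k + m)" for k m
  proof (induction m arbitrary: k)
    case 0
    show ?case by (intro exI[of _ 0] exI[of _ "[s k]"]) auto
  next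
    case (Suc m)
    from Suc.IH[of "Suc k"] obtain n p where p: "p \<in> walks n (s (Suc k))" "distinct p" "set p \<subseteq> range s"
      "last p = s (Suc k + m)" by auto
    show ?case
    proof (cases "s k \<in> set p")
      case True
      from walks_suffix[OF p(1) this] p show ?thesis by fastforce
    next
      case False
      then show ?thesis using p adj[of k] walks_length[OF p(1)]
        by (intro exI[of _ "Suc n"] exI[of _ "s k # p"]) auto
    qed
  qed
  \<comment> \<open>Walks with fewer than \<open>n\<close> steps have finitely many endpoints, so an
    infinite range leaves them.\<close>
  have "finite (\<Union>m\<in>{..<n}. last ` walks m (s 0))" by simp
  then obtain m where m: "s m \<notin> (\<Union>m\<in>{..<n}. last ` walks m (s 0))"
    using inf by (meson finite_subset image_subsetI)
  from reach[of 0 m] obtain l p where p: "p \<in> walks l (s 0)" "distinct p" "set p \<subseteq> range s" "last p = s m"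
    by auto
  have "n \<le> l"
  proof (rule ccontr)
    assume "\<not> n \<le> l"
    then have "last p \<in> (\<Union>m\<in>{..<n}. last ` walks m (s 0))" using p(1) by auto
    then show False using m p(4) by simp
  qed
  from walks_prefix[OF p(1) this] p show ?thesis by blast
qed

text \<open>
  In a time window of length 1/8, the sites whose clock rings form a subcritical percolation
  cluster; a backward chain of infinitely many rings would live in one such window eventually.
\<close>

definition finite_clusters :: "harris \<Rightarrow> bool" where
  "finite_clusters h \<longleftrightarrow> (\<forall>i (m::nat). \<exists>n. \<not> (\<exists>p\<in>walks n i. distinct p \<and>
     (\<forall>x\<in>set p. rings_in h x (real m / 8) (real (Suc m) / 8))))"

text \<open>Union bound. A self-avoiding walk of \<open>n\<close> steps visits n + 1 distinct sites,
  whose clocks are independent, so it is open with probability at most (1/8)^(n + 1); at most 4^n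
  walks leave a bound of (1/2)^n.\<close>

lemma AE_finite_clusters: "AE h in harris_space. finite_clusters h"
  unfolding finite_clusters_def AE_all_countable
proof (intro allI)
  fix i :: site and m :: nat
  let ?s = "real m / 8" and ?t = "real (Suc m) / 8"
  let ?B = "\<lambda>n. {h. \<exists>p\<in>walks n i. distinct p \<and> (\<forall>x\<in>set p. rings_in h x ?s ?t)}"
  have "{h \<in> space harris_space. \<exists>p\<in>walks n i. distinct p \<and> (\<forall>x\<in>set p. rings_in h x ?s ?t)} \<in> sets harris_space" for n
    by measurable
  then have B: "?B n \<in> sets harris_space" for n by simp
  have le: "emeasure harris_space (?B n) \<le> ennreal ((1/2) ^ n)" for n
  proof -
    let ?W = "{p \<in> walks n i. distinct p}"
    let ?D = "\<lambda>p. {h. \<forall>x\<in>set p. rings_in h x ?s ?t}"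
    have "{h \<in> space harris_space. \<forall>x\<in>set p. rings_in h x ?s ?t} \<in> sets harris_space" for p by measurable
    then have D: "?D p \<in> sets harris_space" for p by simp
    have "?B n = (\<Union>p\<in>?W. ?D p)" by auto
    then have "emeasure harris_space (?B n) \<le> (\<Sum>p\<in>?W. emeasure harris_space (?D p))"
      using D by (simp only:) (intro emeasure_subadditive_finite, auto)
    also have "\<dots> \<le> (\<Sum>p\<in>?W. ennreal ((1/8) ^ Suc n))"
    proof (rule sum_mono)
      fix p assume p: "p \<in> ?W"
      have "emeasure harris_space (?D p) \<le> ennreal ((?t - ?s) ^ card (set p))"
        by (rule emeasure_rings_in_all) (auto simp: field_simps)
      also have "(?t - ?s) ^ card (set p) = (1/8) ^ Suc n"
        using p walks_length[of p n i] by (simp add: distinct_card field_simps)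
      finally show "emeasure harris_space (?D p) \<le> ennreal ((1/8) ^ Suc n)" .
    qed
    also have "\<dots> = ennreal (real (card ?W) * (1/8) ^ Suc n)"
      by (subst ennreal_mult) (auto simp: ennreal_of_nat_eq_real_of_nat)
    also have "\<dots> \<le> ennreal (4 ^ n * (1/8) ^ Suc n)"
    proof (intro ennreal_leI mult_right_mono)
      have "card ?W \<le> card (walks n i)" by (intro card_mono) auto
      then have "card ?W \<le> 4 ^ n" using card_walks[of n i] by linarith
      then show "real (card ?W) \<le> 4 ^ n" by (metis of_nat_le_iff of_nat_numeral of_nat_power)
    qed simp
    also have "\<dots> \<le> ennreal ((1/2) ^ n)"
      by (intro ennreal_leI) (simp add: power_mult_distrib[symmetric])
    finally show ?thesis .
  qed
  have "emeasure harris_space (\<Inter>n. ?B n) \<le> ennreal ((1/2) ^ n)" for n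
    by (rule order_trans[OF emeasure_mono le[of n]]) (use B in auto)
  moreover have "(\<lambda>n. ennreal ((1/2) ^ n)) \<longlonglongrightarrow> ennreal 0"
    by (intro tendsto_ennrealI LIMSEQ_power_zero) auto
  ultimately have "emeasure harris_space (\<Inter>n. ?B n) \<le> 0"
    by (intro LIMSEQ_le_const[where X="\<lambda>n. ennreal ((1/2) ^ n)"]) auto
  moreover have "(\<Inter>n. ?B n) \<in> sets harris_space" using B by auto
  ultimately show "AE h in harris_space. \<exists>n. \<not> (\<exists>p\<in>walks n i. distinct p \<and> (\<forall>x\<in>set p. rings_in h x ?s ?t))"
    by (intro AE_I[of _ _ "\<Inter>n. ?B n"]) auto
qed

lemma finite_rings_upto:
  assumes "regular h"
  shows "finite {k. ring_time h i k \<le> t}"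
proof -
  obtain n where n: "t < ring_time h i n" using ring_time_unbounded[OF assms] by blast
  have "{k. ring_time h i k \<le> t} \<subseteq> {..<n}"
  proof
    fix k assume "k \<in> {k. ring_time h i k \<le> t}"
    then have "ring_time h i k < ring_time h i n" using n by simp
    then show "k \<in> {..<n}" by (simp add: ring_time_less_iff[OF assms])
  qed
  then show ?thesis by (rule finite_subset) simp
qed

text \<open>Along an infinite chain the ring times decrease to a limit \<open>L\<close>, so
  eventually all lie in the window containing \<open>L\<close>. Each site rings finitely often up to
  a given time and no ring repeats, so the chain visits infinitely many sites; loop erasure then
  gives open self-avoiding walks of every length.\<close>

lemma wf_ring_before:
  assumes h: "regular h" and fc: "finite_clusters h"
  shows "wf {((j, l), (i, k)). adjacent i j \<and> ring_before h (ring_time h i k) j l}" (is "wf ?r")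
  unfolding wf_iff_no_infinite_down_chain
proof
  assume "\<exists>f. \<forall>n. (f (Suc n), f n) \<in> ?r"
  then obtain f where f: "\<And>n. (f (Suc n), f n) \<in> ?r" by blast
  define x where "x n = fst (f n)" for n
  define \<tau> where "\<tau> n = ring_time h (fst (f n)) (snd (f n))" for n
  have adj: "adjacent (x n) (x (Suc n))" and dec: "\<tau> (Suc n) < \<tau> n" for n
    using f[of n] by (auto simp: x_def \<tau>_def ring_before_def split: prod.splits)
  have pos: "0 < \<tau> n" for n unfolding \<tau>_def by (rule ring_time_pos[OF h])
  have decs: "decseq \<tau>" by (rule decseq_SucI) (use dec in \<open>simp add: less_imp_le\<close>)
  obtain L where L: "\<tau> \<longlonglongrightarrow> L" "\<And>n. L \<le> \<tau> n"
    using decseq_convergent[OF decs, of 0] pos by (auto intro: less_imp_le)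
  \<comment> \<open>Strictness matters: the windows of \<open>rings_in\<close> are open on the left
    and \<open>L\<close> may be a window's left end.\<close>
  have L': "L < \<tau> n" for n using L(2)[of "Suc n"] dec[of n] by linarith
  have "0 \<le> L" using L(1) pos by (intro LIMSEQ_le_const) (auto intro: less_imp_le)
  define m where "m = nat \<lfloor>8 * L\<rfloor>"
  have m: "real m / 8 \<le> L" "L < real (Suc m) / 8"
    using \<open>0 \<le> L\<close> unfolding m_def by (auto simp: field_simps) linarith+
  have "\<forall>\<^sub>F n in sequentially. \<tau> n < real (Suc m) / 8" using L(1) m(2) by (rule order_tendstoD)
  then obtain n0 where n0: "\<And>n. n \<ge> n0 \<Longrightarrow> \<tau> n < real (Suc m) / 8"
    unfolding eventually_sequentially by blast
  define s where "s n = x (n0 + n)" for n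
  have open_site: "rings_in h y (real m / 8) (real (Suc m) / 8)" if y: "y \<in> range s" for y
  proof -
    obtain n where "y = s n" using y by blast
    then have "y = x (n0 + n)" by (simp add: s_def)
    then show ?thesis using n0[of "n0 + n"] L'[of "n0 + n"] m(1)
      unfolding rings_in_def \<tau>_def x_def by (intro exI[of _ "snd (f (n0 + n))"]) auto
  qed
  have "infinite (range s)"
  proof
    assume fin: "finite (range s)"
    let ?F = "SIGMA i:range s. {k. ring_time h i k \<le> real (Suc m) / 8}"
    have "finite ?F" using fin by (rule finite_SigmaI) (rule finite_rings_upto[OF h])
    moreover have "range (\<lambda>n. f (n0 + n)) \<subseteq> ?F"
    proof
      fix e assume "e \<in> range (\<lambda>n. f (n0 + n))"
      then obtain n where e: "e = f (n0 + n)" by blast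
      have "(fst e, snd e) \<in> ?F"
      proof (rule SigmaI)
        show "fst e \<in> range s" unfolding e s_def x_def by blast
        show "snd e \<in> {k. ring_time h (fst e) k \<le> real (Suc m) / 8}"
          using n0[of "n0 + n"] unfolding e \<tau>_def by simp
      qed
      then show "e \<in> ?F" by simp
    qed
    moreover have "inj (\<lambda>n. f (n0 + n))"
    proof (rule injI)
      fix a b assume "f (n0 + a) = f (n0 + b)"
      then have "\<tau> (n0 + a) = \<tau> (n0 + b)" by (simp add: \<tau>_def)
      moreover have "strict_mono (\<lambda>n. - \<tau> n)" by (rule strict_monoI_Suc) (use dec in simp)
      ultimately show "a = b" using strict_mono_eq[of "\<lambda>n. - \<tau> n" "n0 + a" "n0 + b"] by simp
    qed
    ultimately show False using range_inj_infinite finite_subset by blast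
  qed
  moreover have "adjacent (s n) (s (Suc n))" for n using adj[of "n0 + n"] by (simp add: s_def)
  ultimately have "\<exists>p\<in>walks n (s 0). distinct p \<and> set p \<subseteq> range s" for n
    by (intro infinite_walk_distinct)
  then have "\<exists>p\<in>walks n (s 0). distinct p \<and> (\<forall>y\<in>set p. rings_in h y (real m / 8) (real (Suc m) / 8))" for n
    using open_site by (meson subsetD)
  then show False using fc unfolding finite_clusters_def by blast
qed

lemma deep_antimono: "deep h n i k \<Longrightarrow> m \<le> n \<Longrightarrow> deep h m i k"
proof (induction m arbitrary: n i k)
  case (Suc m)
  then obtain n' where n: "n = Suc n'" "m \<le> n'" by (cases n) auto
  with Suc.prems obtain j l where "adjacent i j" "ring_before h (ring_time h i k) j l" "deep h n' j l"
    by auto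
  moreover then have "deep h m j l" by (intro Suc.IH[OF _ n(2)])
  ultimately show ?case unfolding deep.simps by blast
qed simp

text \<open>The argument of Koenig's lemma: branching is finite, since there are four neighbours
  with finitely many earlier rings each. Well-founded induction can therefore take the maximum of
  the successors' depths.\<close>

lemma good_if_finite_clusters:
  assumes h: "regular h" and fc: "finite_clusters h"
  shows "good h"
proof -
  have "\<exists>n. \<not> deep h n (fst e) (snd e)" for e
  proof (induction e rule: wf_induct_rule[OF wf_ring_before[OF h fc]])
    case (1 e)
    obtain i k where e: "e = (i, k)" by (cases e)
    let ?P = "{(j, l). adjacent i j \<and> ring_before h (ring_time h i k) j l}"
    have "?P \<subseteq> (SIGMA j:{j. adjacent i j}. {l. ring_time h j l \<le> ring_time h i k})"
      by (auto simp: ring_before_def)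
    then have fin: "finite ?P"
      by (rule finite_subset) (intro finite_SigmaI finite_neighbours finite_rings_upto[OF h])
    have "\<forall>e'\<in>?P. \<exists>n. \<not> deep h n (fst e') (snd e')" using 1 e by auto
    then obtain N where N: "\<And>e'. e' \<in> ?P \<Longrightarrow> \<not> deep h (N e') (fst e') (snd e')" by metis
    define M where "M = Max (insert 0 (N ` ?P))"
    have "\<not> deep h M (fst e') (snd e')" if "e' \<in> ?P" for e'
    proof -
      have "N e' \<le> M" unfolding M_def using fin that by (intro Max_ge) auto
      then show ?thesis using N[OF that] deep_antimono by blast
    qed
    then have "\<not> deep h (Suc M) i k" by auto
    then show ?case unfolding e fst_conv snd_conv by (rule exI)
  qed
  then show ?thesis using h unfolding good_def by (metis fst_conv snd_conv)
qed

lemma AE_good: "AE h in harris_space. good h"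
  using AE_regular AE_finite_clusters by eventually_elim (rule good_if_finite_clusters)

subsection \<open>Symmetries\<close>

definition harris_shift :: "site \<Rightarrow> harris \<Rightarrow> harris" where
  "harris_shift u h = (\<lambda>p. h (fst p - u, snd p))"

text \<open>Reflection preserves the uniform law of the marks, and matches the fact that flipping a
  configuration replaces its \<open>plus_prob\<close> by one minus it.\<close>

definition harris_flip :: "harris \<Rightarrow> harris" where
  "harris_flip h = (\<lambda>p. (fst (h p), 1 - snd (h p)))"

lemma measurable_harris_shift [measurable]: "harris_shift u \<in> harris_space \<rightarrow>\<^sub>M harris_space"
  unfolding harris_shift_def
  by (subst (2) harris_space_eq) (rule measurable_PiM_single', auto intro: measurable_harris_coordinate)

lemma distr_harris_shift: "distr harris_space harris_space (harris_shift u) = harris_space"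
proof -
  have "inj_on (\<lambda>p. (fst p - u, snd p)) (UNIV :: (site \<times> nat) set)"
    by (rule injI) (auto simp: prod_eq_iff)
  from distr_PiM_reindex[of UNIV "\<lambda>_. wait_mark_space", OF wait_mark.prob_space_axioms this]
  show ?thesis by (simp add: harris_shift_def[abs_def] flip: harris_space_eq)
qed

lemma distr_unif_flip:
  "distr (uniform_measure lborel {0..1}) (uniform_measure lborel {0..1}) (\<lambda>x::real. 1 - x) = uniform_measure lborel {0..1}"
proof (rule measure_eqI)
  fix A :: "real set" assume "A \<in> sets (distr (uniform_measure lborel {0..1}) (uniform_measure lborel {0..1}) (\<lambda>x::real. 1 - x))"
  then have A [measurable]: "A \<in> sets borel" by simp
  have "lborel = distr lborel borel (\<lambda>x::real. 1 + x)"
    by (rule lborel_distr_plus[symmetric])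
  also have "\<dots> = distr (distr lborel borel uminus) borel (\<lambda>x::real. 1 + x)"
    by (simp add: lborel_distr_uminus)
  also have "\<dots> = distr lborel borel (\<lambda>x::real. 1 - x)"
    by (simp add: distr_distr comp_def)
  finally have l: "lborel = distr lborel borel (\<lambda>x::real. 1 - x)" .
  have "emeasure lborel ({0..1} \<inter> A) = emeasure (distr lborel borel (\<lambda>x::real. 1 - x)) ({0..1} \<inter> A)"
    using l by simp
  also have "\<dots> = emeasure lborel ((\<lambda>x. 1 - x) -` ({0..1} \<inter> A))"
    by (subst emeasure_distr) auto
  also have "(\<lambda>x::real. 1 - x) -` ({0..1} \<inter> A) = {0..1} \<inter> ((\<lambda>x. 1 - x) -` A)"
    by auto
  finally have "emeasure lborel ({0..1} \<inter> A) = emeasure lborel ({0..1} \<inter> ((\<lambda>x. 1 - x) -` A))" .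
  moreover have "(\<lambda>x. 1 - x) -` A \<in> sets borel"
    using measurable_sets[of "\<lambda>x::real. 1 - x" borel borel A] by simp
  ultimately show "emeasure (distr (uniform_measure lborel {0..1}) (uniform_measure lborel {0..1}) (\<lambda>x::real. 1 - x)) A =
      emeasure (uniform_measure lborel {0..1}) A"
    by (subst emeasure_distr) (auto simp: Int_commute)
qed simp

lemma measurable_mark_flip [measurable]: "(\<lambda>x. (fst x, 1 - snd x)) \<in> wait_mark_space \<rightarrow>\<^sub>M wait_mark_space"
  by measurable

lemma distr_mark_flip: "distr wait_mark_space wait_mark_space (\<lambda>x. (fst x, 1 - snd x)) = wait_mark_space"
proof -
  let ?E = "density lborel (exponential_density 1)" and ?U = "uniform_measure lborel {0..1::real}"
  have "?E \<Otimes>\<^sub>M ?U = distr ?E ?E (\<lambda>x. x) \<Otimes>\<^sub>M distr ?U ?U (\<lambda>x. 1 - x)"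
    unfolding distr_unif_flip distr_id ..
  also have "\<dots> = distr (?E \<Otimes>\<^sub>M ?U) (?E \<Otimes>\<^sub>M ?U) (\<lambda>(x, y). (x, 1 - y))"
    by (rule pair_measure_distr) (auto simp: distr_unif_flip intro: unif_prob.sigma_finite_measure_axioms)
  finally show ?thesis by (simp add: wait_mark_space_def split_beta')
qed

lemma measurable_harris_flip [measurable]: "harris_flip \<in> harris_space \<rightarrow>\<^sub>M harris_space"
  unfolding harris_flip_def[abs_def]
  by (subst (2) harris_space_eq)
     (rule measurable_PiM_single', auto intro: measurable_compose[OF measurable_harris_coordinate measurable_mark_flip])

lemma distr_harris_flip: "distr harris_space harris_space harris_flip = harris_space"
proof -
  have 1: "distr harris_space wait_mark_space (\<lambda>h. (fst (h p), 1 - snd (h p))) = wait_mark_space" for p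
  proof -
    have "distr harris_space wait_mark_space (\<lambda>h. h p) = wait_mark_space"
      unfolding harris_space_eq by (rule distr_PiM_component) (auto intro: wait_mark.prob_space_axioms)
    then have "distr (distr harris_space wait_mark_space (\<lambda>h. h p)) wait_mark_space (\<lambda>x. (fst x, 1 - snd x)) = wait_mark_space"
      using distr_mark_flip by simp
    then show ?thesis
      by (subst (asm) distr_distr) (auto intro: measurable_harris_coordinate simp: comp_def)
  qed
  have "harris.indep_vars (\<lambda>_. wait_mark_space) (\<lambda>p h. (fst (h p), 1 - snd (h p))) UNIV"
    using harris.indep_vars_compose2[OF indep_coordinates measurable_mark_flip] .
  then have "distr harris_space (Pi\<^sub>M UNIV (\<lambda>_. wait_mark_space)) (\<lambda>h. \<lambda>p\<in>UNIV. (fst (h p), 1 - snd (h p))) =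
      Pi\<^sub>M UNIV (\<lambda>p. distr harris_space wait_mark_space (\<lambda>h. (fst (h p), 1 - snd (h p))))"
    by (subst (asm) harris.indep_vars_iff_distr_eq_PiM)
       (auto intro: measurable_compose[OF measurable_harris_coordinate measurable_mark_flip])
  then show ?thesis
    by (simp add: 1 harris_flip_def[abs_def] flip: harris_space_eq)
qed

text \<open>\<open>plus_prob\<close> is a function of an integer, the sum of the neighbouring spins,
  so it takes countably many values, while the marks have no atoms. Excluding ties makes the
  reflection of marks compatible with the rule \<open>ring_mark \<le> plus_prob\<close>.\<close>

lemma AE_marks_not_plus_prob: "AE h in harris_space. \<forall>p \<sigma> i. snd (h p) \<noteq> plus_prob \<beta> \<sigma> i"
proof -
  let ?V = "range (\<lambda>z::int. 1 / (1 + exp (- 2 * \<beta> * of_int z)))"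
  have V: "plus_prob \<beta> \<sigma> i \<in> ?V" for \<sigma> i
  proof -
    have *: "(\<Sum>j | adjacent i j. spin (\<sigma> j)) = of_int (\<Sum>j | adjacent i j. if \<sigma> j then 1 else - 1)"
      unfolding of_int_sum by (intro sum.cong) (auto simp: spin_def)
    show ?thesis unfolding plus_prob_def * by blast
  qed
  have "AE h in harris_space. snd (h p) \<noteq> v" for p v
  proof -
    have "AE y in uniform_measure lborel {0..1::real}. y \<noteq> v"
      by (rule AE_uniform_measureI) (use AE_lborel_singleton[of v] in auto)
    moreover interpret pair_sigma_finite "density lborel (exponential_density 1)" "uniform_measure lborel {0..1::real}"
      by unfold_locales
    have "{x \<in> space wait_mark_space. snd x \<noteq> v} \<in> sets wait_mark_space" by measurable
    ultimately have "AE x in wait_mark_space. snd x \<noteq> v"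
      unfolding wait_mark_space_def by (intro AE_pair_measure) auto
    then show ?thesis
      unfolding harris_space_eq
      by (intro AE_PiM_component[where P="\<lambda>x. snd x \<noteq> v"]) (auto intro: wait_mark.prob_space_axioms)
  qed
  then have "AE h in harris_space. \<forall>p. \<forall>v\<in>?V. snd (h p) \<noteq> v"
    by (simp add: AE_all_countable AE_ball_countable)
  then show ?thesis by eventually_elim (use V in blast)
qed

section \<open>Measurability of the dynamics\<close>

lemma measurable_config_coordinate:
  "(\<lambda>\<sigma> :: config. \<sigma> i) \<in> borel \<rightarrow>\<^sub>M count_space UNIV"
proof -
  have "(\<lambda>\<sigma> :: config. \<sigma> i) \<in> borel \<rightarrow>\<^sub>M (borel :: bool measure)"
    by (rule borel_measurable_continuous_onI) (rule continuous_on_product_coordinates)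
  then show ?thesis by (simp add: measurable_cong_sets[OF refl sets_borel_eq_count_space])
qed

lemma pred_config_coordinate [measurable (raw)]:
  fixes f :: "'a \<Rightarrow> config"
  assumes "f \<in> N \<rightarrow>\<^sub>M borel"
  shows "Measurable.pred N (\<lambda>x. f x i)"
  using measurable_compose[OF assms measurable_config_coordinate] .

lemma measurable_configI:
  fixes f :: "'a \<Rightarrow> config"
  assumes "\<And>i. Measurable.pred N (\<lambda>x. f x i)"
  shows "f \<in> N \<rightarrow>\<^sub>M borel"
proof -
  have "f \<in> N \<rightarrow>\<^sub>M Pi\<^sub>M UNIV (\<lambda>_ :: site. borel :: bool measure)"
  proof (rule measurable_PiM_single')
    show "(\<lambda>x. f x i) \<in> N \<rightarrow>\<^sub>M (borel :: bool measure)" for i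
      using assms[of i] by (simp add: measurable_cong_sets[OF refl sets_borel_eq_count_space])
  qed simp
  then show ?thesis by (simp add: measurable_cong_sets[OF refl sets_PiM_equal_borel])
qed

lemma measurable_plus_prob [measurable (raw)]:
  assumes [measurable]: "\<And>j. Measurable.pred N (\<lambda>x. c x j)"
  shows "(\<lambda>x. plus_prob \<beta> (c x) i) \<in> borel_measurable N"
  unfolding plus_prob_def spin_def by measurable

lemma pred_deep:
  fixes g :: "'a \<Rightarrow> harris"
  assumes g [measurable]: "g \<in> N \<rightarrow>\<^sub>M harris_space"
  shows "Measurable.pred N (\<lambda>x. deep (g x) n i k)"
proof (induction n arbitrary: i k)
  case (Suc n)
  note Suc [measurable]
  show ?case unfolding deep.simps ring_before_def by measurable
qed simp

lemma pred_good:
  fixes g :: "'a \<Rightarrow> harris"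
  assumes g [measurable]: "g \<in> N \<rightarrow>\<^sub>M harris_space"
  shows "Measurable.pred N (\<lambda>x. good (g x))"
proof -
  note pred_deep [OF g, measurable]
  show ?thesis unfolding good_def regular_def by measurable
qed

context
  fixes N :: "'a measure" and f :: "'a \<Rightarrow> config" and g :: "'a \<Rightarrow> harris"
  assumes f [measurable]: "f \<in> N \<rightarrow>\<^sub>M borel" and g [measurable]: "g \<in> N \<rightarrow>\<^sub>M harris_space"
begin

lemma pred_ev_val: "Measurable.pred N (\<lambda>x. ev_val \<beta> (f x) (g x) n i k)"
proof (induction n arbitrary: i k)
  case (Suc n)
  note Suc [measurable]
  show ?case unfolding ev_val.simps ring_before_def by measurable
qed simp

lemma pred_state: "Measurable.pred N (\<lambda>x. state \<beta> (f x) (g x) t i)"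
proof -
  note pred_ev_val [measurable] pred_deep [OF g, measurable]
  show ?thesis unfolding state_def resampled_def ring_upto_def by measurable
qed

lemma measurable_state: "(\<lambda>x. state \<beta> (f x) (g x) t) \<in> N \<rightarrow>\<^sub>M borel"
  by (rule measurable_configI) (rule pred_state)

end

section \<open>A law of large numbers for local observables\<close>

definition nb :: "nat \<Rightarrow> site \<Rightarrow> site set" where
  "nb r i = {fst i - int r..fst i + int r} \<times> {snd i - int r..snd i + int r}"

definition avg :: "nat \<Rightarrow> (site \<Rightarrow> real) \<Rightarrow> real" where
  "avg n f = (\<Sum>i\<in>box n. f i) / real (card (box n))"

definition local_at :: "nat \<Rightarrow> site \<Rightarrow> (harris \<Rightarrow> 'a) \<Rightarrow> bool" where
  "local_at r i X \<longleftrightarrow> (\<forall>h h'. (\<forall>j\<in>nb r i. \<forall>k. h (j, k) = h' (j, k)) \<longrightarrow> X h = X h')"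

lemma local_at_comp: "local_at r i X \<Longrightarrow> local_at r i (\<lambda>h. F (X h))"
  unfolding local_at_def by metis

lemma block_mag_avg: "block_mag n \<sigma> = avg n (\<lambda>i. spin (\<sigma> i))"
  by (simp add: block_mag_def avg_def)

lemma finite_box [simp]: "finite (box n)"
  and card_box: "card (box n) = (2 * n + 1) ^ 2"
proof -
  show "finite (box n)" by (simp add: box_def)
  have "nat (2 * int n + 1) = 2 * n + 1" by simp
  then show "card (box n) = (2 * n + 1) ^ 2"
    by (simp add: box_def card_cartesian_product power2_eq_square nat_mult_distrib)
qed

lemma card_box_pos [simp]: "0 < card (box n)"
  by (simp add: card_box)

lemma card_nb: "card (nb r i) = (2 * r + 1) ^ 2"
proof -
  have "nat (2 * int r + 1) = 2 * r + 1" by simp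
  then show ?thesis
    by (simp add: nb_def card_cartesian_product power2_eq_square algebra_simps)
qed

lemma avg_const [simp]: "avg n (\<lambda>_. c) = c"
  unfolding avg_def sum_constant by (rule nonzero_mult_div_cancel_left) (simp add: card_box)

lemma avg_diff: "avg n (\<lambda>i. f i - g i) = avg n f - avg n g"
  by (simp add: avg_def sum_subtractf diff_divide_distrib)

lemma avg_cmult: "avg n (\<lambda>i. c * f i) = c * avg n f"
  by (simp add: avg_def sum_distrib_left)

lemma avg_mono: "(\<And>i. i \<in> box n \<Longrightarrow> f i \<le> g i) \<Longrightarrow> avg n f \<le> avg n g"
  by (simp add: avg_def divide_right_mono sum_mono)

lemma abs_avg_le: "\<bar>avg n f\<bar> \<le> avg n (\<lambda>i. \<bar>f i\<bar>)"
  by (simp add: avg_def abs_divide divide_right_mono)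

text \<open>A local observable factors through the restriction to its neighbourhood, and
  restrictions to disjoint coordinate sets are independent.\<close>

lemma local_integral_mult:
  fixes X Y :: "harris \<Rightarrow> real"
  assumes [measurable]: "X \<in> borel_measurable harris_space" "Y \<in> borel_measurable harris_space"
    and int: "integrable harris_space X" "integrable harris_space Y"
    and loc: "local_at r i X" "local_at r j Y" and disj: "nb r i \<inter> nb r j = {}"
  shows "(\<integral>h. X h * Y h \<partial>harris_space) = (\<integral>h. X h \<partial>harris_space) * (\<integral>h. Y h \<partial>harris_space)"
proof -
  \<comment> \<open>Extends a partial sample by a default value so that \<open>X\<close> can be
    applied to it; by locality \<open>X\<close> sees only coordinates that were kept.\<close>
  define E where "E A w = (\<lambda>p. if p \<in> A then w p else (0, 0))" for A :: "(site \<times> nat) set" and w :: harris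
  have E: "E A \<in> Pi\<^sub>M A (\<lambda>_. wait_mark_space) \<rightarrow>\<^sub>M harris_space" for A
    unfolding harris_space_eq E_def[abs_def]
  proof (rule measurable_PiM_single')
    fix p
    show "(\<lambda>w. if p \<in> A then w p else (0, 0)) \<in> Pi\<^sub>M A (\<lambda>_. wait_mark_space) \<rightarrow>\<^sub>M wait_mark_space"
      by (cases "p \<in> A") auto
  qed simp
  let ?A = "nb r i \<times> (UNIV :: nat set)" and ?B = "nb r j \<times> (UNIV :: nat set)"
  have "?A \<inter> ?B = {}" using disj by auto
  from harris.indep_var_restrict[OF indep_coordinates this]
  have "harris.indep_var (Pi\<^sub>M ?A (\<lambda>_. wait_mark_space)) (\<lambda>h. restrict h ?A)
     (Pi\<^sub>M ?B (\<lambda>_. wait_mark_space)) (\<lambda>h. restrict h ?B)" by simp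
  from harris.indep_var_compose[OF this measurable_compose[OF E assms(1)] measurable_compose[OF E assms(2)]]
  have "harris.indep_var borel ((\<lambda>w. X (E ?A w)) \<circ> (\<lambda>h. restrict h ?A))
     borel ((\<lambda>w. Y (E ?B w)) \<circ> (\<lambda>h. restrict h ?B))" .
  moreover have "(\<lambda>w. X (E ?A w)) \<circ> (\<lambda>h. restrict h ?A) = X"
    using loc(1) by (auto simp: local_at_def E_def fun_eq_iff)
  moreover have "(\<lambda>w. Y (E ?B w)) \<circ> (\<lambda>h. restrict h ?B) = Y"
    using loc(2) by (auto simp: local_at_def E_def fun_eq_iff)
  ultimately show ?thesis
    using int by (intro harris.indep_var_lebesgue_integral) auto
qed

text \<open>Covariances vanish beyond distance \<open>2 * r\<close>, so the second moment of the
  average is at most a constant over the number of sites, hence summable in \<open>n\<close>. The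
  sum of the squared averages then has finite expectation, is almost surely finite, and its terms
  tend to 0. No stationarity enters, as \<open>X\<close> may vary with the site.\<close>

lemma local_lln:
  fixes X :: "site \<Rightarrow> harris \<Rightarrow> real"
  assumes X [measurable]: "\<And>i. X i \<in> borel_measurable harris_space"
    and bound: "\<And>i h. \<bar>X i h\<bar> \<le> 1"
    and loc: "\<And>i. local_at r i (X i)"
  shows "AE h in harris_space. (\<lambda>n. avg n (\<lambda>i. X i h - (\<integral>h. X i h \<partial>harris_space))) \<longlonglongrightarrow> 0"
proof -
  let ?H = harris_space
  define Y where "Y i h = X i h - (\<integral>h. X i h \<partial>?H)" for i h
  have intX: "integrable ?H (X i)" for i
    by (rule harris.integrable_const_bound[where B=1]) (auto simp: bound)
  have Eb: "\<bar>\<integral>h. X i h \<partial>?H\<bar> \<le> 1" for i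
  proof -
    have "\<bar>\<integral>h. X i h \<partial>?H\<bar> \<le> (\<integral>h. \<bar>X i h\<bar> \<partial>?H)" by (rule integral_abs_bound)
    also have "\<dots> \<le> (\<integral>h. 1 \<partial>?H)" using intX bound by (intro integral_mono) auto
    finally show ?thesis by (simp add: harris.prob_space[unfolded space_harris])
  qed
  have Yb: "\<bar>Y i h\<bar> \<le> 2" for i h
    using abs_triangle_ineq4[of "X i h" "\<integral>h. X i h \<partial>?H"] bound[of i h] Eb[of i] unfolding Y_def by linarith
  have [measurable]: "Y i \<in> borel_measurable ?H" for i unfolding Y_def[abs_def] by measurable
  have intY: "integrable ?H (Y i)" for i
    by (rule harris.integrable_const_bound[where B=2]) (auto simp: Yb)
  have YY: "\<bar>Y i h * Y j h\<bar> \<le> 4" for i j h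
    using mult_mono[OF Yb[of i h] Yb[of j h]] by (simp add: abs_mult)
  have intYY: "integrable ?H (\<lambda>h. Y i h * Y j h)" for i j
    by (rule harris.integrable_const_bound[where B=4]) (auto simp: YY)
  have EY: "(\<integral>h. Y i h \<partial>?H) = 0" for i
    unfolding Y_def using intX by (simp add: harris.prob_space[unfolded space_harris])
  have locY: "local_at r i (Y i)" for i
    unfolding Y_def[abs_def] using loc by (rule local_at_comp)
  \<comment> \<open>Centred variables are bounded by 2, hence the 4; boxes of radius
    \<open>r\<close> are disjoint once their centres are more than \<open>2 * r\<close> apart in
    some coordinate.\<close>
  have cov: "(\<integral>h. Y i h * Y j h \<partial>?H) \<le> (if j \<in> nb (2 * r) i then 4 else 0)" for i j
  proof (cases "j \<in> nb (2 * r) i")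
    case True
    have "(\<integral>h. Y i h * Y j h \<partial>?H) \<le> (\<integral>h. 4 \<partial>?H)"
      using YY[of i _ j] by (intro integral_mono intYY) (auto simp: abs_le_iff)
    then show ?thesis using True by (simp add: harris.prob_space[unfolded space_harris])
  next
    case False
    then have "nb r i \<inter> nb r j = {}" by (auto simp: nb_def mem_Times_iff)
    then have "(\<integral>h. Y i h * Y j h \<partial>?H) = 0"
      using local_integral_mult[OF _ _ intY intY locY locY] by (simp add: EY)
    then show ?thesis using False by simp
  qed
  define c where "c n = real (card (box n))" for n
  have c: "0 < c n" "c n = (2 * real n + 1) ^ 2" for n
    using card_box_pos[of n] by (simp_all add: c_def card_box del: card_box_pos)
  \<comment> \<open>Each site is correlated with at most this many sites, each covariance being at
    most 4; the count is the same for every centre.\<close>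
  define K where "K = 4 * real (card (nb (2 * r) (0, 0)))"
  define Z where "Z n h = (avg n (\<lambda>i. Y i h))\<^sup>2" for n h
  have Zm [measurable]: "Z n \<in> borel_measurable ?H" for n
    unfolding Z_def[abs_def] avg_def by measurable
  have Zsum: "Z n h = (\<Sum>i\<in>box n. \<Sum>j\<in>box n. Y i h * Y j h) / (c n)\<^sup>2" for n h
    by (simp add: Z_def avg_def power_divide c_def power2_eq_square sum_product)
  have Zint: "integrable ?H (Z n)" for n
    unfolding Zsum by (intro integrable_divide Bochner_Integration.integrable_sum intYY)
  have EZ: "(\<integral>h. Z n h \<partial>?H) \<le> K / c n" for n
  proof -
    have "(\<integral>h. Z n h \<partial>?H) = (\<Sum>i\<in>box n. \<Sum>j\<in>box n. \<integral>h. Y i h * Y j h \<partial>?H) / (c n)\<^sup>2"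
      unfolding Zsum using intYY by (simp add: Bochner_Integration.integral_sum integrable_sum)
    also have "\<dots> \<le> (\<Sum>i\<in>box n. K) / (c n)\<^sup>2"
    proof (intro divide_right_mono sum_mono)
      fix i
      have "(\<Sum>j\<in>box n. \<integral>h. Y i h * Y j h \<partial>?H) \<le> (\<Sum>j\<in>box n. if j \<in> nb (2 * r) i then 4 else 0)"
        by (intro sum_mono cov)
      also have "\<dots> = 4 * real (card (box n \<inter> nb (2 * r) i))"
        by (simp add: sum.If_cases)
      also have "\<dots> \<le> K"
      proof -
        have "card (box n \<inter> nb (2 * r) i) \<le> card (nb (2 * r) i)" by (intro card_mono) (auto simp: nb_def)
        also have "\<dots> = card (nb (2 * r) (0, 0))" by (simp only: card_nb)
        finally show ?thesis by (simp add: K_def)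
      qed
      finally show "(\<Sum>j\<in>box n. \<integral>h. Y i h * Y j h \<partial>?H) \<le> K" .
    qed simp
    also have "\<dots> = K / c n" using c(1)[of n] by (simp add: c_def power2_eq_square)
    finally show ?thesis .
  qed
  have sm: "summable (\<lambda>n. K / c n)"
  proof (rule summable_comparison_test')
    show "summable (\<lambda>n. K * inverse (real (Suc n) ^ 2))"
      using inverse_power_summable[of 2, where ?'a=real]
      by (intro summable_mult) (subst summable_Suc_iff, simp)
    fix n :: nat
    have "real (Suc n) ^ 2 \<le> c n" unfolding c(2) by (intro power_mono) auto
    then have "inverse (c n) \<le> inverse (real (Suc n) ^ 2)" by (intro le_imp_inverse_le) auto
    then have "K * inverse (c n) \<le> K * inverse (real (Suc n) ^ 2)" by (rule mult_left_mono) (simp add: K_def)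
    then show "norm (K / c n) \<le> K * inverse (real (Suc n) ^ 2)"
      using c(1)[of n] by (simp add: K_def divide_inverse abs_mult)
  qed
  have "(\<integral>\<^sup>+h. (\<Sum>n. ennreal (Z n h)) \<partial>?H) = (\<Sum>n. \<integral>\<^sup>+h. ennreal (Z n h) \<partial>?H)"
    by (rule nn_integral_suminf) measurable
  also have "\<dots> = (\<Sum>n. ennreal (\<integral>h. Z n h \<partial>?H))"
    using Zint by (subst nn_integral_eq_integral) (auto simp: Z_def)
  also have "\<dots> \<le> (\<Sum>n. ennreal (K / c n))"
    by (intro suminf_le ennreal_leI EZ) auto
  also have "\<dots> < \<infinity>"
    using sm c(1) by (subst suminf_ennreal2) (auto simp: K_def less_imp_le)
  finally have "(\<integral>\<^sup>+h. (\<Sum>n. ennreal (Z n h)) \<partial>?H) \<noteq> \<infinity>" by simp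
  then have "AE h in ?H. (\<Sum>n. ennreal (Z n h)) \<noteq> \<infinity>"
    by (intro nn_integral_PInf_AE) auto
  then show ?thesis
  proof eventually_elim
    case (elim h)
    have "summable (\<lambda>n. Z n h)"
      using elim by (intro summable_suminf_not_top) (auto simp: Z_def)
    then have "(\<lambda>n. (avg n (\<lambda>i. Y i h))\<^sup>2) \<longlonglongrightarrow> 0"
      unfolding Z_def by (rule summable_LIMSEQ_zero)
    then show ?case by (simp add: power_tendsto_0_iff Y_def)
  qed
qed

section \<open>Concentration of the block magnetization\<close>

text \<open>A stand-in for the spin at time \<open>t\<close> which reads only sites within distance
  \<open>n\<close>; it can be wrong only where \<open>rough\<close> holds.\<close>

definition approx :: "real \<Rightarrow> config \<Rightarrow> nat \<Rightarrow> real \<Rightarrow> site \<Rightarrow> harris \<Rightarrow> bool" where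
  "approx \<beta> \<xi> n t i h \<longleftrightarrow> (t < ring_time h i 0 \<and> \<xi> i) \<or> (\<exists>k. ring_upto h t i k \<and> ev_val \<beta> \<xi> h n i k)"

definition rough :: "nat \<Rightarrow> real \<Rightarrow> site \<Rightarrow> harris \<Rightarrow> bool" where
  "rough n t i h \<longleftrightarrow> (\<exists>k. ring_upto h t i k \<and> deep h n i k)"

lemma state_approx:
  assumes "good h" "\<not> rough n t i h"
  shows "state \<beta> \<xi> h t i = approx \<beta> \<xi> n t i h"
proof -
  have "resampled \<beta> \<xi> h i k = ev_val \<beta> \<xi> h n i k" if "ring_upto h t i k" for k
    using assms(2) that by (intro resampled_ev_val) (auto simp: rough_def)
  then show ?thesis unfolding state_def approx_def by blast
qed

lemma nb_self: "i \<in> nb n i"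
  by (cases i) (simp add: nb_def)

lemma nb_adjacent: "adjacent i j \<Longrightarrow> nb n j \<subseteq> nb (Suc n) i"
  by (auto simp: nb_def adjacent_def)

text \<open>One step of the recursion reaches adjacent sites only, and \<open>nb n j\<close> lies in
  \<open>nb (Suc n) i\<close> for \<open>j\<close> adjacent to \<open>i\<close>.\<close>

lemma local_ev_val:
  "(\<forall>j\<in>nb n i. \<forall>k. h (j, k) = h' (j, k)) \<Longrightarrow> ev_val \<beta> \<xi> h n i k = ev_val \<beta> \<xi> h' n i k"
proof (induction n arbitrary: i k)
  case (Suc n)
  have hi: "h (i, k) = h' (i, k)" for k using Suc.prems nb_self by blast
  have i: "ring_time h i = ring_time h' i" "ring_mark h i = ring_mark h' i"
    by (rule ring_time_cong, rule hi) (rule ring_mark_cong, rule hi)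
  have j: "ring_time h j = ring_time h' j" "ring_before h t j = ring_before h' t j"
      "ev_val \<beta> \<xi> h n j l = ev_val \<beta> \<xi> h' n j l"
    if "adjacent i j" for j t l
  proof -
    have *: "\<forall>j'\<in>nb n j. \<forall>k. h (j', k) = h' (j', k)"
      using Suc.prems nb_adjacent[OF that] by blast
    then have hj: "h (j, k) = h' (j, k)" for k using nb_self by blast
    show "ring_time h j = ring_time h' j" "ring_before h t j = ring_before h' t j"
      by (rule ring_time_cong, rule hj) (rule ring_before_cong, rule hj)
    show "ev_val \<beta> \<xi> h n j l = ev_val \<beta> \<xi> h' n j l" by (rule Suc.IH[OF *])
  qed
  show ?case
    unfolding ev_val.simps i by (subst plus_prob_cong) (auto simp: j)
qed simp

lemma local_deep:
  "(\<forall>j\<in>nb n i. \<forall>k. h (j, k) = h' (j, k)) \<Longrightarrow> deep h n i k = deep h' n i k"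
proof (induction n arbitrary: i k)
  case (Suc n)
  have hi: "h (i, k) = h' (i, k)" for k using Suc.prems nb_self by blast
  have i: "ring_time h i = ring_time h' i"
    by (rule ring_time_cong, rule hi)
  have j: "ring_before h t j = ring_before h' t j" "deep h n j l = deep h' n j l"
    if "adjacent i j" for j t l
  proof -
    have *: "\<forall>j'\<in>nb n j. \<forall>k. h (j', k) = h' (j', k)"
      using Suc.prems nb_adjacent[OF that] by blast
    then have hj: "h (j, k) = h' (j, k)" for k using nb_self by blast
    show "ring_before h t j = ring_before h' t j" by (rule ring_before_cong, rule hj)
    show "deep h n j l = deep h' n j l" by (rule Suc.IH[OF *])
  qed
  show ?case unfolding deep.simps i by (simp add: j cong: conj_cong)
qed simp

lemma local_approx: "local_at n i (approx \<beta> \<xi> n t i)"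
  unfolding local_at_def
proof (intro allI impI)
  fix h h' :: harris assume *: "\<forall>j\<in>nb n i. \<forall>k. h (j, k) = h' (j, k)"
  then have hi: "h (i, k) = h' (i, k)" for k using nb_self by blast
  have "ring_time h i = ring_time h' i" "ring_upto h t i = ring_upto h' t i"
    by (rule ring_time_cong, rule hi) (rule ring_upto_cong, rule hi)
  then show "approx \<beta> \<xi> n t i h = approx \<beta> \<xi> n t i h'"
    unfolding approx_def local_ev_val[OF *] by simp
qed

lemma local_rough: "local_at n i (rough n t i)"
  unfolding local_at_def
proof (intro allI impI)
  fix h h' :: harris assume *: "\<forall>j\<in>nb n i. \<forall>k. h (j, k) = h' (j, k)"
  then have hi: "h (i, k) = h' (i, k)" for k using nb_self by blast
  have "ring_upto h t i = ring_upto h' t i"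
    by (rule ring_upto_cong, rule hi)
  then show "rough n t i h = rough n t i h'"
    unfolding rough_def local_deep[OF *] by simp
qed

lemma local_rings_in: "local_at 0 i (\<lambda>h. rings_in h i s t)"
  unfolding local_at_def
proof (intro allI impI)
  fix h h' :: harris assume *: "\<forall>j\<in>nb 0 i. \<forall>k. h (j, k) = h' (j, k)"
  then have hi: "h (i, k) = h' (i, k)" for k using nb_self by blast
  have "ring_time h i = ring_time h' i" by (rule ring_time_cong, rule hi)
  then show "rings_in h i s t = rings_in h' i s t" by (simp add: rings_in_def)
qed

lemma measurable_approx [measurable]: "Measurable.pred harris_space (approx \<beta> \<xi> n t i)"
proof -
  have [measurable]: "Measurable.pred harris_space (\<lambda>h. ev_val \<beta> \<xi> h n i k)" for k
    by (rule pred_ev_val[where f="\<lambda>_. \<xi>" and g="\<lambda>h. h"]) auto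
  show ?thesis unfolding approx_def[abs_def] ring_upto_def by measurable
qed

lemma measurable_rough [measurable]: "Measurable.pred harris_space (rough n t i)"
proof -
  have [measurable]: "Measurable.pred harris_space (\<lambda>h. deep h n i k)" for k
    by (rule pred_deep[where g="\<lambda>h. h"]) auto
  show ?thesis unfolding rough_def[abs_def] ring_upto_def by measurable
qed

lemma deep_shift: "deep (harris_shift u h) n i k = deep h n (i - u) k"
proof (induction n arbitrary: i k)
  case (Suc n)
  have rt: "ring_time (harris_shift u h) i = ring_time h (i - u)" for i
    by (simp add: ring_time_def harris_shift_def fun_eq_iff)
  have rb: "ring_before (harris_shift u h) t j l = ring_before h t (j - u) l" for t j l
    by (simp add: ring_before_def rt)
  have adj: "adjacent i j \<longleftrightarrow> adjacent (i - u) (j - u)" for j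
    by (simp add: adjacent_def)
  show ?case
  proof
    assume "deep (harris_shift u h) (Suc n) i k"
    then show "deep h (Suc n) (i - u) k"
      unfolding deep.simps rt rb Suc adj by blast
  next
    assume "deep h (Suc n) (i - u) k"
    then obtain j l where "adjacent (i - u) j" "ring_before h (ring_time h (i - u) k) j l" "deep h n j l"
      by auto
    then have "adjacent i (j + u)" "ring_before h (ring_time h (i - u) k) (j + u - u) l" "deep h n (j + u - u) l"
      by (simp_all add: adj)
    then show "deep (harris_shift u h) (Suc n) i k"
      unfolding deep.simps rt rb Suc by blast
  qed
qed simp

lemma rough_shift: "rough n t i (harris_shift u h) = rough n t (i - u) h"
  unfolding rough_def deep_shift ring_upto_def
  by (simp add: ring_time_def harris_shift_def)

definition rough_prob :: "nat \<Rightarrow> real \<Rightarrow> real" where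
  "rough_prob n t = measure harris_space {h. rough n t (0, 0) h}"

lemma measure_rough: "measure harris_space {h. rough n t i h} = rough_prob n t"
proof -
  have "{h \<in> space harris_space. rough n t i h} \<in> sets harris_space" by measurable
  then have m: "{h. rough n t i h} \<in> sets harris_space" by simp
  have "measure harris_space {h. rough n t i h} = measure (distr harris_space harris_space (harris_shift i)) {h. rough n t i h}"
    unfolding distr_harris_shift ..
  also have "\<dots> = measure harris_space (harris_shift i -` {h. rough n t i h} \<inter> space harris_space)"
    by (rule measure_distr[OF measurable_harris_shift m])
  also have "harris_shift i -` {h. rough n t i h} \<inter> space harris_space = {h. rough n t (0, 0) h}"
    by (auto simp: rough_shift zero_prod_def[symmetric])
  finally show ?thesis by (simp add: rough_prob_def)
qed

text \<open>Continuity from above. A representation that stays rough for all \<open>n\<close> would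
  have infinite depth at the latest ring of the origin, contrary to \<open>good\<close>.\<close>

lemma rough_prob_tendsto: "(\<lambda>n. rough_prob n t) \<longlonglongrightarrow> 0"
proof -
  let ?A = "\<lambda>n. {h. rough n t (0, 0) h}"
  have "{h \<in> space harris_space. rough n t (0, 0) h} \<in> sets harris_space" for n by measurable
  then have m: "?A n \<in> sets harris_space" for n by simp
  have "decseq ?A"
  proof (rule decseq_SucI, rule subsetI)
    fix n h assume "h \<in> ?A (Suc n)"
    then obtain k where k: "ring_upto h t (0, 0) k" "deep h (Suc n) (0, 0) k"
      unfolding rough_def by blast
    show "h \<in> ?A n" using k(1) deep_antimono[OF k(2), of n] unfolding rough_def by auto
  qed
  then have "(\<lambda>n. measure harris_space (?A n)) \<longlonglongrightarrow> measure harris_space (\<Inter>n. ?A n)"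
    using m by (intro harris.finite_Lim_measure_decseq) auto
  moreover have "measure harris_space (\<Inter>n. ?A n) = 0"
  proof -
    have "AE h in harris_space. h \<notin> (\<Inter>n. ?A n)"
      using AE_good
    proof eventually_elim
      case (elim h)
      show ?case
      proof
        assume "h \<in> (\<Inter>n. ?A n)"
        then have r: "rough n t (0, 0) h" for n by blast
        from r[of 0] obtain k where k: "ring_upto h t (0, 0) k" by (auto simp: rough_def)
        obtain n where "\<not> deep h n (0, 0) k" using elim by (auto simp: good_def)
        then show False using r[of n] ring_upto_unique[OF good_regular[OF elim] k] by (auto simp: rough_def)
      qed
    qed
    moreover have "(\<Inter>n. ?A n) \<in> sets harris_space" using m by auto
    ultimately have "(\<Inter>n. ?A n) \<in> null_sets harris_space" by (simp only: AE_iff_null_sets)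
    then show ?thesis by (rule measure_eq_0_null_sets)
  qed
  ultimately show ?thesis by (simp add: rough_prob_def)
qed

lemma integral_of_bool:
  assumes [measurable]: "Measurable.pred harris_space P"
  shows "(\<integral>h. of_bool (P h) \<partial>harris_space) = measure harris_space {h. P h}"
proof -
  have "(\<lambda>h. of_bool (P h) :: real) = indicator {h. P h}" by (auto simp: fun_eq_iff)
  moreover have "{h \<in> space harris_space. P h} \<in> sets harris_space" by measurable
  ultimately show ?thesis by simp
qed

definition mean_spin :: "real \<Rightarrow> config \<Rightarrow> real \<Rightarrow> site \<Rightarrow> real" where
  "mean_spin \<beta> \<xi> t i = (\<integral>h. spin (state \<beta> \<xi> h t i) \<partial>harris_space)"

lemma abs_spin [simp]: "\<bar>spin b\<bar> = 1"
  by (simp add: spin_def)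

lemma measurable_spin [measurable (raw)]:
  assumes [measurable]: "Measurable.pred N (\<lambda>x. f x)"
  shows "(\<lambda>x. spin (f x)) \<in> borel_measurable N"
  unfolding spin_def by measurable

lemma integrable_spin:
  assumes [measurable]: "Measurable.pred harris_space f"
  shows "integrable harris_space (\<lambda>h. spin (f h))"
  by (rule harris.integrable_const_bound[where B=1]) auto

text \<open>True and truncated spins differ at rough sites only. For fixed \<open>m\<close> the law
  of large numbers controls both the truncated magnetization and the density of rough sites; after
  the limit in \<open>n\<close> the remaining error is a multiple of \<open>rough_prob m t\<close>,
  which vanishes as \<open>m\<close> grows. Countably many \<open>m\<close> share one null
  set.\<close>

lemma AE_block_mag_concentration:
  "AE h in harris_space. (\<lambda>n. block_mag n (state \<beta> \<xi> h t) - avg n (mean_spin \<beta> \<xi> t)) \<longlonglongrightarrow> 0"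
proof -
  let ?H = harris_space
  let ?X = "\<lambda>m i h. spin (approx \<beta> \<xi> m t i h)" and ?Y = "\<lambda>m i h. of_bool (rough m t i h) :: real"
  have X: "AE h in ?H. \<forall>m. (\<lambda>n. avg n (\<lambda>i. ?X m i h - (\<integral>h. ?X m i h \<partial>?H))) \<longlonglongrightarrow> 0"
    unfolding AE_all_countable
  proof
    fix m
    have "local_at m i (?X m i)" for i by (rule local_at_comp[OF local_approx])
    then show "AE h in ?H. (\<lambda>n. avg n (\<lambda>i. ?X m i h - (\<integral>h. ?X m i h \<partial>?H))) \<longlonglongrightarrow> 0"
      by (intro local_lln[where r=m]) auto
  qed
  have EY: "(\<integral>h. ?Y m i h \<partial>?H) = rough_prob m t" for m i
    by (subst integral_of_bool) (simp_all add: measure_rough)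
  have Y: "AE h in ?H. \<forall>m. (\<lambda>n. avg n (\<lambda>i. ?Y m i h - rough_prob m t)) \<longlonglongrightarrow> 0"
    unfolding AE_all_countable
  proof
    fix m
    have "local_at m i (?Y m i)" for i by (rule local_at_comp[OF local_rough])
    then have "AE h in ?H. (\<lambda>n. avg n (\<lambda>i. ?Y m i h - (\<integral>h. ?Y m i h \<partial>?H))) \<longlonglongrightarrow> 0"
      by (intro local_lln[where r=m]) auto
    then show "AE h in ?H. (\<lambda>n. avg n (\<lambda>i. ?Y m i h - rough_prob m t)) \<longlonglongrightarrow> 0"
      unfolding EY .
  qed
  have ms [measurable]: "Measurable.pred ?H (\<lambda>h. state \<beta> \<xi> h t i)" for i
    by (rule pred_state[where f="\<lambda>_. \<xi>" and g="\<lambda>h. h"]) auto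
  have diff: "\<bar>spin (state \<beta> \<xi> h t i) - ?X m i h\<bar> \<le> 2 * ?Y m i h" if "good h" for h m i
    using state_approx[OF that, of m t i \<beta> \<xi>] by (auto simp: spin_def)
  have Ediff: "\<bar>mean_spin \<beta> \<xi> t i - (\<integral>h. ?X m i h \<partial>?H)\<bar> \<le> 2 * rough_prob m t" for m i
  proof -
    have i1: "integrable ?H (\<lambda>h. spin (state \<beta> \<xi> h t i))" "integrable ?H (?X m i)"
      by (intro integrable_spin; measurable)+
    have i2: "integrable ?H (?Y m i)"
      by (rule harris.integrable_const_bound[where B=1]) auto
    have "\<bar>mean_spin \<beta> \<xi> t i - (\<integral>h. ?X m i h \<partial>?H)\<bar> = \<bar>\<integral>h. spin (state \<beta> \<xi> h t i) - ?X m i h \<partial>?H\<bar>"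
      using i1 by (simp add: mean_spin_def)
    also have "\<dots> \<le> (\<integral>h. \<bar>spin (state \<beta> \<xi> h t i) - ?X m i h\<bar> \<partial>?H)" by (rule integral_abs_bound)
    also have "\<dots> \<le> (\<integral>h. 2 * ?Y m i h \<partial>?H)"
    proof (rule integral_mono_AE)
      show "AE h in ?H. \<bar>spin (state \<beta> \<xi> h t i) - ?X m i h\<bar> \<le> 2 * ?Y m i h"
        using AE_good by eventually_elim (rule diff)
    qed (use i1 i2 in auto)
    also have "\<dots> = 2 * rough_prob m t" by (simp add: EY)
    finally show ?thesis .
  qed
  show ?thesis
    using AE_good X Y
  proof eventually_elim
    case (elim h)
    \<comment> \<open>The 4 is 2 + 2: one contribution from replacing the spins, one from replacing
      their means.\<close>
    have est: "\<bar>block_mag n (state \<beta> \<xi> h t) - avg n (mean_spin \<beta> \<xi> t)\<bar> \<le>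
        \<bar>avg n (\<lambda>i. ?X m i h - (\<integral>h. ?X m i h \<partial>?H))\<bar> + 2 * avg n (\<lambda>i. ?Y m i h - rough_prob m t) + 4 * rough_prob m t" for n m
    proof -
      let ?E = "\<lambda>i. \<integral>h. ?X m i h \<partial>?H"
      have "block_mag n (state \<beta> \<xi> h t) - avg n (mean_spin \<beta> \<xi> t) =
         avg n (\<lambda>i. spin (state \<beta> \<xi> h t i) - ?X m i h) + avg n (\<lambda>i. ?X m i h - ?E i) - avg n (\<lambda>i. mean_spin \<beta> \<xi> t i - ?E i)"
        by (simp add: block_mag_avg avg_diff)
      moreover have "\<bar>avg n (\<lambda>i. spin (state \<beta> \<xi> h t i) - ?X m i h)\<bar> \<le> 2 * avg n (\<lambda>i. ?Y m i h)"
        unfolding avg_cmult[symmetric]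
        by (rule order_trans[OF abs_avg_le avg_mono]) (rule diff[OF elim(1)])
      moreover have "\<bar>avg n (\<lambda>i. mean_spin \<beta> \<xi> t i - ?E i)\<bar> \<le> 2 * rough_prob m t"
        by (rule order_trans[OF abs_avg_le], rule order_trans[OF avg_mono[OF Ediff]]) simp
      moreover have "avg n (\<lambda>i. ?Y m i h - rough_prob m t) = avg n (\<lambda>i. ?Y m i h) - rough_prob m t"
        by (simp add: avg_diff)
      ultimately show ?thesis by linarith
    qed
    show ?case
    proof (rule LIMSEQ_I)
      fix e :: real assume e: "0 < e"
      \<comment> \<open>With \<open>e / 8\<close> in all three places the bound \<open>est\<close>
        adds up to (1 + 2 + 4) / 8 of \<open>e\<close>.\<close>
      have "\<forall>\<^sub>F m in sequentially. rough_prob m t < e / 8"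
        by (rule order_tendstoD(2)[OF rough_prob_tendsto]) (use e in simp)
      then obtain m where m: "rough_prob m t < e / 8" by (auto simp: eventually_sequentially)
      have "\<forall>\<^sub>F n in sequentially. \<bar>avg n (\<lambda>i. ?X m i h - (\<integral>h. ?X m i h \<partial>?H))\<bar> < e / 8"
        using elim(2)[rule_format, of m, THEN tendstoD, of "e / 8"] e by (simp add: dist_real_def)
      moreover have "\<forall>\<^sub>F n in sequentially. avg n (\<lambda>i. ?Y m i h - rough_prob m t) < e / 8"
        using elim(3)[rule_format, of m, THEN order_tendstoD(2), of "e / 8"] e by simp
      ultimately have "\<forall>\<^sub>F n in sequentially. norm (block_mag n (state \<beta> \<xi> h t) - avg n (mean_spin \<beta> \<xi> t) - 0) < e"
      proof eventually_elim
        case (elim n)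
        then show ?case using est[of n m] m by simp
      qed
      then show "\<exists>no. \<forall>n\<ge>no. norm (block_mag n (state \<beta> \<xi> h t) - avg n (mean_spin \<beta> \<xi> t) - 0) < e"
        unfolding eventually_sequentially .
    qed
  qed
qed

lemma AE_ring_density:
  assumes st: "0 \<le> s" "s \<le> t"
  shows "AE h in harris_space. \<forall>e>0. \<forall>\<^sub>F n in sequentially. avg n (\<lambda>i. of_bool (rings_in h i s t)) \<le> t - s + e"
proof -
  let ?H = harris_space
  let ?Y = "\<lambda>i h. of_bool (rings_in h i s t) :: real"
  have "local_at 0 i (?Y i)" for i by (rule local_at_comp[OF local_rings_in])
  then have "AE h in ?H. (\<lambda>n. avg n (\<lambda>i. ?Y i h - (\<integral>h. ?Y i h \<partial>?H))) \<longlonglongrightarrow> 0"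
    by (intro local_lln[where r=0]) auto
  then have lln: "AE h in ?H. (\<lambda>n. avg n (\<lambda>i. ?Y i h - (\<integral>h. ?Y i h \<partial>?H))) \<longlonglongrightarrow> 0" .
  have EY: "(\<integral>h. ?Y i h \<partial>?H) \<le> t - s" for i
  proof -
    have "(\<integral>h. ?Y i h \<partial>?H) = measure ?H {h. rings_in h i s t}"
      by (rule integral_of_bool) measurable
    also have "\<dots> \<le> t - s"
      using emeasure_rings_in_all[OF st, of "{i}"] st by (simp add: harris.emeasure_eq_measure)
    finally show ?thesis .
  qed
  from lln show ?thesis
  proof eventually_elim
    case (elim h)
    show ?case
    proof (intro allI impI)
      fix e :: real assume "0 < e"
      from order_tendstoD(2)[OF elim this]
      show "\<forall>\<^sub>F n in sequentially. avg n (\<lambda>i. of_bool (rings_in h i s t)) \<le> t - s + e"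
      proof eventually_elim
        case (elim n)
        have "avg n (\<lambda>i. \<integral>h. ?Y i h \<partial>?H) \<le> avg n (\<lambda>_. t - s)" by (intro avg_mono EY)
        then show ?case using elim by (simp add: avg_diff)
      qed
    qed
  qed
qed

section \<open>The law of the dynamics\<close>

lemma space_path_space [simp]: "space path_space = skorokhod"
  by (auto simp: path_space_def space_restrict_space space_PiM skorokhod_def PiE_def)

lemma measurable_path_coordinate:
  assumes "0 \<le> t"
  shows "(\<lambda>\<omega>. \<omega> t) \<in> path_space \<rightarrow>\<^sub>M borel"
  unfolding path_space_def
  by (intro measurable_restrict_space1 measurable_component_singleton) (use assms in simp)

text \<open>A version of \<open>glauber_path\<close> whose case distinction is the measurable
  predicate \<open>good\<close>; it is jointly measurable in the initial configuration and the
  representation.\<close>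

definition path :: "real \<Rightarrow> config \<Rightarrow> harris \<Rightarrow> real \<Rightarrow> config" where
  "path \<beta> \<xi> h = (if good h then flow \<beta> \<xi> h else (\<lambda>t\<in>{0..}. \<xi>))"

lemma path_skorokhod: "path \<beta> \<xi> h \<in> skorokhod"
proof -
  have "((\<lambda>t\<in>{0..}. \<xi>) \<longlongrightarrow> \<xi>) (at_right t)" if "0 \<le> t" for t :: real
    unfolding tendsto_config_iff
  proof
    fix i
    show "\<forall>\<^sub>F s in at_right t. (\<lambda>t\<in>{0..}. \<xi>) s i = \<xi> i"
      using eventually_at_right_less[of t] by eventually_elim (use that in simp)
  qed
  moreover have "((\<lambda>t\<in>{0..}. \<xi>) \<longlongrightarrow> \<xi>) (at_left t)" if "0 < t" for t :: real
    unfolding tendsto_config_iff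
  proof
    fix i
    show "\<forall>\<^sub>F s in at_left t. (\<lambda>t\<in>{0..}. \<xi>) s i = \<xi> i"
      using eventually_at_left_real[OF that] by eventually_elim simp
  qed
  ultimately have "(\<lambda>t\<in>{0..}. \<xi>) \<in> skorokhod"
    by (auto simp: skorokhod_def cadlag_def)
  then show ?thesis by (simp add: path_def flow_skorokhod)
qed

lemma path_good: "good h \<Longrightarrow> 0 \<le> t \<Longrightarrow> path \<beta> \<xi> h t = state \<beta> \<xi> h t"
  by (simp add: path_def flow_def)

lemma path_0: "path \<beta> \<xi> h 0 = \<xi>"
  using flow_driven[of h \<beta> \<xi>] by (simp add: path_def driven_by_def)

lemma measurable_path [measurable (raw)]:
  assumes f: "f \<in> N \<rightarrow>\<^sub>M borel" and g: "g \<in> N \<rightarrow>\<^sub>M harris_space"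
  shows "(\<lambda>x. path \<beta> (f x) (g x)) \<in> N \<rightarrow>\<^sub>M path_space"
  unfolding path_space_def
proof (rule measurable_restrict_space2)
  show "(\<lambda>x. path \<beta> (f x) (g x)) \<in> space N \<rightarrow> skorokhod" using path_skorokhod by blast
  show "(\<lambda>x. path \<beta> (f x) (g x)) \<in> N \<rightarrow>\<^sub>M Pi\<^sub>M {0..} (\<lambda>_. borel)"
  proof (rule measurable_PiM_single')
    fix t :: real assume t: "t \<in> {0..}"
    have [measurable]: "Measurable.pred N (\<lambda>x. good (g x))" by (rule pred_good[OF g])
    have [measurable]: "(\<lambda>x. state \<beta> (f x) (g x) t) \<in> N \<rightarrow>\<^sub>M borel" by (rule measurable_state[OF f g])
    have "(\<lambda>x. path \<beta> (f x) (g x) t) = (\<lambda>x. if good (g x) then state \<beta> (f x) (g x) t else f x)"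
      using t by (auto simp: path_def flow_def fun_eq_iff)
    also have "\<dots> \<in> N \<rightarrow>\<^sub>M borel" using f by measurable
    finally show "(\<lambda>x. path \<beta> (f x) (g x) t) \<in> N \<rightarrow>\<^sub>M borel" .
  next
    show "(\<lambda>x. path \<beta> (f x) (g x)) \<in> space N \<rightarrow> (\<Pi>\<^sub>E i\<in>{0..}. space borel)"
      using path_skorokhod by (auto simp: skorokhod_def PiE_def)
  qed
qed

lemma pred_completion_AE:
  assumes "AE x in M. P x \<longleftrightarrow> Q x" and [measurable]: "Measurable.pred M Q"
  shows "Measurable.pred (completion M) P"
proof -
  have [measurable]: "Measurable.pred (completion M) (\<lambda>x. P x \<noteq> Q x)"
    by (rule sets_completion_AE) (use assms(1) in simp)
  have [measurable]: "Measurable.pred (completion M) Q"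
    by (rule measurable_completion) measurable
  have "P = (\<lambda>x. if P x \<noteq> Q x then \<not> Q x else Q x)" by auto
  also have "Measurable.pred (completion M) \<dots>" by measurable
  finally show ?thesis .
qed

lemma emeasure_completion_AE:
  assumes ae: "AE x in M. x \<in> A \<longleftrightarrow> x \<in> B" and A: "A \<subseteq> space M" and B: "B \<in> sets M"
  shows "A \<in> sets (completion M)" "emeasure (completion M) A = emeasure M B"
proof -
  have "Measurable.pred M (\<lambda>x. x \<in> B)" using B by measurable
  with ae have "Measurable.pred (completion M) (\<lambda>x. x \<in> A)" by (rule pred_completion_AE)
  then have "{x \<in> space M. x \<in> A} \<in> sets (completion M)" by (simp add: pred_def)
  moreover have "{x \<in> space M. x \<in> A} = A" using A by auto
  ultimately show A': "A \<in> sets (completion M)" by simp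
  have "emeasure (completion M) A = emeasure (completion M) B"
    using AE_completion[OF ae] A' B by (intro emeasure_eq_AE) auto
  then show "emeasure (completion M) A = emeasure M B" using B by simp
qed

text \<open>Both paths agree off a null set, so preimages differ by subsets of null sets; the
  completion makes them measurable with equal measure.\<close>

lemma glauber_law_eq: "glauber_law \<beta> \<xi> = distr harris_space path_space (path \<beta> \<xi>)"
proof -
  have ae: "AE h in harris_space. glauber_path \<beta> \<xi> h = path \<beta> \<xi> h"
    using AE_good by eventually_elim (simp add: glauber_path_eq_flow path_def)
  have p [measurable]: "path \<beta> \<xi> \<in> harris_space \<rightarrow>\<^sub>M path_space"
    using measurable_path[of "\<lambda>_. \<xi>" harris_space "\<lambda>h. h"] by simp
  have in_sko: "glauber_path \<beta> \<xi> h \<in> skorokhod" for h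
  proof (cases "\<exists>!\<omega>. \<omega> \<in> skorokhod \<and> driven_by \<beta> \<xi> h \<omega>")
    case True
    then show ?thesis unfolding glauber_path_def using theI'[OF True] by simp
  next
    case False
    \<comment> \<open>A representation with zero waits is not regular, so \<open>path\<close> is
      constant there; \<open>path_skorokhod\<close> thus yields that the constant path is
      cadlag.\<close>
    have "\<not> good (\<lambda>_. (0, 0))" by (simp add: good_def regular_def)
    then have "(\<lambda>t\<in>{0..}. \<xi>) = path \<beta> \<xi> (\<lambda>_. (0, 0))" by (simp add: path_def)
    then show ?thesis unfolding glauber_path_def using False path_skorokhod by simp
  qed
  have vim: "{h. glauber_path \<beta> \<xi> h \<in> A} \<in> sets (completion harris_space)"
    "emeasure (completion harris_space) {h. glauber_path \<beta> \<xi> h \<in> A} = emeasure harris_space {h. path \<beta> \<xi> h \<in> A}"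
    if [measurable]: "A \<in> sets path_space" for A
  proof -
    have "{h \<in> space harris_space. path \<beta> \<xi> h \<in> A} \<in> sets harris_space" by measurable
    then have B: "{h. path \<beta> \<xi> h \<in> A} \<in> sets harris_space" by simp
    have "AE h in harris_space. h \<in> {h. glauber_path \<beta> \<xi> h \<in> A} \<longleftrightarrow> h \<in> {h. path \<beta> \<xi> h \<in> A}"
      using ae by eventually_elim simp
    from emeasure_completion_AE[OF this _ B]
    show "{h. glauber_path \<beta> \<xi> h \<in> A} \<in> sets (completion harris_space)"
      "emeasure (completion harris_space) {h. glauber_path \<beta> \<xi> h \<in> A} = emeasure harris_space {h. path \<beta> \<xi> h \<in> A}"
      by simp_all
  qed
  have m: "glauber_path \<beta> \<xi> \<in> completion harris_space \<rightarrow>\<^sub>M path_space"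
    by (rule measurableI) (auto simp: in_sko vim vimage_def)
  show ?thesis
    unfolding glauber_law_def
  proof (rule measure_eqI)
    fix A assume "A \<in> sets (distr (completion harris_space) path_space (glauber_path \<beta> \<xi>))"
    then have A: "A \<in> sets path_space" by simp
    show "emeasure (distr (completion harris_space) path_space (glauber_path \<beta> \<xi>)) A =
        emeasure (distr harris_space path_space (path \<beta> \<xi>)) A"
      by (simp add: emeasure_distr[OF m A] emeasure_distr[OF p A] vimage_def vim(2)[OF A] del: emeasure_completion)
  qed simp
qed

lemma measurable_path_harris [measurable]: "path \<beta> \<xi> \<in> harris_space \<rightarrow>\<^sub>M path_space"
  using measurable_path[of "\<lambda>_. \<xi>" harris_space "\<lambda>h. h"] by simp

lemma glauber_kernel_eq:
  assumes "0 \<le> u"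
  shows "glauber_kernel \<beta> u \<xi> = distr harris_space borel (\<lambda>h. path \<beta> \<xi> h u)"
  unfolding glauber_kernel_def glauber_law_eq
  by (subst distr_distr[OF measurable_path_coordinate[OF assms] measurable_path_harris]) (simp add: comp_def)

section \<open>Asymptotic equicontinuity of the block magnetization\<close>

text \<open>Only rational times are inspected, which keeps the event measurable in path space; right
  continuity recovers real times in \<open>changesI\<close>.\<close>

definition changes :: "(real \<Rightarrow> config) \<Rightarrow> site \<Rightarrow> rat \<Rightarrow> rat \<Rightarrow> bool" where
  "changes \<omega> i s t \<longleftrightarrow> (\<exists>q. s \<le> q \<and> q \<le> t \<and> \<omega> (of_rat q) i \<noteq> \<omega> (of_rat s) i)"

text \<open>The ring density bound expressed through the path alone, with countable quantifiers
  only, so that it defines a measurable set of full measure for every law of the dynamics.\<close>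

definition regular_paths :: "(real \<Rightarrow> config) set" where
  "regular_paths = {\<omega> \<in> skorokhod. \<forall>s t. 0 \<le> s \<longrightarrow> s \<le> t \<longrightarrow> (\<forall>j::nat. \<exists>N. \<forall>n\<ge>N.
     avg n (\<lambda>i. of_bool (changes \<omega> i s t)) \<le> of_rat (t - s) + 1 / real (Suc j))}"

lemma pred_path_coordinate:
  assumes "0 \<le> q"
  shows "Measurable.pred path_space (\<lambda>\<omega>. \<omega> (of_rat q) i)"
  by (rule pred_config_coordinate[OF measurable_path_coordinate]) (use assms in simp)

lemma pred_changes:
  assumes s: "0 \<le> s"
  shows "Measurable.pred path_space (\<lambda>\<omega>. changes \<omega> i s t)"
proof -
  have "Measurable.pred path_space (\<lambda>\<omega>. s \<le> q \<and> q \<le> t \<and> \<omega> (of_rat q) i \<noteq> \<omega> (of_rat s) i)" for q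
  proof (cases "s \<le> q")
    case True
    then have [measurable]: "Measurable.pred path_space (\<lambda>\<omega>. \<omega> (of_rat q) i)" "Measurable.pred path_space (\<lambda>\<omega>. \<omega> (of_rat s) i)"
      using s by (intro pred_path_coordinate; linarith)+
    show ?thesis by measurable
  qed simp
  then show ?thesis unfolding changes_def by measurable
qed

lemma sets_regular_paths [measurable]: "regular_paths \<in> sets path_space"
proof -
  have "Measurable.pred path_space (\<lambda>\<omega>. 0 \<le> s \<longrightarrow> s \<le> t \<longrightarrow> (\<forall>j::nat. \<exists>N. \<forall>n\<ge>N.
     avg n (\<lambda>i. of_bool (changes \<omega> i s t)) \<le> of_rat (t - s) + 1 / real (Suc j)))" for s t
  proof (cases "0 \<le> s")
    case True
    note pred_changes[OF this, measurable]
    show ?thesis unfolding avg_def by measurable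
  qed simp
  then have "{\<omega> \<in> space path_space. \<forall>s t. 0 \<le> s \<longrightarrow> s \<le> t \<longrightarrow> (\<forall>j::nat. \<exists>N. \<forall>n\<ge>N.
     avg n (\<lambda>i. of_bool (changes \<omega> i s t)) \<le> of_rat (t - s) + 1 / real (Suc j))} \<in> sets path_space"
    by measurable
  then show ?thesis unfolding regular_paths_def space_path_space .
qed

text \<open>A site that changes between \<open>s\<close> and \<open>t\<close> must have rung, so
  \<open>AE_ring_density\<close>, applied to all pairs of rational times, bounds the density of
  changes.\<close>

lemma AE_path_regular: "AE h in harris_space. path \<beta> \<xi> h \<in> regular_paths"
proof -
  have "AE h in harris_space. \<forall>s t :: rat. 0 \<le> s \<longrightarrow> s \<le> t \<longrightarrow> (\<forall>e>0. \<forall>\<^sub>F n in sequentially.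
      avg n (\<lambda>i. of_bool (rings_in h i (of_rat s) (of_rat t))) \<le> of_rat t - of_rat s + e)"
    unfolding AE_all_countable
  proof (intro allI)
    fix s t :: rat
    show "AE h in harris_space. 0 \<le> s \<longrightarrow> s \<le> t \<longrightarrow> (\<forall>e>0. \<forall>\<^sub>F n in sequentially.
      avg n (\<lambda>i. of_bool (rings_in h i (of_rat s) (of_rat t))) \<le> of_rat t - of_rat s + e)"
    proof (cases "0 \<le> s \<and> s \<le> t")
      case True
      then have "0 \<le> (of_rat s :: real)" "(of_rat s :: real) \<le> of_rat t" by (auto simp: of_rat_less_eq)
      from AE_ring_density[OF this] show ?thesis by eventually_elim simp
    qed auto
  qed
  with AE_good show ?thesis
  proof eventually_elim
    case (elim h)
    have ch: "rings_in h i (of_rat s) (of_rat t)" if s: "0 \<le> s" and c: "changes (path \<beta> \<xi> h) i s t" for i s t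
    proof (rule ccontr)
      assume no: "\<not> rings_in h i (of_rat s) (of_rat t)"
      obtain q where q: "s \<le> q" "q \<le> t" "path \<beta> \<xi> h (of_rat q) i \<noteq> path \<beta> \<xi> h (of_rat s) i"
        using c by (auto simp: changes_def)
      have le: "(of_rat s :: real) \<le> of_rat q" "(of_rat q :: real) \<le> of_rat t" "0 \<le> (of_rat s :: real)" "0 \<le> (of_rat q :: real)"
        using q s by (auto simp: of_rat_less_eq)
      have "state \<beta> \<xi> h (of_rat q) i = state \<beta> \<xi> h (of_rat s) i"
        using no le by (intro state_eqI_no_ring[OF good_regular[OF elim(1)]]) (auto simp: rings_in_def)
      then show False using q(3) path_good[OF elim(1)] le by simp
    qed
    show ?case
      unfolding regular_paths_def
    proof (intro CollectI conjI path_skorokhod allI impI)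
      fix s t :: rat and j :: nat assume st: "0 \<le> s" "s \<le> t"
      have "\<forall>\<^sub>F n in sequentially. avg n (\<lambda>i. of_bool (rings_in h i (of_rat s) (of_rat t))) \<le> of_rat t - of_rat s + 1 / real (Suc j)"
        using elim(2) st by auto
      then have "\<forall>\<^sub>F n in sequentially. avg n (\<lambda>i. of_bool (changes (path \<beta> \<xi> h) i s t)) \<le> of_rat (t - s) + 1 / real (Suc j)"
      proof eventually_elim
        case (elim n)
        have "avg n (\<lambda>i. of_bool (changes (path \<beta> \<xi> h) i s t)) \<le> avg n (\<lambda>i. of_bool (rings_in h i (of_rat s) (of_rat t)))"
          by (intro avg_mono) (use ch[OF st(1)] in auto)
        then show ?case using elim by (simp add: of_rat_diff)
      qed
      then show "\<exists>N. \<forall>n\<ge>N. avg n (\<lambda>i. of_bool (changes (path \<beta> \<xi> h) i s t)) \<le> of_rat (t - s) + 1 / real (Suc j)"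
        by (simp add: eventually_sequentially)
    qed
  qed
qed

text \<open>Right continuity carries the discrepancy at \<open>r\<close> to a slightly later
  rational time; only the right endpoint has no room to its right, and there \<open>t\<close> itself
  is rational.\<close>

lemma changesI:
  assumes \<omega>: "\<omega> \<in> skorokhod" and s: "0 \<le> s" and r: "of_rat s \<le> r" "r \<le> of_rat t" and ne: "\<omega> r i \<noteq> \<omega> (of_rat s) i"
  shows "changes \<omega> i s t"
proof (cases "r = of_rat t")
  case True
  then show ?thesis using r ne unfolding changes_def by (intro exI[of _ t]) (auto simp: of_rat_less_eq)
next
  case False
  have r0: "0 \<le> r" using s r(1) by (meson order_trans zero_le_of_rat_iff)
  obtain b where b: "r < b" "\<And>y. r < y \<Longrightarrow> y < b \<Longrightarrow> \<omega> y i = \<omega> r i"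
    using skorokhod_right[OF \<omega> r0, of i] unfolding eventually_at_right_field by blast
  have "r < min b (of_rat t)" using b(1) r(2) False by simp
  then obtain q where q: "r < of_rat q" "of_rat q < min b (of_rat t)" using of_rat_dense by blast
  then have "\<omega> (of_rat q) i \<noteq> \<omega> (of_rat s) i" using b(2)[of "of_rat q"] ne by simp
  moreover have "s \<le> q" "q \<le> t"
    using q r(1) by (auto simp: of_rat_less_eq[symmetric, where ?'a=real] simp del: of_rat_less_eq)
  ultimately show ?thesis unfolding changes_def by blast
qed

text \<open>Enclose \<open>s\<close> and \<open>t\<close> between rational times and compare both
  spins with the one at the earlier of these. Only changing sites contribute, each at most
  2.\<close>

lemma block_mag_equicontinuous:
  assumes \<omega>: "\<omega> \<in> regular_paths" and st: "0 \<le> s" "s \<le> t" and e: "0 < e"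
  shows "\<forall>\<^sub>F n in sequentially. \<bar>block_mag n (\<omega> t) - block_mag n (\<omega> s)\<bar> \<le> 2 * (t - s) + e"
proof -
  have sko: "\<omega> \<in> skorokhod" using \<omega> by (simp add: regular_paths_def)
  obtain a where a: "0 \<le> a" "of_rat a \<le> s" "s - e / 8 < of_rat a"
  \<comment> \<open>A rational time slightly below \<open>s\<close> must remain nonnegative, so 0
    itself serves when \<open>s = 0\<close>.\<close>
  proof (cases "s = 0")
    case True
    then show ?thesis using e by (intro that[of 0]) auto
  next
    case False
    then obtain a where a: "max 0 (s - e / 8) < of_rat a" "of_rat a < s"
      using of_rat_dense[of "max 0 (s - e / 8)" s] st(1) e by auto
    then have "0 \<le> a" by (metis less_imp_le max_less_iff_conj zero_less_of_rat_iff)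
    then show ?thesis using a by (intro that[of a]) auto
  qed
  obtain b where b: "t < of_rat b" "of_rat b < t + e / 8" using of_rat_dense[of t "t + e / 8"] e by auto
  have ab: "a \<le> b" using a(2) st b(1) by (metis le_less_trans less_imp_le of_rat_less_eq order_trans)
  obtain j :: nat where j: "1 / real (Suc j) < e / 8" using e nat_approx_posE[of "e / 8"] by auto
  have "\<forall>\<^sub>F n in sequentially. avg n (\<lambda>i. of_bool (changes \<omega> i a b)) \<le> of_rat (b - a) + 1 / real (Suc j)"
    using \<omega> a(1) ab unfolding regular_paths_def eventually_sequentially by blast
  then show ?thesis
  proof eventually_elim
    case (elim n)
    have le: "\<bar>spin (\<omega> t i) - spin (\<omega> s i)\<bar> \<le> 2 * of_bool (changes \<omega> i a b)" for i
    proof (cases "changes \<omega> i a b")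
      case True
      then show ?thesis by (simp add: spin_def)
    next
      case False
      then have "\<omega> r i = \<omega> (of_rat a) i" if "of_rat a \<le> r" "r \<le> of_rat b" for r
        using changesI[OF sko a(1) that] by blast
      then have "\<omega> t i = \<omega> s i" using a(2) st b(1) by (smt (verit))
      then show ?thesis using False by simp
    qed
    have "\<bar>block_mag n (\<omega> t) - block_mag n (\<omega> s)\<bar> = \<bar>avg n (\<lambda>i. spin (\<omega> t i) - spin (\<omega> s i))\<bar>"
      by (simp add: block_mag_avg avg_diff)
    also have "\<dots> \<le> 2 * avg n (\<lambda>i. of_bool (changes \<omega> i a b))"
      unfolding avg_cmult[symmetric] by (rule order_trans[OF abs_avg_le avg_mono]) (rule le)
    finally show ?case
    proof -
      assume *: "\<bar>block_mag n (\<omega> t) - block_mag n (\<omega> s)\<bar> \<le> 2 * avg n (\<lambda>i. of_bool (changes \<omega> i a b))"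
      have "A \<le> (t - s) + e / 2"
        if "A \<le> b' - a' + d" "s - e / 8 < a'" "b' < t + e / 8" "d < e / 8" for A a' b' d :: real
        using that e by linarith
      from this[OF elim[unfolded of_rat_diff] a(3) b(2) j] * show ?thesis by argo
    qed
  qed
qed

lemma block_mag_close:
  assumes \<omega>: "\<omega> \<in> regular_paths" and st: "0 \<le> s" "0 \<le> t" and d: "\<bar>t - s\<bar> < d"
  shows "\<forall>\<^sub>F n in sequentially. \<bar>block_mag n (\<omega> t) - block_mag n (\<omega> s)\<bar> \<le> 2 * d"
proof -
  \<comment> \<open>Chosen so that 2 |t - s| plus this slack is exactly
    \<open>2 * d\<close>.\<close>
  have e: "0 < 2 * (d - \<bar>t - s\<bar>)" using d by simp
  show ?thesis
  proof (cases "s \<le> t")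
    case True
    from block_mag_equicontinuous[OF \<omega> st(1) True e] show ?thesis
      by eventually_elim (use True in auto)
  next
    case False
    then have "t \<le> s" by simp
    from block_mag_equicontinuous[OF \<omega> st(2) this e] show ?thesis
      by eventually_elim (use False in \<open>auto simp: abs_minus_commute\<close>)
  qed
qed

text \<open>Convergence written with countable quantifiers and closed inequalities, ready for the
  measurability prover.\<close>

lemma tendsto_iff_Suc:
  fixes X :: "nat \<Rightarrow> real"
  shows "X \<longlonglongrightarrow> c \<longleftrightarrow> (\<forall>j::nat. \<exists>N. \<forall>n\<ge>N. \<bar>X n - c\<bar> \<le> 1 / real (Suc j))"
proof
  assume X: "X \<longlonglongrightarrow> c"
  show "\<forall>j::nat. \<exists>N. \<forall>n\<ge>N. \<bar>X n - c\<bar> \<le> 1 / real (Suc j)"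
  proof
    fix j :: nat
    have "\<forall>\<^sub>F n in sequentially. dist (X n) c < 1 / real (Suc j)" using X by (rule tendstoD) simp
    then show "\<exists>N. \<forall>n\<ge>N. \<bar>X n - c\<bar> \<le> 1 / real (Suc j)"
      unfolding eventually_sequentially dist_real_def by (meson less_imp_le)
  qed
next
  assume *: "\<forall>j::nat. \<exists>N. \<forall>n\<ge>N. \<bar>X n - c\<bar> \<le> 1 / real (Suc j)"
  show "X \<longlonglongrightarrow> c"
  proof (rule LIMSEQ_I)
    fix e :: real assume "0 < e"
    then obtain j :: nat where "1 / real (Suc j) < e" using nat_approx_posE by blast
    then show "\<exists>N. \<forall>n\<ge>N. norm (X n - c) < e"
      using *[rule_format, of j] by (metis le_less_trans real_norm_def)
  qed
qed

definition hits :: "real \<Rightarrow> (real \<Rightarrow> config) \<Rightarrow> bool" where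
  "hits c \<omega> \<longleftrightarrow> (\<exists>t\<ge>0. (\<lambda>n. block_mag n (\<omega> t)) \<longlonglongrightarrow> c)"

text \<open>
  Hitting a prescribed value is an uncountable union over times; asymptotic equicontinuity and
  compactness of time intervals reduce it to rational times.
\<close>

lemma hits_iff_rational:
  assumes \<omega>: "\<omega> \<in> regular_paths"
  shows "hits c \<omega> \<longleftrightarrow> (\<exists>K::nat. \<forall>j::nat. \<exists>q::rat. 0 \<le> q \<and> of_rat q \<le> real K \<and>
    (\<exists>N. \<forall>n\<ge>N. \<bar>block_mag n (\<omega> (of_rat q)) - c\<bar> \<le> 1 / real (Suc j)))"
proof
  assume "hits c \<omega>"
  then obtain t where t: "0 \<le> t" "(\<lambda>n. block_mag n (\<omega> t)) \<longlonglongrightarrow> c" by (auto simp: hits_def)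
  \<comment> \<open>The extra 1 leaves room for rational times just after \<open>t\<close>, which
    lie within \<open>d \<le> 1\<close> of it.\<close>
  obtain K :: nat where K: "t + 1 < real K" using reals_Archimedean2 by blast
  show "\<exists>K::nat. \<forall>j::nat. \<exists>q::rat. 0 \<le> q \<and> of_rat q \<le> real K \<and>
    (\<exists>N. \<forall>n\<ge>N. \<bar>block_mag n (\<omega> (of_rat q)) - c\<bar> \<le> 1 / real (Suc j))"
  proof (intro exI[of _ K] allI)
    fix j :: nat
    \<comment> \<open>A budget of \<open>4 * d\<close>: the drift from \<open>t\<close> to
      \<open>q\<close> costs \<open>2 * d\<close> and the convergence at \<open>t\<close> another
      \<open>d\<close>.\<close>
    define d where "d = 1 / (4 * real (Suc j))"
    have d: "0 < d" "d \<le> 1" "4 * d = 1 / real (Suc j)" by (auto simp: d_def field_simps)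
    obtain q where q: "t < of_rat q" "of_rat q < t + d" using of_rat_dense[of t "t + d"] d by auto
    have q0: "0 \<le> (of_rat q :: real)" using q t(1) by linarith
    have "\<forall>\<^sub>F n in sequentially. \<bar>block_mag n (\<omega> (of_rat q)) - block_mag n (\<omega> t)\<bar> \<le> 2 * d"
      using q by (intro block_mag_close[OF \<omega> t(1) q0]) auto
    moreover have "\<forall>\<^sub>F n in sequentially. dist (block_mag n (\<omega> t)) c < d" using t(2) d(1) by (rule tendstoD)
    ultimately have "\<forall>\<^sub>F n in sequentially. \<bar>block_mag n (\<omega> (of_rat q)) - c\<bar> \<le> 1 / real (Suc j)"
      by eventually_elim (use d in \<open>auto simp: dist_real_def\<close>)
    then show "\<exists>q::rat. 0 \<le> q \<and> of_rat q \<le> real K \<and>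
      (\<exists>N. \<forall>n\<ge>N. \<bar>block_mag n (\<omega> (of_rat q)) - c\<bar> \<le> 1 / real (Suc j))"
      using q q0 K d(2) unfolding eventually_sequentially by (intro exI[of _ q]) auto
  qed
next
  assume "\<exists>K::nat. \<forall>j::nat. \<exists>q::rat. 0 \<le> q \<and> of_rat q \<le> real K \<and>
    (\<exists>N. \<forall>n\<ge>N. \<bar>block_mag n (\<omega> (of_rat q)) - c\<bar> \<le> 1 / real (Suc j))"
  then obtain K :: nat and q :: "nat \<Rightarrow> rat" where q: "\<And>j. 0 \<le> q j" "\<And>j. of_rat (q j) \<le> real K"
    "\<And>j. \<exists>N. \<forall>n\<ge>N. \<bar>block_mag n (\<omega> (of_rat (q j))) - c\<bar> \<le> 1 / real (Suc j)"
    by metis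
  \<comment> \<open>The common bound \<open>K\<close> confines the approximate hitting times to a
    compact interval; an accumulation point of them is a genuine hitting time.\<close>
  have "seq_compact {0..real K}" by (intro compact_imp_seq_compact) simp
  moreover have "\<forall>j. of_rat (q j) \<in> {0..real K}" using q by simp
  ultimately obtain t r where t: "t \<in> {0..real K}" "strict_mono (r :: nat \<Rightarrow> nat)" "((\<lambda>j. of_rat (q j)) \<circ> r) \<longlonglongrightarrow> t"
    by (rule seq_compactE)
  have "(\<lambda>n. block_mag n (\<omega> t)) \<longlonglongrightarrow> c"
  proof (rule LIMSEQ_I)
    fix e :: real assume e: "0 < e"
    obtain j0 :: nat where j0: "1 / real (Suc j0) < e / 4" using e nat_approx_posE[of "e / 4"] by auto
    have "\<forall>\<^sub>F j in sequentially. dist (((\<lambda>j. of_rat (q j)) \<circ> r) j) t < e / 4"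
      by (rule tendstoD[OF t(3)]) (use e in simp)
    then obtain j where j: "j0 \<le> j" "\<bar>t - of_rat (q (r j))\<bar> < e / 4"
      by (auto simp: eventually_sequentially dist_real_def abs_minus_commute) (meson le_cases)
    have "j0 \<le> r j" using j(1) seq_suble[OF t(2), of j] by simp
    then have "1 / real (Suc (r j)) \<le> 1 / real (Suc j0)" by (intro divide_left_mono) auto
    then have s: "1 / real (Suc (r j)) < e / 4" using j0 by linarith
    have "\<forall>\<^sub>F n in sequentially. \<bar>block_mag n (\<omega> t) - block_mag n (\<omega> (of_rat (q (r j))))\<bar> \<le> 2 * (e / 4)"
      using t(1) q(1)[of "r j"] by (intro block_mag_close[OF \<omega> _ _ j(2)]) auto
    moreover have "\<forall>\<^sub>F n in sequentially. \<bar>block_mag n (\<omega> (of_rat (q (r j)))) - c\<bar> \<le> 1 / real (Suc (r j))"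
      using q(3)[of "r j"] unfolding eventually_sequentially .
    ultimately have "\<forall>\<^sub>F n in sequentially. norm (block_mag n (\<omega> t) - c) < e"
    proof eventually_elim
      case (elim n)
      have "\<bar>x - c\<bar> < e" if "\<bar>x - y\<bar> \<le> 2 * (e / 4)" "\<bar>y - c\<bar> \<le> d" "d < e / 4" for x y d :: real
        using that e by argo
      from this[OF elim s] show ?case unfolding real_norm_def .
    qed
    then show "\<exists>N. \<forall>n\<ge>N. norm (block_mag n (\<omega> t) - c) < e" unfolding eventually_sequentially .
  qed
  then show "hits c \<omega>" using t(1) unfolding hits_def by auto
qed

text \<open>Unlike hitting, staying needs no compactness: a slightly later rational time controls
  each real time.\<close>

lemma limit_iff_rational:
  assumes \<omega>: "\<omega> \<in> regular_paths"
  shows "(\<forall>t\<ge>0. (\<lambda>n. block_mag n (\<omega> t)) \<longlonglongrightarrow> c) \<longleftrightarrow>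
    (\<forall>q::rat. 0 \<le> q \<longrightarrow> (\<lambda>n. block_mag n (\<omega> (of_rat q))) \<longlonglongrightarrow> c)"
proof (intro iffI allI impI)
  fix t :: real assume *: "\<forall>q::rat. 0 \<le> q \<longrightarrow> (\<lambda>n. block_mag n (\<omega> (of_rat q))) \<longlonglongrightarrow> c" and t: "0 \<le> t"
  show "(\<lambda>n. block_mag n (\<omega> t)) \<longlonglongrightarrow> c"
  proof (rule LIMSEQ_I)
    fix e :: real assume e: "0 < e"
    obtain q where q: "t < of_rat q" "of_rat q < t + e / 4" using of_rat_dense[of t "t + e / 4"] e by auto
    have q0: "0 \<le> (of_rat q :: real)" using q t by linarith
    have "\<forall>\<^sub>F n in sequentially. \<bar>block_mag n (\<omega> t) - block_mag n (\<omega> (of_rat q))\<bar> \<le> 2 * (e / 4)"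
      using q by (intro block_mag_close[OF \<omega> q0 t]) auto
    moreover have "\<forall>\<^sub>F n in sequentially. dist (block_mag n (\<omega> (of_rat q))) c < e / 4"
      by (rule tendstoD) (use * q0 e in auto)
    ultimately have "\<forall>\<^sub>F n in sequentially. norm (block_mag n (\<omega> t) - c) < e"
    proof eventually_elim
      case (elim n)
      have "\<bar>x - c\<bar> < e" if "\<bar>x - y\<bar> \<le> 2 * (e / 4)" "\<bar>y - c\<bar> < e / 4" for x y :: real
        using that e by argo
      from this[OF elim[unfolded dist_real_def]] show ?case unfolding real_norm_def .
    qed
    then show "\<exists>N. \<forall>n\<ge>N. norm (block_mag n (\<omega> t) - c) < e" unfolding eventually_sequentially .
  qed
qed simp

section \<open>Survival sets\<close>

text \<open>
  \<open>staying_paths C\<close> itself need not be measurable; intersecting with \<open>regular_paths\<close>, which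
  carries all the laws of the dynamics, does not change its completed measure.
\<close>

definition tame :: "config set \<Rightarrow> bool" where
  "tame C \<longleftrightarrow> C \<in> sets borel \<and> staying_paths C \<inter> regular_paths \<in> sets path_space"

lemma measurable_block_mag [measurable (raw)]:
  fixes f :: "'a \<Rightarrow> config"
  assumes [measurable]: "f \<in> N \<rightarrow>\<^sub>M borel"
  shows "(\<lambda>x. block_mag n (f x)) \<in> borel_measurable N"
  unfolding block_mag_def by measurable

lemma sets_block_mag_limit: "{\<sigma>. (\<lambda>n. block_mag n \<sigma>) \<longlonglongrightarrow> c} \<in> sets borel"
proof -
  have "{\<sigma> \<in> space borel. \<forall>j::nat. \<exists>N. \<forall>n\<ge>N. \<bar>block_mag n \<sigma> - c\<bar> \<le> 1 / real (Suc j)} \<in> sets borel" by measurable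
  then show ?thesis by (simp add: tendsto_iff_Suc)
qed

lemma measurable_path_rational:
  "0 \<le> q \<Longrightarrow> (\<lambda>\<omega>. \<omega> (of_rat q)) \<in> path_space \<rightarrow>\<^sub>M borel"
  by (rule measurable_path_coordinate) simp

lemma tame_zero: "tame zero_sector"
proof -
  have "Measurable.pred path_space (\<lambda>\<omega>. \<forall>q::rat. 0 \<le> q \<longrightarrow> (\<lambda>n. block_mag n (\<omega> (of_rat q))) \<longlonglongrightarrow> 0)"
  proof (rule pred_intros_countable)
    fix q :: rat
    show "Measurable.pred path_space (\<lambda>\<omega>. 0 \<le> q \<longrightarrow> (\<lambda>n. block_mag n (\<omega> (of_rat q))) \<longlonglongrightarrow> 0)"
    proof (cases "0 \<le> q")
      case True
      note measurable_path_rational[OF this, measurable]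
      show ?thesis unfolding tendsto_iff_Suc by measurable
    qed simp
  qed
  then have "{\<omega> \<in> space path_space. \<omega> \<in> regular_paths \<and> (\<forall>q::rat. 0 \<le> q \<longrightarrow> (\<lambda>n. block_mag n (\<omega> (of_rat q))) \<longlonglongrightarrow> 0)} \<in> sets path_space"
    by measurable
  moreover have "{\<omega> \<in> space path_space. \<omega> \<in> regular_paths \<and> (\<forall>q::rat. 0 \<le> q \<longrightarrow> (\<lambda>n. block_mag n (\<omega> (of_rat q))) \<longlonglongrightarrow> 0)}
      = staying_paths zero_sector \<inter> regular_paths"
    using limit_iff_rational[of _ 0] by (auto simp: staying_paths_def zero_sector_def)
  ultimately show ?thesis
    unfolding tame_def using sets_block_mag_limit[of 0] by (simp add: zero_sector_def)
qed

lemma pred_hits: "{\<omega> \<in> regular_paths. hits c \<omega>} \<in> sets path_space"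
proof -
  have "Measurable.pred path_space (\<lambda>\<omega>. 0 \<le> q \<and> of_rat q \<le> real K \<and>
    (\<exists>N. \<forall>n\<ge>N. \<bar>block_mag n (\<omega> (of_rat q)) - c\<bar> \<le> 1 / real (Suc j)))" for K j :: nat and q :: rat
  proof (cases "0 \<le> q")
    case True
    note measurable_path_rational[OF this, measurable]
    show ?thesis by measurable
  qed simp
  then have "{\<omega> \<in> space path_space. \<omega> \<in> regular_paths \<and> (\<exists>K::nat. \<forall>j::nat. \<exists>q::rat. 0 \<le> q \<and> of_rat q \<le> real K \<and>
    (\<exists>N. \<forall>n\<ge>N. \<bar>block_mag n (\<omega> (of_rat q)) - c\<bar> \<le> 1 / real (Suc j)))} \<in> sets path_space"
    by measurable
  moreover have "{\<omega> \<in> space path_space. \<omega> \<in> regular_paths \<and> (\<exists>K::nat. \<forall>j::nat. \<exists>q::rat. 0 \<le> q \<and> of_rat q \<le> real K \<and>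
    (\<exists>N. \<forall>n\<ge>N. \<bar>block_mag n (\<omega> (of_rat q)) - c\<bar> \<le> 1 / real (Suc j)))} = {\<omega> \<in> regular_paths. hits c \<omega>}"
    using hits_iff_rational by (auto simp: regular_paths_def)
  ultimately show ?thesis by (simp only:)
qed

text \<open>Leaving the sector means having block magnetization plus or minus
  \<open>spont_mag \<beta>\<close> at some time, so among regular paths the stayers are the
  complement of two hitting events.\<close>

lemma tame_rest: "tame (rest_sector \<beta>)"
proof -
  let ?m = "spont_mag \<beta>"
  have "staying_paths (rest_sector \<beta>) \<inter> regular_paths =
      regular_paths - ({\<omega> \<in> regular_paths. hits ?m \<omega>} \<union> {\<omega> \<in> regular_paths. hits (- ?m) \<omega>})"
    by (auto simp: staying_paths_def rest_sector_def plus_sector_def minus_sector_def hits_def regular_paths_def)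
  moreover have "\<dots> \<in> sets path_space" using pred_hits by auto
  moreover have "rest_sector \<beta> \<in> sets borel"
    using sets_block_mag_limit unfolding rest_sector_def plus_sector_def minus_sector_def by auto
  ultimately show ?thesis unfolding tame_def by simp
qed

lemma staying_paths_subset: "staying_paths C \<subseteq> skorokhod"
  by (auto simp: staying_paths_def)

lemma
  assumes C: "tame C"
  shows emeasure_staying: "emeasure (completion (glauber_law \<beta> \<xi>)) (staying_paths C) =
      emeasure harris_space {h. path \<beta> \<xi> h \<in> staying_paths C \<inter> regular_paths}"
    and survival_set_iff: "\<xi> \<in> survival_set \<beta> C \<longleftrightarrow> \<xi> \<in> C \<and> (AE h in harris_space. path \<beta> \<xi> h \<in> staying_paths C)"
proof -
  let ?Q = "staying_paths C \<inter> regular_paths"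
  have Q [measurable]: "?Q \<in> sets path_space" using C by (simp add: tame_def)
  have R: "{\<omega> \<in> space path_space. \<omega> \<in> regular_paths} \<in> sets path_space" by measurable
  have "AE \<omega> in glauber_law \<beta> \<xi>. \<omega> \<in> regular_paths"
    unfolding glauber_law_eq AE_distr_iff[OF measurable_path_harris R] by (rule AE_path_regular)
  then have ae: "AE \<omega> in glauber_law \<beta> \<xi>. \<omega> \<in> staying_paths C \<longleftrightarrow> \<omega> \<in> ?Q" by eventually_elim simp
  have "emeasure (completion (glauber_law \<beta> \<xi>)) (staying_paths C) = emeasure (glauber_law \<beta> \<xi>) ?Q"
    using staying_paths_subset Q by (intro emeasure_completion_AE(2)[OF ae]) (simp_all add: glauber_law_eq)
  also have "\<dots> = emeasure harris_space {h. path \<beta> \<xi> h \<in> ?Q}"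
    unfolding glauber_law_eq by (subst emeasure_distr) (auto simp: vimage_def)
  finally show 1: "emeasure (completion (glauber_law \<beta> \<xi>)) (staying_paths C) =
      emeasure harris_space {h. path \<beta> \<xi> h \<in> ?Q}" .
  have "{h \<in> space harris_space. path \<beta> \<xi> h \<in> ?Q} \<in> sets harris_space" by measurable
  then have "emeasure harris_space {h. path \<beta> \<xi> h \<in> ?Q} = 1 \<longleftrightarrow> (AE h in harris_space. path \<beta> \<xi> h \<in> ?Q)"
    using harris.AE_in_set_eq_1[of "{h. path \<beta> \<xi> h \<in> ?Q}"] by (simp add: harris.emeasure_eq_measure)
  also have "\<dots> \<longleftrightarrow> (AE h in harris_space. path \<beta> \<xi> h \<in> staying_paths C)"
    using AE_path_regular[of \<beta> \<xi>] by (auto elim: AE_mp)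
  finally show "\<xi> \<in> survival_set \<beta> C \<longleftrightarrow> \<xi> \<in> C \<and> (AE h in harris_space. path \<beta> \<xi> h \<in> staying_paths C)"
    by (simp add: survival_set_def 1 del: emeasure_completion)
qed

text \<open>The path is jointly measurable in the initial configuration and the representation, so
  the probability of staying, as the measure of a section, is a Borel function of the initial
  configuration.\<close>

lemma sets_survival_set:
  assumes C: "tame C"
  shows "survival_set \<beta> C \<in> sets borel"
proof -
  let ?Q = "staying_paths C \<inter> regular_paths"
  have Q [measurable]: "?Q \<in> sets path_space" and [measurable]: "C \<in> sets borel" using C by (simp_all add: tame_def)
  have "{x \<in> space (borel \<Otimes>\<^sub>M harris_space). path \<beta> (fst x) (snd x) \<in> ?Q} \<in> sets (borel \<Otimes>\<^sub>M harris_space)"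
    by measurable
  from harris.measurable_emeasure_Pair[OF this]
  have [measurable]: "(\<lambda>\<xi>. emeasure harris_space {h. path \<beta> \<xi> h \<in> ?Q}) \<in> borel_measurable borel"
    by (simp add: vimage_def space_pair_measure)
  have "survival_set \<beta> C = {\<xi> \<in> space borel. \<xi> \<in> C \<and> emeasure harris_space {h. path \<beta> \<xi> h \<in> ?Q} = 1}"
    unfolding survival_set_def emeasure_staying[OF C] by auto
  also have "\<dots> \<in> sets borel" by measurable
  finally show ?thesis .
qed

section \<open>The Markov property\<close>

lemma at_right_shift:
  fixes t u :: real
  assumes "\<forall>\<^sub>F s in at_right (t - u). P s"
  shows "\<forall>\<^sub>F s in at_right t. P (s - u)"
  using assms unfolding eventually_at_right_field
proof safe
  fix b assume b: "t - u < b" "\<forall>y>t - u. y < b \<longrightarrow> P y"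
  then show "\<exists>b>t. \<forall>y>t. y < b \<longrightarrow> P (y - u)"
    by (intro exI[of _ "b + u"]) auto
qed

lemma at_left_shift:
  fixes t u :: real
  assumes "\<forall>\<^sub>F s in at_left (t - u). P s"
  shows "\<forall>\<^sub>F s in at_left t. P (s - u)"
  using assms unfolding eventually_at_left_field
proof safe
  fix b assume b: "b < t - u" "\<forall>y>b. y < t - u \<longrightarrow> P y"
  then show "\<exists>b<t. \<forall>y>b. y < t \<longrightarrow> P (y - u)"
    by (intro exI[of _ "b + u"]) auto
qed

text \<open>The path that follows \<open>h\<close> until \<open>u\<close> and then restarts under
  \<open>h'\<close> obeys the rule for the spliced rings; uniqueness identifies it with the
  flow.\<close>

lemma flow_splice:
  assumes h: "good h" and h': "good h'" and g: "good (splice u h h')" and u: "0 \<le> u" and t: "0 \<le> t"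
  shows "flow \<beta> \<xi> (splice u h h') (u + t) = flow \<beta> (flow \<beta> \<xi> h u) h' t"
proof -
  define \<zeta> where "\<zeta> = flow \<beta> \<xi> h u"
  define \<omega> where "\<omega> = (\<lambda>t\<in>{0..}. if t < u then flow \<beta> \<xi> h t else flow \<beta> \<zeta> h' (t - u))"
  note rh = good_regular[OF h] and rh' = good_regular[OF h']
  \<comment> \<open>At \<open>s = u\<close> the second branch of \<open>\<omega>\<close> applies; it
    agrees because the restarted flow begins at \<open>\<zeta>\<close>.\<close>
  have before: "\<omega> s = flow \<beta> \<xi> h s" if "0 \<le> s" "s \<le> u" for s
    using that flow_driven[OF h', of \<beta> \<zeta>] by (auto simp: \<omega>_def driven_by_def \<zeta>_def)
  have after: "\<omega> s = flow \<beta> \<zeta> h' (s - u)" if "u \<le> s" for s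
    using that u by (simp add: \<omega>_def)
  have left_before: "(\<omega> \<longlongrightarrow> left_state \<beta> \<xi> h s) (at_left s)" if "0 < s" "s \<le> u" for s
    unfolding tendsto_config_iff
  proof
    fix i
    from flow_left[OF h that(1), of \<beta> \<xi>] have "\<forall>\<^sub>F r in at_left s. flow \<beta> \<xi> h r i = left_state \<beta> \<xi> h s i"
      by (simp add: tendsto_config_iff)
    with eventually_at_left_real[OF that(1)] show "\<forall>\<^sub>F r in at_left s. \<omega> r i = left_state \<beta> \<xi> h s i"
      by eventually_elim (use that before in auto)
  qed
  have left_after: "(\<omega> \<longlongrightarrow> left_state \<beta> \<zeta> h' (s - u)) (at_left s)" if "u < s" for s
    unfolding tendsto_config_iff
  proof
    fix i
    have "0 < s - u" using that by simp
    from flow_left[OF h' this, of \<beta> \<zeta>] have "\<forall>\<^sub>F r in at_left (s - u). flow \<beta> \<zeta> h' r i = left_state \<beta> \<zeta> h' (s - u) i"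
      by (simp add: tendsto_config_iff)
    from at_left_shift[OF this] eventually_at_left_real[OF that]
    show "\<forall>\<^sub>F r in at_left s. \<omega> r i = left_state \<beta> \<zeta> h' (s - u) i"
      by eventually_elim (use after in auto)
  qed
  have sko: "\<omega> \<in> skorokhod"
  proof -
    have "(\<omega> \<longlongrightarrow> \<omega> s) (at_right s)" if s: "0 \<le> s" for s
      unfolding tendsto_config_iff
    proof
      fix i
      show "\<forall>\<^sub>F r in at_right s. \<omega> r i = \<omega> s i"
      proof (cases "s < u")
        case True
        from skorokhod_right[OF flow_skorokhod[OF h] s, of \<beta> \<xi> i] eventually_at_right_real[OF True]
        show ?thesis by eventually_elim (use True s before in auto)
      next
        case False
        then have "0 \<le> s - u" by simp
        from at_right_shift[OF skorokhod_right[OF flow_skorokhod[OF h'] this, of \<beta> \<zeta> i]] eventually_at_right_less[of s]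
        show ?thesis by eventually_elim (use False after in auto)
      qed
    qed
    moreover have "\<exists>l. (\<omega> \<longlongrightarrow> l) (at_left s)" if "0 < s" for s
      using left_before[OF that] left_after[of s] by (meson not_le)
    ultimately show ?thesis unfolding skorokhod_def cadlag_def by (auto simp: \<omega>_def)
  qed
  have "driven_by \<beta> \<xi> (splice u h h') \<omega>"
    unfolding driven_by_def
  proof (intro conjI allI impI)
    show "\<omega> 0 = \<xi>" using before[of 0] u flow_driven[OF h, of \<beta> \<xi>] by (simp add: driven_by_def)
  next
    fix s :: real and l :: config and i k
    assume s: "0 < s" and l: "(\<omega> \<longlongrightarrow> l) (at_left s)" and k: "ring_time (splice u h h') i k = s"
    show "\<omega> s i = (ring_mark (splice u h h') i k \<le> plus_prob \<beta> l i)"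
    proof (cases "s \<le> u")
      case True
      have "l = left_state \<beta> \<xi> h s"
        using tendsto_config_unique[OF _ l left_before[OF s True]] by simp
      then have l': "(flow \<beta> \<xi> h \<longlongrightarrow> l) (at_left s)" using flow_left[OF h s] by simp
      have k': "ring_time h i k = s" using splice_ring_before(1)[OF rh rh' u True] k by blast
      show ?thesis
        using flow_driven[OF h, of \<beta> \<xi>] s l' k' before[of s] True splice_ring_before(2)[OF rh rh' u True k']
        unfolding driven_by_def by auto
    next
      case False
      then have su: "u < s" "0 < s - u" by auto
      have "l = left_state \<beta> \<zeta> h' (s - u)"
        using tendsto_config_unique[OF _ l left_after[OF su(1)]] by simp
      then have l': "(flow \<beta> \<zeta> h' \<longlongrightarrow> l) (at_left (s - u))" using flow_left[OF h' su(2)] by simp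
      obtain m where "ring_time h' i m = s - u" "ring_mark (splice u h h') i k = ring_mark h' i m"
        using splice_ring_after(2)[OF rh rh' u su(1) k] by blast
      then show ?thesis
        using flow_driven[OF h', of \<beta> \<zeta>] su l' after[of s] unfolding driven_by_def by auto
    qed
  next
    fix s :: real and l :: config and i
    assume s: "0 < s" and l: "(\<omega> \<longlongrightarrow> l) (at_left s)" and k: "\<forall>k. ring_time (splice u h h') i k \<noteq> s"
    show "\<omega> s i = l i"
    proof (cases "s \<le> u")
      case True
      have "l = left_state \<beta> \<xi> h s"
        using tendsto_config_unique[OF _ l left_before[OF s True]] by simp
      then have l': "(flow \<beta> \<xi> h \<longlongrightarrow> l) (at_left s)" using flow_left[OF h s] by simp
      have k': "\<forall>k. ring_time h i k \<noteq> s" using splice_ring_before(1)[OF rh rh' u True] k by blast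
      show ?thesis
        using flow_driven[OF h, of \<beta> \<xi>] s l' k' before[of s] True unfolding driven_by_def by auto
    next
      case False
      then have su: "u < s" "0 < s - u" by auto
      have "l = left_state \<beta> \<zeta> h' (s - u)"
        using tendsto_config_unique[OF _ l left_after[OF su(1)]] by simp
      then have l': "(flow \<beta> \<zeta> h' \<longlongrightarrow> l) (at_left (s - u))" using flow_left[OF h' su(2)] by simp
      have k': "\<forall>k. ring_time h' i k \<noteq> s - u" using splice_ring_after(1)[OF rh rh' u su(1)] k by blast
      show ?thesis
        using flow_driven[OF h', of \<beta> \<zeta>] su l' k' after[of s] unfolding driven_by_def by auto
    qed
  qed
  from driven_by_unique[OF g sko this] show ?thesis
    using after[of "u + t"] t by (simp add: \<zeta>_def)
qed

text \<open>A spliced representation is again a typical one, so the path under it almost surely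
  stays in \<open>C\<close>. By Fubini, for almost every \<open>h\<close> this holds for almost
  every \<open>h'\<close>, and after time \<open>u\<close> that path is the one driven by
  \<open>h'\<close> from the configuration reached at \<open>u\<close>.\<close>

lemma survival_set_absorbing:
  assumes C: "tame C" and \<xi>: "\<xi> \<in> survival_set \<beta> C" and u: "0 \<le> u"
  shows "AE h in harris_space. path \<beta> \<xi> h u \<in> survival_set \<beta> C"
proof -
  interpret P: pair_sigma_finite harris_space harris_space by unfold_locales
  let ?Q = "\<lambda>h. path \<beta> \<xi> h \<in> staying_paths C \<and> good h"
  have "AE h in harris_space. ?Q h"
    using \<xi> AE_good unfolding survival_set_iff[OF C] by auto
  then have "AE h in distr (harris_space \<Otimes>\<^sub>M harris_space) harris_space (\<lambda>(h, h'). splice u h h'). ?Q h"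
    unfolding distr_splice[OF u] .
  then have "AE x in harris_space \<Otimes>\<^sub>M harris_space. ?Q ((\<lambda>(h, h'). splice u h h') x)"
    by (rule AE_distrD[rotated]) (simp add: split_beta')
  from P.AE_pair[OF this] have "AE h in harris_space. AE h' in harris_space. ?Q (splice u h h')" by simp
  with AE_good show ?thesis
  proof eventually_elim
    case (elim h)
    define \<zeta> where "\<zeta> = path \<beta> \<xi> h u"
    have \<zeta>: "\<zeta> = flow \<beta> \<xi> h u" using elim(1) by (simp add: \<zeta>_def path_def)
    have ae: "AE h' in harris_space. path \<beta> \<zeta> h' \<in> staying_paths C"
      using elim(2) AE_good
    proof eventually_elim
      case (elim h')
      have "path \<beta> \<zeta> h' t \<in> C" if t: "0 \<le> t" for t
      proof -
        have "path \<beta> \<zeta> h' t = flow \<beta> \<xi> (splice u h h') (u + t)"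
          using flow_splice[OF \<open>good h\<close> elim(2) _ u t, of \<beta> \<xi>] elim(1,2) by (simp add: \<zeta> path_def)
        also have "\<dots> = path \<beta> \<xi> (splice u h h') (u + t)" using elim(1) by (simp add: path_def)
        also have "\<dots> \<in> C" using elim(1) u t by (simp add: staying_paths_def)
        finally show ?thesis .
      qed
      then show ?case using path_skorokhod by (auto simp: staying_paths_def)
    qed
    \<comment> \<open>An event of full measure is nonempty; any such path lies in \<open>C\<close>
      at time 0, where it equals \<open>\<zeta>\<close>.\<close>
    obtain h' where "path \<beta> \<zeta> h' \<in> staying_paths C"
      using eventually_happens'[OF harris.ae_filter_bot ae] by blast
    then have "path \<beta> \<zeta> h' 0 \<in> C" by (simp add: staying_paths_def)
    then have "\<zeta> \<in> C" by (simp add: path_0)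
    with ae show ?case unfolding survival_set_iff[OF C] \<zeta>_def[symmetric] by blast
  qed
qed

lemma survival_set_kernel:
  assumes C: "tame C" and \<xi>: "\<xi> \<in> survival_set \<beta> C" and u: "0 \<le> u"
  shows "emeasure (completion (glauber_kernel \<beta> u \<xi>)) (survival_set \<beta> C) = 1"
proof -
  have m: "(\<lambda>h. path \<beta> \<xi> h u) \<in> harris_space \<rightarrow>\<^sub>M borel"
    by (rule measurable_compose[OF measurable_path_harris measurable_path_coordinate[OF u]])
  interpret K: prob_space "glauber_kernel \<beta> u \<xi>"
    unfolding glauber_kernel_eq[OF u] by (rule harris.prob_space_distr[OF m])
  have S: "survival_set \<beta> C \<in> sets (glauber_kernel \<beta> u \<xi>)"
    using sets_survival_set[OF C] by (simp add: glauber_kernel_eq[OF u])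
  have "AE \<sigma> in glauber_kernel \<beta> u \<xi>. \<sigma> \<in> survival_set \<beta> C"
    unfolding glauber_kernel_eq[OF u]
    using survival_set_absorbing[OF C \<xi> u] sets_survival_set[OF C] by (subst AE_distr_iff[OF m]) auto
  then have "emeasure (glauber_kernel \<beta> u \<xi>) (survival_set \<beta> C) = 1"
    using K.AE_in_set_eq_1[OF S] by (simp add: K.emeasure_eq_measure)
  then show ?thesis using S by simp
qed

section \<open>Antiperiodic configurations\<close>

text \<open>The sum over a box is minus the sum over its translate, so twice the sum lives on the
  symmetric difference of the two. That is a boundary layer of order \<open>n\<close> sites against
  order n^2 in the box.\<close>

lemma avg_antiperiodic:
  fixes e :: "site \<Rightarrow> real"
  assumes anti: "\<And>i. e i = - e (i - v)" and bound: "\<And>i. \<bar>e i\<bar> \<le> 1"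
  shows "(\<lambda>n. avg n e) \<longlonglongrightarrow> 0"
proof -
  define c where "c = real_of_int (\<bar>fst v\<bar> + \<bar>snd v\<bar>)"
  \<comment> \<open>In one coordinate a shift by \<open>a\<close> pushes at most |a| points out, all
    at one end.\<close>
  have edge: "card {x \<in> {- int n..int n}. x + a \<notin> {- int n..int n}} \<le> nat \<bar>a\<bar>" for n a
  proof -
    have "{x \<in> {- int n..int n}. x + a \<notin> {- int n..int n}} \<subseteq> (if 0 \<le> a then {int n - a + 1..int n} else {- int n..- int n - a - 1})"
      by auto
    then have "card {x \<in> {- int n..int n}. x + a \<notin> {- int n..int n}} \<le>
        card (if 0 \<le> a then {int n - a + 1..int n} else {- int n..- int n - a - 1})"
      by (intro card_mono) auto
    also have "\<dots> = nat \<bar>a\<bar>" by auto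
    finally show ?thesis .
  qed
  have boundary: "card {i \<in> box n. i + w \<notin> box n} \<le> (2 * n + 1) * (nat \<bar>fst w\<bar> + nat \<bar>snd w\<bar>)" for n w
  proof -
    let ?I = "{- int n..int n}"
    let ?X = "\<lambda>a. {x \<in> ?I. x + a \<notin> ?I}"
    have I: "card ?I = 2 * n + 1" by simp
    have fX: "finite (?X a)" for a by (rule finite_subset[of _ ?I]) auto
    have "{i \<in> box n. i + w \<notin> box n} \<subseteq> ?X (fst w) \<times> ?I \<union> ?I \<times> ?X (snd w)"
      by (auto simp: box_def mem_Times_iff)
    then have "card {i \<in> box n. i + w \<notin> box n} \<le> card (?X (fst w) \<times> ?I \<union> ?I \<times> ?X (snd w))"
      by (intro card_mono finite_UnI finite_cartesian_product fX) auto
    also have "\<dots> \<le> card (?X (fst w)) * (2 * n + 1) + (2 * n + 1) * card (?X (snd w))"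
      by (rule order_trans[OF card_Un_le]) (simp only: card_cartesian_product I order_refl)
    also have "\<dots> \<le> nat \<bar>fst w\<bar> * (2 * n + 1) + (2 * n + 1) * nat \<bar>snd w\<bar>"
      by (intro add_mono mult_right_mono mult_left_mono edge) auto
    finally show ?thesis by (simp add: algebra_simps)
  qed
  have small: "\<bar>\<Sum>i\<in>box n. e i\<bar> \<le> (2 * real n + 1) * c" for n
  proof -
    let ?S = "box n" and ?S' = "(\<lambda>i. i - v) ` box n"
    have "(\<Sum>i\<in>?S. e i) = (\<Sum>i\<in>?S. - e (i - v))" by (rule sum.cong[OF refl]) (rule anti)
    also have "\<dots> = - (\<Sum>i\<in>?S'. e i)" by (subst sum.reindex) (auto simp: inj_on_def sum_negf)
    finally have "2 * (\<Sum>i\<in>?S. e i) = (\<Sum>i\<in>?S. e i) - (\<Sum>i\<in>?S'. e i)" by simp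
    also have "\<dots> = (\<Sum>i\<in>?S - ?S'. e i) - (\<Sum>i\<in>?S' - ?S. e i)"
    proof -
      have "(\<Sum>i\<in>?S. e i) = (\<Sum>i\<in>?S - ?S'. e i) + (\<Sum>i\<in>?S \<inter> ?S'. e i)"
        "(\<Sum>i\<in>?S'. e i) = (\<Sum>i\<in>?S' - ?S. e i) + (\<Sum>i\<in>?S \<inter> ?S'. e i)"
        by (subst sum.union_disjoint[symmetric]; force intro: sum.cong)+
      then show ?thesis by simp
    qed
    finally have eq: "2 * (\<Sum>i\<in>?S. e i) = (\<Sum>i\<in>?S - ?S'. e i) - (\<Sum>i\<in>?S' - ?S. e i)" .
    have card_bound: "\<bar>\<Sum>i\<in>A. e i\<bar> \<le> real (card A)" if "finite A" for A
      using sum_norm_bound[of A e 1] bound by simp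
    have c: "real ((2 * n + 1) * (nat \<bar>fst v\<bar> + nat \<bar>snd v\<bar>)) = (2 * real n + 1) * c"
      by (simp add: c_def algebra_simps)
    have "?S - ?S' \<subseteq> {i \<in> box n. i + v \<notin> box n}" by (auto simp: image_iff) (metis add_diff_cancel_right')
    then have "card (?S - ?S') \<le> (2 * n + 1) * (nat \<bar>fst v\<bar> + nat \<bar>snd v\<bar>)"
      by (intro order_trans[OF card_mono boundary]) auto
    then have 1: "real (card (?S - ?S')) \<le> (2 * real n + 1) * c" unfolding c[symmetric] of_nat_le_iff .
    have "?S' - ?S \<subseteq> (\<lambda>i. i - v) ` {i \<in> box n. i + - v \<notin> box n}" by auto
    then have "card (?S' - ?S) \<le> card ((\<lambda>i. i - v) ` {i \<in> box n. i + - v \<notin> box n})"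
      by (intro card_mono) auto
    also have "\<dots> \<le> card {i \<in> box n. i + - v \<notin> box n}" by (intro card_image_le) auto
    also have "\<dots> \<le> (2 * n + 1) * (nat \<bar>fst (- v)\<bar> + nat \<bar>snd (- v)\<bar>)" by (rule boundary)
    finally have "card (?S' - ?S) \<le> (2 * n + 1) * (nat \<bar>fst v\<bar> + nat \<bar>snd v\<bar>)" by simp
    then have 2: "real (card (?S' - ?S)) \<le> (2 * real n + 1) * c" unfolding c[symmetric] of_nat_le_iff .
    show ?thesis
      using eq card_bound[of "?S - ?S'"] card_bound[of "?S' - ?S"] 1 2 by simp
  qed
  have le: "\<bar>avg n e\<bar> \<le> c / (2 * real n + 1)" for n
  proof -
    have "\<bar>avg n e\<bar> = \<bar>\<Sum>i\<in>box n. e i\<bar> / (2 * real n + 1)\<^sup>2"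
      by (simp add: avg_def card_box abs_divide)
    also have "\<dots> \<le> ((2 * real n + 1) * c) / (2 * real n + 1)\<^sup>2"
      by (intro divide_right_mono small) simp
    also have "\<dots> = c / (2 * real n + 1)" by (simp add: power2_eq_square)
    finally show ?thesis .
  qed
  have "(\<lambda>n. c / (2 * real n + 1)) \<longlonglongrightarrow> 0" by real_asymp
  then show ?thesis
    by (rule Lim_null_comparison[rotated]) (use le in \<open>simp add: always_eventually\<close>)
qed

lemma flip_flip: "flip (flip \<sigma>) = \<sigma>"
  by (simp add: flip_def)

lemma spin_not: "spin (\<not> b) = - spin b"
  by (simp add: spin_def)

text \<open>Flipping negates the sum of the neighbouring spins, and the logistic function L
  satisfies L(-y) = 1 - L(y).\<close>

lemma plus_prob_flip_translate:
  "plus_prob \<beta> (flip (translate v l)) i = 1 - plus_prob \<beta> l (i - v)"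
proof -
  have "(\<Sum>j | adjacent i j. spin (flip (translate v l) j)) = - (\<Sum>j | adjacent i j. spin (l (j - v)))"
    by (simp add: flip_def translate_def spin_not sum_negf)
  also have "(\<Sum>j | adjacent i j. spin (l (j - v))) = (\<Sum>j | adjacent (i - v) j. spin (l j))"
    by (rule sum.reindex_bij_witness[of _ "\<lambda>j. j + v" "\<lambda>j. j - v"]) (auto simp: adjacent_def)
  finally have sum: "(\<Sum>j | adjacent i j. spin (flip (translate v l) j)) = - (\<Sum>j | adjacent (i - v) j. spin (l j))" .
  have "1 / (1 + exp y) = 1 - 1 / (1 + exp (- y))" for y :: real
    using add_pos_pos[OF zero_less_one exp_gt_zero, of y] by (simp add: exp_minus field_simps)
  from this[of "2 * \<beta> * (\<Sum>j | adjacent (i - v) j. spin (l j))"] show ?thesis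
    unfolding plus_prob_def sum by simp
qed

text \<open>The transformed path is driven by the transformed representation, so uniqueness
  applies.\<close>

lemma flow_flip_translate:
  assumes h: "good h" and h': "good (harris_flip (harris_shift v h))"
    and ties: "\<And>p \<sigma> i. snd (h p) \<noteq> plus_prob \<beta> \<sigma> i" and t: "0 \<le> t"
  shows "flow \<beta> (flip (translate v \<xi>)) (harris_flip (harris_shift v h)) t = flip (translate v (flow \<beta> \<xi> h t))"
proof -
  let ?h = "harris_flip (harris_shift v h)"
  define \<omega> where "\<omega> = (\<lambda>t\<in>{0..}. flip (translate v (flow \<beta> \<xi> h t)))"
  have \<omega>: "\<omega> s i \<longleftrightarrow> \<not> flow \<beta> \<xi> h s (i - v)" if "0 \<le> s" for s i
    using that by (simp add: \<omega>_def flip_def translate_def)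
  have rt: "ring_time ?h i k = ring_time h (i - v) k" and rm: "ring_mark ?h i k = 1 - ring_mark h (i - v) k" for i k
    by (simp_all add: ring_time_def ring_mark_def harris_flip_def harris_shift_def)
  have left: "(\<omega> \<longlongrightarrow> flip (translate v (left_state \<beta> \<xi> h s))) (at_left s)" if s: "0 < s" for s
    unfolding tendsto_config_iff
  proof
    fix i
    have "\<forall>\<^sub>F r in at_left s. flow \<beta> \<xi> h r (i - v) = left_state \<beta> \<xi> h s (i - v)"
      using flow_left[OF h s, of \<beta> \<xi>] unfolding tendsto_config_iff by blast
    with eventually_at_left_real[OF s]
    show "\<forall>\<^sub>F r in at_left s. \<omega> r i = flip (translate v (left_state \<beta> \<xi> h s)) i"
      by eventually_elim (simp add: \<omega> flip_def translate_def)
  qed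
  have sko: "\<omega> \<in> skorokhod"
  proof -
    have "(\<omega> \<longlongrightarrow> \<omega> s) (at_right s)" if s: "0 \<le> s" for s
      unfolding tendsto_config_iff
    proof
      fix i
      from skorokhod_right[OF flow_skorokhod[OF h] s, of \<beta> \<xi> "i - v"] eventually_at_right_less[of s]
      show "\<forall>\<^sub>F r in at_right s. \<omega> r i = \<omega> s i"
        by eventually_elim (use s \<omega> in auto)
    qed
    then show ?thesis unfolding skorokhod_def cadlag_def using left by (auto simp: \<omega>_def)
  qed
  have "driven_by \<beta> (flip (translate v \<xi>)) ?h \<omega>"
    unfolding driven_by_def
  proof (intro conjI allI impI)
    show "\<omega> 0 = flip (translate v \<xi>)"
      using flow_driven[OF h, of \<beta> \<xi>] by (simp add: \<omega>_def driven_by_def)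
  next
    fix s :: real and l :: config and i k
    assume s: "0 < s" and l: "(\<omega> \<longlongrightarrow> l) (at_left s)" and k: "ring_time ?h i k = s"
    let ?l = "left_state \<beta> \<xi> h s"
    have l: "l = flip (translate v ?l)"
      using tendsto_config_unique[OF _ l left[OF s]] by simp
    have "ring_time h (i - v) k = s" using k rt by simp
    then have "flow \<beta> \<xi> h s (i - v) = (ring_mark h (i - v) k \<le> plus_prob \<beta> ?l (i - v))"
      using flow_driven[OF h, of \<beta> \<xi>] s flow_left[OF h s, of \<beta> \<xi>] unfolding driven_by_def by blast
    \<comment> \<open>Negating \<open>mark \<le> p\<close> gives \<open>p < mark\<close>, while the
      reflected rule reads \<open>p \<le> mark\<close>; they agree once ties are excluded.\<close>
    moreover have "ring_mark h (i - v) k \<noteq> plus_prob \<beta> ?l (i - v)" unfolding ring_mark_def by (rule ties)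
    ultimately show "\<omega> s i = (ring_mark ?h i k \<le> plus_prob \<beta> l i)"
      using s unfolding l rm plus_prob_flip_translate by (auto simp: \<omega>)
  next
    fix s :: real and l :: config and i
    assume s: "0 < s" and l: "(\<omega> \<longlongrightarrow> l) (at_left s)" and k: "\<forall>k. ring_time ?h i k \<noteq> s"
    let ?l = "left_state \<beta> \<xi> h s"
    have l: "l = flip (translate v ?l)"
      using tendsto_config_unique[OF _ l left[OF s]] by simp
    have "\<forall>k. ring_time h (i - v) k \<noteq> s" using k rt by simp
    then have "flow \<beta> \<xi> h s (i - v) = ?l (i - v)"
      using flow_driven[OF h, of \<beta> \<xi>] s flow_left[OF h s, of \<beta> \<xi>] unfolding driven_by_def by blast
    then show "\<omega> s i = l i" using s unfolding l by (simp add: \<omega> flip_def translate_def)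
  qed
  from fun_cong[OF driven_by_unique[OF h' sko this], of t] show ?thesis using t by (simp add: \<omega>_def)
qed

text \<open>The composed translation and flip fixes \<open>\<eta>\<close>, and the same operations
  on clocks and marks preserve \<open>harris_space\<close>; transporting the expectation shifts the
  site by \<open>v\<close> and reverses the spin.\<close>

lemma mean_spin_antiperiodic:
  assumes \<eta>: "translate v \<eta> = flip \<eta>" and t: "0 \<le> t"
  shows "mean_spin \<beta> \<eta> t i = - mean_spin \<beta> \<eta> t (i - v)"
proof -
  let ?H = harris_space and ?T = "\<lambda>h. harris_flip (harris_shift v h)"
  have T: "?T \<in> ?H \<rightarrow>\<^sub>M ?H"
    by (rule measurable_compose[OF measurable_harris_shift measurable_harris_flip])
  have dT: "distr ?H ?H ?T = ?H"
    using distr_distr[OF measurable_harris_flip measurable_harris_shift, of v]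
    by (simp add: distr_harris_shift distr_harris_flip comp_def)
  have "AE h in distr ?H ?H ?T. good h" unfolding dT by (rule AE_good)
  then have gT: "AE h in ?H. good (?T h)" by (rule AE_distrD[OF T])
  have m: "(\<lambda>h. spin (state \<beta> \<eta> h t i)) \<in> borel_measurable ?H"
    by (intro measurable_spin pred_state[where f="\<lambda>_. \<eta>" and g="\<lambda>h. h"]) auto
  have m': "(\<lambda>h. - spin (state \<beta> \<eta> h t (i - v))) \<in> borel_measurable ?H"
    by (intro borel_measurable_uminus measurable_spin pred_state[where f="\<lambda>_. \<eta>" and g="\<lambda>h. h"]) auto
  have "mean_spin \<beta> \<eta> t i = (\<integral>h. spin (state \<beta> \<eta> h t i) \<partial>distr ?H ?H ?T)"
    unfolding mean_spin_def dT ..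
  also have "\<dots> = (\<integral>h. spin (state \<beta> \<eta> (?T h) t i) \<partial>?H)"
    by (rule integral_distr[OF T m])
  also have "\<dots> = (\<integral>h. - spin (state \<beta> \<eta> h t (i - v)) \<partial>?H)"
  proof (rule integral_cong_AE)
    show "(\<lambda>h. spin (state \<beta> \<eta> (?T h) t i)) \<in> borel_measurable ?H"
      by (rule measurable_compose[OF T m])
    show "AE h in ?H. spin (state \<beta> \<eta> (?T h) t i) = - spin (state \<beta> \<eta> h t (i - v))"
      using AE_good gT AE_marks_not_plus_prob[of \<beta>]
    proof eventually_elim
      case (elim h)
      have "flow \<beta> (flip (translate v \<eta>)) (?T h) t = flip (translate v (flow \<beta> \<eta> h t))"
        using elim t by (intro flow_flip_translate) auto
      then have "state \<beta> \<eta> (?T h) t = flip (translate v (state \<beta> \<eta> h t))"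
        using t by (simp add: \<eta> flip_flip flow_def)
      then show ?case by (simp add: flip_def translate_def spin_not)
    qed
  qed (rule m')
  also have "\<dots> = - mean_spin \<beta> \<eta> t (i - v)" by (simp add: mean_spin_def)
  finally show ?thesis .
qed

lemma abs_mean_spin_le: "\<bar>mean_spin \<beta> \<xi> t i\<bar> \<le> 1"
proof -
  have "\<bar>mean_spin \<beta> \<xi> t i\<bar> \<le> (\<integral>h. \<bar>spin (state \<beta> \<xi> h t i)\<bar> \<partial>harris_space)"
    unfolding mean_spin_def by (rule integral_abs_bound)
  then show ?thesis by (simp add: harris.prob_space[unfolded space_harris])
qed

text \<open>At each rational time concentration around a vanishing mean gives limit 0 almost surely;
  regularity of the path extends this to all times, and time 0 shows that \<open>\<eta>\<close>
  itself lies in the sector.\<close>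

lemma antiperiodic_survival:
  assumes \<eta>: "translate v \<eta> = flip \<eta>"
  shows "\<eta> \<in> survival_set \<beta> zero_sector"
proof -
  have "AE h in harris_space. \<forall>q::rat. 0 \<le> q \<longrightarrow> (\<lambda>n. block_mag n (path \<beta> \<eta> h (of_rat q))) \<longlonglongrightarrow> 0"
    unfolding AE_all_countable
  proof
    fix q :: rat
    show "AE h in harris_space. 0 \<le> q \<longrightarrow> (\<lambda>n. block_mag n (path \<beta> \<eta> h (of_rat q))) \<longlonglongrightarrow> 0"
    proof (cases "0 \<le> q")
      case True
      then have t: "0 \<le> (of_rat q :: real)" by simp
      have mean: "(\<lambda>n. avg n (mean_spin \<beta> \<eta> (of_rat q))) \<longlonglongrightarrow> 0"
        by (rule avg_antiperiodic, rule mean_spin_antiperiodic[OF \<eta> t], rule abs_mean_spin_le)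
      from AE_block_mag_concentration[of \<beta> \<eta> "of_rat q"] AE_good show ?thesis
      proof eventually_elim
        case (elim h)
        from tendsto_add[OF elim(1) mean] show ?case using path_good[OF elim(2) t] by simp
      qed
    qed simp
  qed
  then have ae: "AE h in harris_space. path \<beta> \<eta> h \<in> staying_paths zero_sector"
    using AE_path_regular[of \<beta> \<eta>]
  proof eventually_elim
    case (elim h)
    then show ?case
      using limit_iff_rational[OF elim(2), of 0] path_skorokhod by (auto simp: staying_paths_def zero_sector_def)
  qed
  then obtain h where "path \<beta> \<eta> h \<in> staying_paths zero_sector"
    using eventually_happens'[OF harris.ae_filter_bot] by blast
  then have "path \<beta> \<eta> h 0 \<in> zero_sector" by (simp add: staying_paths_def)
  then have "\<eta> \<in> zero_sector" by (simp add: path_0)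
  with ae show ?thesis unfolding survival_set_iff[OF tame_zero] by simp
qed

text \<open>Repeat the strip of width 2n + 1 of \<open>\<sigma>\<close> around the origin
  horizontally, flipping every other copy: translation by one width is then the flip, and on the
  central strip the result equals \<open>\<sigma>\<close>. The strips exhaust the plane as
  \<open>n\<close> grows.\<close>

lemma closure_antiperiodic: "closure {\<eta>. \<exists>v. translate v \<eta> = flip \<eta>} = UNIV"
proof -
  have "\<sigma> \<in> closure {\<eta>. \<exists>v. translate v \<eta> = flip \<eta>}" for \<sigma> :: config
  proof -
    define N where "N n = 2 * int n + 1" for n
    define \<eta> where "\<eta> n i = (\<sigma> ((fst i + int n) mod N n - int n, snd i) \<noteq> odd ((fst i + int n) div N n))" for n and i :: site
    have "translate (N n, 0) (\<eta> n) = flip (\<eta> n)" for n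
    proof
      fix i :: site
      have N: "N n \<noteq> 0" unfolding N_def by presburger
      have e: "fst i - N n + int n = (fst i + int n) + (- 1) * N n" by simp
      have "(fst i - N n + int n) div N n = (fst i + int n) div N n - 1"
        "(fst i - N n + int n) mod N n = (fst i + int n) mod N n"
        unfolding e by (subst div_mult_self1[OF N], simp_all)
      then show "translate (N n, 0) (\<eta> n) i = flip (\<eta> n) i"
        by (simp add: translate_def flip_def \<eta>_def)
    qed
    then have "\<eta> n \<in> closure {\<eta>. \<exists>v. translate v \<eta> = flip \<eta>}" for n
      by (intro subsetD[OF closure_subset]) blast
    moreover have "\<eta> \<longlonglongrightarrow> \<sigma>"
      unfolding tendsto_config_iff
    proof
      fix i :: site
      show "\<forall>\<^sub>F n in sequentially. \<eta> n i = \<sigma> i"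
        unfolding eventually_sequentially
      proof (intro exI allI impI)
        fix n assume n: "nat \<bar>fst i\<bar> \<le> n"
        then have r: "0 \<le> fst i + int n" "fst i + int n < N n" by (auto simp: N_def)
        show "\<eta> n i = \<sigma> i" unfolding \<eta>_def by (simp add: div_pos_pos_trivial[OF r] mod_pos_pos_trivial[OF r])
      qed
    qed
    ultimately show ?thesis
      by (intro Lim_in_closed_set[of _ \<eta> sequentially]) auto
  qed
  then show ?thesis by blast
qed

section \<open>The spontaneous magnetization at infinite temperature\<close>

lemma continuous_on_local:
  fixes f :: "config \<Rightarrow> real"
  assumes "finite J" "\<And>\<sigma> \<tau>. (\<forall>i\<in>J. \<sigma> i = \<tau> i) \<Longrightarrow> f \<sigma> = f \<tau>"
  shows "continuous_on UNIV f"
  unfolding continuous_on_def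
proof
  fix \<sigma> :: config
  have "((\<lambda>x. x) \<longlongrightarrow> \<sigma>) (at \<sigma>)" by (rule tendsto_ident_at)
  then have "\<forall>\<^sub>F x in at \<sigma>. \<forall>i\<in>J. x i = \<sigma> i"
    unfolding tendsto_config_iff using assms(1) by (intro eventually_ball_finite) auto
  then have "\<forall>\<^sub>F x in at \<sigma>. f x = f \<sigma>" by eventually_elim (rule assms(2))
  then show "(f \<longlongrightarrow> f \<sigma>) (at \<sigma> within UNIV)" by (rule tendsto_eventually)
qed

text \<open>Indicators of cylinder sets depend on finitely many discrete spins, hence are
  continuous, and the limits of \<open>plus_expectation\<close> fix their integrals. This justifies
  evaluating the \<open>THE\<close> in \<open>plus_phase\<close> through any candidate.\<close>

lemma is_plus_phase_unique:
  assumes \<mu>: "is_plus_phase \<beta> \<mu>" and \<nu>: "is_plus_phase \<beta> \<nu>"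
  shows "\<mu> = \<nu>"
proof (rule measure_eqI_PiM_infinite)
  interpret \<mu>: prob_space \<mu> using \<mu> by (simp add: is_plus_phase_def)
  interpret \<nu>: prob_space \<nu> using \<nu> by (simp add: is_plus_phase_def)
  have s: "sets \<mu> = sets borel" "sets \<nu> = sets borel" using \<mu> \<nu> by (simp_all add: is_plus_phase_def)
  show "sets \<mu> = sets (Pi\<^sub>M UNIV (\<lambda>_ :: site. borel :: bool measure))"
    "sets \<nu> = sets (Pi\<^sub>M UNIV (\<lambda>_ :: site. borel :: bool measure))"
    unfolding s by (rule sets_PiM_equal_borel[symmetric])+
  show "finite_measure \<mu>" by (rule \<mu>.finite_measure_axioms)
  fix A :: "site \<Rightarrow> bool set" and J :: "site set" assume J: "finite J"
  let ?X = "{\<sigma>. \<forall>i\<in>J. \<sigma> i \<in> A i}"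
  have X: "prod_emb UNIV (\<lambda>_. borel) J (Pi\<^sub>E J A) = ?X"
    by (auto simp: prod_emb_def PiE_iff)
  have "{\<sigma> \<in> space borel. \<forall>i\<in>J. \<sigma> i \<in> A i} \<in> sets (borel :: config measure)"
    using J by measurable
  then have Xs: "?X \<in> sets \<mu>" "?X \<in> sets \<nu>" by (simp_all add: s)
  have "continuous_on UNIV (indicator ?X :: config \<Rightarrow> real)"
    by (rule continuous_on_local[OF J]) (auto simp: indicator_def)
  then have "(\<lambda>n. plus_expectation \<beta> n (indicator ?X)) \<longlonglongrightarrow> (\<integral>\<sigma>. indicator ?X \<sigma> \<partial>\<mu>)"
    "(\<lambda>n. plus_expectation \<beta> n (indicator ?X)) \<longlonglongrightarrow> (\<integral>\<sigma>. indicator ?X \<sigma> \<partial>\<nu>)"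
    using \<mu> \<nu> unfolding is_plus_phase_def by blast+
  then have "(\<integral>\<sigma>. indicator ?X \<sigma> \<partial>\<mu>) = (\<integral>\<sigma>. indicator ?X \<sigma> \<partial>\<nu> :: real)" by (rule LIMSEQ_unique)
  then have "measure \<mu> ?X = measure \<nu> ?X" using Xs by simp
  then show "emeasure \<mu> (prod_emb UNIV (\<lambda>_. borel) J (Pi\<^sub>E J A)) = emeasure \<nu> (prod_emb UNIV (\<lambda>_. borel) J (Pi\<^sub>E J A))"
    unfolding X by (simp add: \<mu>.emeasure_eq_measure \<nu>.emeasure_eq_measure)
qed

lemma compact_config: "compact (UNIV :: config set)"
proof -
  have "compact_space (euclidean :: bool topology)"
    by (simp add: compact_space_def finite_imp_compact)
  then have "compact_space (product_topology (\<lambda>_ :: site. euclidean :: bool topology) UNIV)"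
    by (simp add: compact_space_product_topology)
  then show ?thesis
    by (simp add: compact_space_def euclidean_product_topology)
qed

definition fair_coins :: "config measure" where
  "fair_coins = distr (Pi\<^sub>M UNIV (\<lambda>_. measure_pmf (pmf_of_set UNIV))) borel (\<lambda>\<sigma>. \<sigma>)"

lemma measurable_fair_coins:
  "(\<lambda>\<sigma>. \<sigma>) \<in> Pi\<^sub>M UNIV (\<lambda>_ :: site. measure_pmf (pmf_of_set (UNIV :: bool set))) \<rightarrow>\<^sub>M borel"
proof (rule measurable_configI)
  fix i :: site
  have "(\<lambda>\<sigma>. \<sigma> i) \<in> Pi\<^sub>M UNIV (\<lambda>_ :: site. measure_pmf (pmf_of_set (UNIV :: bool set))) \<rightarrow>\<^sub>M measure_pmf (pmf_of_set UNIV)"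
    by (rule measurable_component_singleton) simp
  then show "Measurable.pred (Pi\<^sub>M UNIV (\<lambda>_ :: site. measure_pmf (pmf_of_set (UNIV :: bool set)))) (\<lambda>\<sigma>. \<sigma> i)"
    by (simp cong: measurable_cong_sets)
qed

lemma prob_space_fair_coins: "prob_space fair_coins"
  unfolding fair_coins_def
  by (intro prob_space.prob_space_distr measurable_fair_coins prob_space_PiM) (rule prob_space_measure_pmf)

lemma measure_fair_coins:
  assumes J: "finite J"
  shows "measure fair_coins {\<sigma>. \<forall>i\<in>J. \<sigma> i = \<tau> i} = (1/2) ^ card J"
proof -
  interpret P: product_prob_space "\<lambda>_ :: site. measure_pmf (pmf_of_set (UNIV :: bool set))" UNIV
    by unfold_locales
  let ?C = "{\<sigma>. \<forall>i\<in>J. \<sigma> i = \<tau> i}"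
  have "{\<sigma> \<in> space borel. \<forall>i\<in>J. \<sigma> i = \<tau> i} \<in> sets (borel :: config measure)" using J by measurable
  then have "?C \<in> sets (borel :: config measure)" by simp
  then have "emeasure fair_coins ?C =
      emeasure (Pi\<^sub>M UNIV (\<lambda>_ :: site. measure_pmf (pmf_of_set (UNIV :: bool set))))
        {\<sigma> \<in> space (Pi\<^sub>M UNIV (\<lambda>_ :: site. measure_pmf (pmf_of_set (UNIV :: bool set)))). \<forall>i\<in>J. \<sigma> i \<in> {\<tau> i}}"
    unfolding fair_coins_def by (subst emeasure_distr[OF measurable_fair_coins]) (auto intro!: arg_cong2[where f=emeasure])
  also have "\<dots> = (\<Prod>i\<in>J. emeasure (measure_pmf (pmf_of_set (UNIV :: bool set))) {\<tau> i})"
    using J by (intro P.emeasure_PiM_Collect) auto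
  also have "\<dots> = (\<Prod>i\<in>J. ennreal (1/2))"
  proof (rule prod.cong[OF refl])
    have "pmf (pmf_of_set UNIV) b = 1 / 2" for b :: bool by simp
    then show "emeasure (measure_pmf (pmf_of_set UNIV)) {\<tau> i} = ennreal (1/2)" for i
      by (simp only: emeasure_pmf_single)
  qed
  also have "\<dots> = ennreal ((1/2) ^ card J)"
    by (subst prod_constant) (rule ennreal_power, simp)
  finally show ?thesis by (simp add: measure_def)
qed

text \<open>At \<open>\<beta> = 0\<close> all weights are 1, so the finite-volume measure is uniform
  on \<open>plus_configs n\<close>; fair coins with everything outside the box overwritten by plus
  have this law.\<close>

lemma plus_expectation_fair_coins:
  fixes f :: "config \<Rightarrow> real"
  shows "plus_expectation 0 n f = (\<integral>\<sigma>. f (\<lambda>i. \<sigma> i \<or> i \<notin> box n) \<partial>fair_coins)"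
proof -
  interpret F: prob_space fair_coins by (rule prob_space_fair_coins)
  have sF: "sets fair_coins = sets borel" by (simp add: fair_coins_def)
  let ?\<pi> = "\<lambda>\<sigma> i. \<sigma> i \<or> i \<notin> box n"
  let ?c = "(1/2 :: real) ^ card (box n)"
  have "plus_configs n \<subseteq> (\<lambda>A i. i \<in> A \<or> i \<notin> box n) ` Pow (box n)"
  proof
    fix \<sigma> assume "\<sigma> \<in> plus_configs n"
    then have "\<sigma> = (\<lambda>i. i \<in> {i \<in> box n. \<sigma> i} \<or> i \<notin> box n)" by (auto simp: plus_configs_def)
    then show "\<sigma> \<in> (\<lambda>A i. i \<in> A \<or> i \<notin> box n) ` Pow (box n)" by blast
  qed
  then have fin: "finite (plus_configs n)" by (rule finite_subset) simp
  have key: "(\<integral>\<sigma>. g (?\<pi> \<sigma>) \<partial>fair_coins) = (\<Sum>\<tau>\<in>plus_configs n. g \<tau>) * ?c" for g :: "config \<Rightarrow> real"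
  proof -
    let ?C = "\<lambda>\<tau>. {\<sigma>. \<forall>i\<in>box n. \<sigma> i = \<tau> i}"
    have "{\<sigma> \<in> space borel. \<forall>i\<in>box n. \<sigma> i = \<tau> i} \<in> sets (borel :: config measure)" for \<tau> :: config by measurable
    then have C: "?C \<tau> \<in> sets fair_coins" for \<tau> by (simp add: sF)
    have int: "integrable fair_coins (indicator (?C \<tau>) :: config \<Rightarrow> real)" for \<tau>
      by (intro integrable_real_indicator C) (simp add: less_top[symmetric])
    have "g (?\<pi> \<sigma>) = (\<Sum>\<tau>\<in>plus_configs n. g \<tau> * indicator (?C \<tau>) \<sigma>)" for \<sigma>
    proof -
      have "g \<tau> * indicator (?C \<tau>) \<sigma> = (if \<tau> = ?\<pi> \<sigma> then g \<tau> else 0)" if "\<tau> \<in> plus_configs n" for \<tau>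
        using that by (auto simp: plus_configs_def indicator_def fun_eq_iff)
      then have "(\<Sum>\<tau>\<in>plus_configs n. g \<tau> * indicator (?C \<tau>) \<sigma>) = (\<Sum>\<tau>\<in>plus_configs n. if \<tau> = ?\<pi> \<sigma> then g \<tau> else 0)"
        by (intro sum.cong) auto
      also have "\<dots> = g (?\<pi> \<sigma>)" using fin by (simp add: sum.delta plus_configs_def)
      finally show ?thesis ..
    qed
    then have "(\<integral>\<sigma>. g (?\<pi> \<sigma>) \<partial>fair_coins) = (\<integral>\<sigma>. (\<Sum>\<tau>\<in>plus_configs n. g \<tau> * indicator (?C \<tau>) \<sigma>) \<partial>fair_coins)"
      by simp
    also have "\<dots> = (\<Sum>\<tau>\<in>plus_configs n. g \<tau> * measure fair_coins (?C \<tau>))"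
      using C int by (subst Bochner_Integration.integral_sum) auto
    also have "\<dots> = (\<Sum>\<tau>\<in>plus_configs n. g \<tau>) * ?c"
      by (simp add: measure_fair_coins sum_distrib_right)
    finally show ?thesis .
  qed
  \<comment> \<open>The constant function 1 computes the normalization.\<close>
  have 1: "real (card (plus_configs n)) * ?c = 1" using key[of "\<lambda>_. 1"] F.prob_space by simp
  then have "real (card (plus_configs n)) = 2 ^ card (box n)" by (simp add: field_simps power_divide)
  then show ?thesis unfolding key plus_expectation_def by (simp add: power_divide)
qed

text \<open>Overwriting outside ever larger boxes converges pointwise to the identity, and
  continuous functions on the compact configuration space are bounded, so dominated convergence
  applies.\<close>

lemma is_plus_phase_0: "is_plus_phase 0 fair_coins"
  unfolding is_plus_phase_def
proof (intro conjI allI impI prob_space_fair_coins)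
  interpret F: prob_space fair_coins by (rule prob_space_fair_coins)
  show sF: "sets fair_coins = sets borel" by (simp add: fair_coins_def)
  fix f :: "config \<Rightarrow> real" assume f: "continuous_on UNIV f"
  have "compact (f ` UNIV)" by (rule compact_continuous_image[OF f compact_config])
  then obtain B where B: "\<And>\<sigma>. \<bar>f \<sigma>\<bar> \<le> B"
    using compact_imp_bounded[THEN bounded_iff[THEN iffD1]] by fastforce
  have mf: "f \<in> borel_measurable fair_coins"
    using borel_measurable_continuous_onI[OF f] by (simp cong: measurable_cong_sets add: sF)
  have m\<pi>: "(\<lambda>\<sigma> i. \<sigma> i \<or> i \<notin> box n) \<in> fair_coins \<rightarrow>\<^sub>M fair_coins" for n
  proof -
    have "(\<lambda>\<sigma> i. \<sigma> i \<or> i \<notin> box n) \<in> borel \<rightarrow>\<^sub>M (borel :: config measure)"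
      by (rule measurable_configI) measurable
    then show ?thesis by (simp cong: measurable_cong_sets add: sF)
  qed
  have "(\<lambda>n. \<integral>\<sigma>. f (\<lambda>i. \<sigma> i \<or> i \<notin> box n) \<partial>fair_coins) \<longlonglongrightarrow> (\<integral>\<sigma>. f \<sigma> \<partial>fair_coins)"
  proof (rule integral_dominated_convergence[where w="\<lambda>_. B"])
    show "(\<lambda>\<sigma>. f (\<lambda>i. \<sigma> i \<or> i \<notin> box n)) \<in> borel_measurable fair_coins" for n
      by (rule measurable_compose[OF m\<pi> mf])
    have "(\<lambda>n. f (\<lambda>i. \<sigma> i \<or> i \<notin> box n)) \<longlonglongrightarrow> f \<sigma>" for \<sigma>
    proof -
      have "(\<lambda>n i. \<sigma> i \<or> i \<notin> box n) \<longlonglongrightarrow> \<sigma>"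
        unfolding tendsto_config_iff
      proof
        fix i :: site
        show "\<forall>\<^sub>F n in sequentially. (\<sigma> i \<or> i \<notin> box n) = \<sigma> i"
          unfolding eventually_sequentially
          by (intro exI[of _ "nat \<bar>fst i\<bar> + nat \<bar>snd i\<bar>"]) (auto simp: box_def mem_Times_iff)
      qed
      from continuous_on_tendsto_compose[OF f this] show ?thesis by simp
    qed
    then show "AE \<sigma> in fair_coins. (\<lambda>n. f (\<lambda>i. \<sigma> i \<or> i \<notin> box n)) \<longlonglongrightarrow> f \<sigma>" by simp
  qed (use mf B in auto)
  then show "(\<lambda>n. plus_expectation 0 n f) \<longlonglongrightarrow> (\<integral>\<sigma>. f \<sigma> \<partial>fair_coins)"
    by (simp only: plus_expectation_fair_coins)
qed

lemma spont_mag_0: "spont_mag 0 = 0"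
proof -
  interpret F: prob_space fair_coins by (rule prob_space_fair_coins)
  have sF: "sets fair_coins = sets borel" by (simp add: fair_coins_def)
  have "{\<sigma> \<in> space borel. \<sigma> (0, 0)} \<in> sets (borel :: config measure)" by measurable
  then have C: "{\<sigma>. \<sigma> (0, 0)} \<in> sets fair_coins" by (simp add: sF)
  have "plus_phase 0 = fair_coins"
    unfolding plus_phase_def using is_plus_phase_0 is_plus_phase_unique by (intro the_equality)
  then have "spont_mag 0 = (\<integral>\<sigma>. 2 * indicator {\<sigma>. \<sigma> (0, 0)} \<sigma> - 1 \<partial>fair_coins)"
    unfolding spont_mag_def by (auto simp: spin_def intro!: Bochner_Integration.integral_cong)
  also have "\<dots> = 2 * measure fair_coins {\<sigma>. \<sigma> (0, 0)} - 1"
  proof -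
    have "integrable fair_coins (indicator {\<sigma>. \<sigma> (0, 0)} :: config \<Rightarrow> real)"
      by (intro integrable_real_indicator C) (simp add: less_top[symmetric])
    then show ?thesis using C F.prob_space by (subst Bochner_Integration.integral_diff) auto
  qed
  also have "\<dots> = 0"
    using measure_fair_coins[of "{(0, 0)}" "\<lambda>_. True"] by simp
  finally show ?thesis .
qed

lemma spont_mag_nonzero:
  assumes "beta_crit < ereal \<beta>"
  shows "spont_mag \<beta> \<noteq> 0"
proof
  assume 0: "spont_mag \<beta> = 0"
  have "ereal 0 \<le> beta_crit" unfolding beta_crit_def by (rule SUP_upper) (simp add: spont_mag_0)
  then have "ereal 0 < ereal \<beta>" using assms by (rule le_less_trans)
  then have "ereal \<beta> \<le> beta_crit" unfolding beta_crit_def using 0 by (intro SUP_upper) simp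
  then show False using assms by simp
qed

theorem theorem9:
  fixes \<beta> :: real
  assumes "beta_crit < ereal \<beta>"
  shows "anti_periodic \<subseteq> survival_set \<beta> zero_sector
    \<and> survival_set \<beta> zero_sector \<subseteq> survival_set \<beta> (rest_sector \<beta>)
    \<and> (\<forall>C \<in> {zero_sector, rest_sector \<beta>}.
         closure (survival_set \<beta> C) = UNIV
         \<and> universally_measurable (survival_set \<beta> C)
         \<and> (\<forall>\<xi> \<in> survival_set \<beta> C. \<forall>u\<ge>0.
               emeasure (completion (glauber_kernel \<beta> u \<xi>)) (survival_set \<beta> C) = 1))"
proof -
  have anti: "{\<eta>. \<exists>v. translate v \<eta> = flip \<eta>} \<subseteq> survival_set \<beta> zero_sector"
    using antiperiodic_survival by blast
  have m: "spont_mag \<beta> \<noteq> 0" by (rule spont_mag_nonzero[OF assms])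
  have "zero_sector \<subseteq> rest_sector \<beta>"
    using m LIMSEQ_unique[of _ 0 "spont_mag \<beta>"] LIMSEQ_unique[of _ 0 "- spont_mag \<beta>"]
    by (auto simp: zero_sector_def rest_sector_def plus_sector_def minus_sector_def)
  moreover from this have "staying_paths zero_sector \<subseteq> staying_paths (rest_sector \<beta>)"
    by (auto simp: staying_paths_def)
  ultimately have sub: "survival_set \<beta> zero_sector \<subseteq> survival_set \<beta> (rest_sector \<beta>)"
    unfolding survival_set_iff[OF tame_zero] survival_set_iff[OF tame_rest] subset_iff
    by (auto elim!: eventually_mono)
  have um: "universally_measurable (survival_set \<beta> C)" if "tame C" for C
    using sets_survival_set[OF that] by (auto simp: universally_measurable_def)
  have dense: "closure (survival_set \<beta> C) = UNIV"
    if "survival_set \<beta> zero_sector \<subseteq> survival_set \<beta> C" for C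
    using closure_mono[OF order_trans[OF anti that]] closure_antiperiodic by blast
  have "anti_periodic \<subseteq> survival_set \<beta> zero_sector"
    using anti by (auto simp: anti_periodic_def)
  then show ?thesis
    using sub um[OF tame_zero] um[OF tame_rest] dense[OF order_refl] dense[OF sub]
      survival_set_kernel[OF tame_zero] survival_set_kernel[OF tame_rest]
    by simp
qed

end
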